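(* The affine Schur functions $\{\tilde F_\lambda\mid\lambda\in\mathcal B^n\}$ form a basis of $\Lambda^{(n)}$.
   Context: $\Lambda$ is the ring of symmetric functions; $\mathcal B^n$ is the set of partitions $\lambda$ with $\lambda_1<n$; $\Lambda^{(n)}=\Lambda/I_{(n)}$ where $I_{(n)}$ is the ideal spanned by the monomial symmetric functions $m_\mu$ with $\mu\notin\mathcal B^n$, so $\{m_\lambda:\lambda\in\mathcal B^n\}$ is a basis of $\Lambda^{(n)}$. $\tilde S_n$ ($n>2$) is realized as bijections $w:\mathbb Z\to\mathbb Z$ with $w(i+n)=w(i)+n$, $\sum_{i=1}^n w(i)=\sum_{i=1}^n i$; $w$ is affine Grassmannian if $w(1)<\cdots<w(n)$. The code $c(u)=(c_1,\ldots,c_n)$, $c_i=\#\{j\in\mathbb Z:j>i,u(j)<u(i)\}$; $\lambda(w)$ is the conjugate of the decreasing rearrangement of $c(w^{-1})$; $w\mapsto\lambda(w)$ is a bijection from affine Grassmannian elements to $\mathcal B^n$. $\tilde F_w=\sum x_1^{\ell(v_1)}x_2^{\ell(v_2)}\cdots$ over infinite sequences of cyclically decreasing elements (having a reduced word with each letter of $\mathbb Z/n\mathbb Z$ at most once and $i+1$ before $i$ when both occur), all but finitely many the identity, with $v_1v_2\cdots=w$, $\sum\ell(v_i)=\ell(w)$. The affine Schur function $\tilde F_\lambda$ is $\tilde F_w$ for the affine Grassmannian $w$ with $\lambda(w)=\lambda$. *)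

theory Defs
  imports Main
begin

definition affine_perm :: "nat \<Rightarrow> (int \<Rightarrow> int) \<Rightarrow> bool" where
  "affine_perm n w \<longleftrightarrow> bij w \<and> (\<forall>i. w (i + int n) = w i + int n)
     \<and> (\<Sum>i\<in>{1..int n}. w i) = (\<Sum>i\<in>{1..int n}. i)"

definition sgen :: "nat \<Rightarrow> nat \<Rightarrow> int \<Rightarrow> int" where
  "sgen n i j = (if j mod int n = int i then j + 1
                 else if j mod int n = (int i + 1) mod int n then j - 1 else j)"

definition word_prod :: "nat \<Rightarrow> nat list \<Rightarrow> int \<Rightarrow> int" where
  "word_prod n ws = foldr (\<lambda>a f. sgen n a \<circ> f) ws id"

definition is_word :: "nat \<Rightarrow> nat list \<Rightarrow> bool" where
  "is_word n ws \<longleftrightarrow> set ws \<subseteq> {0..<n}"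

definition alen :: "nat \<Rightarrow> (int \<Rightarrow> int) \<Rightarrow> nat" where
  "alen n w = (LEAST k. \<exists>ws. is_word n ws \<and> length ws = k \<and> word_prod n ws = w)"

definition reduced_word :: "nat \<Rightarrow> nat list \<Rightarrow> (int \<Rightarrow> int) \<Rightarrow> bool" where
  "reduced_word n ws w \<longleftrightarrow> is_word n ws \<and> word_prod n ws = w \<and> length ws = alen n w"

definition cyc_dec :: "nat \<Rightarrow> (int \<Rightarrow> int) \<Rightarrow> bool" where
  "cyc_dec n v \<longleftrightarrow> (\<exists>ws. reduced_word n ws v \<and> distinct ws \<and>
      (\<forall>p q. p < length ws \<and> q < length ws \<and> ws ! q = (ws ! p + 1) mod n \<longrightarrow> q < p))"

definition aff_grass :: "nat \<Rightarrow> (int \<Rightarrow> int) \<Rightarrow> bool" where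
  "aff_grass n w \<longleftrightarrow> affine_perm n w \<and> (\<forall>i\<in>{1..<int n}. w i < w (i + 1))"

definition is_partition :: "nat list \<Rightarrow> bool" where
  "is_partition \<mu> \<longleftrightarrow> sorted (rev \<mu>) \<and> 0 \<notin> set \<mu>"

definition Bn :: "nat \<Rightarrow> nat list set" where
  "Bn n = {\<mu>. is_partition \<mu> \<and> (\<forall>x\<in>set \<mu>. x < n)}"

definition conj_part :: "nat list \<Rightarrow> nat list" where
  "conj_part \<mu> = map (\<lambda>k. length (filter (\<lambda>x. k \<le> x) \<mu>)) [1..<Suc (fold max \<mu> 0)]"

definition code_entry :: "(int \<Rightarrow> int) \<Rightarrow> int \<Rightarrow> nat" where
  "code_entry u i = card {j. j > i \<and> u j < u i}"

definition lam :: "nat \<Rightarrow> (int \<Rightarrow> int) \<Rightarrow> nat list" where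
  "lam n w = conj_part (rev (sort (map (\<lambda>i. code_entry (inv w) (int i)) [1..<Suc n])))"

section \<open>Formal power series in x_1, x_2, ... (variable x_{i+1} has index i)\<close>

type_synonym fps_inf = "(nat \<Rightarrow> nat) \<Rightarrow> int"

definition fin_monom :: "(nat \<Rightarrow> nat) \<Rightarrow> bool" where
  "fin_monom \<alpha> \<longleftrightarrow> finite {i. \<alpha> i \<noteq> 0}"

definition mdeg :: "(nat \<Rightarrow> nat) \<Rightarrow> nat" where
  "mdeg \<alpha> = (\<Sum>i\<in>{i. \<alpha> i \<noteq> 0}. \<alpha> i)"

definition Sym :: "fps_inf set" where
  "Sym = {f. (\<forall>\<alpha>. \<not> fin_monom \<alpha> \<longrightarrow> f \<alpha> = 0)
            \<and> (\<exists>d. \<forall>\<alpha>. f \<alpha> \<noteq> 0 \<longrightarrow> mdeg \<alpha> \<le> d)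
            \<and> (\<forall>\<alpha> \<pi>. bij \<pi> \<longrightarrow> f (\<alpha> \<circ> \<pi>) = f \<alpha>)}"

definition msym :: "nat list \<Rightarrow> fps_inf" where
  "msym \<mu> \<alpha> = (if fin_monom \<alpha> \<and> (\<forall>k>0. card {i. \<alpha> i = k} = count_list \<mu> k) then 1 else 0)"

definition In_ideal :: "nat \<Rightarrow> fps_inf set" where
  "In_ideal n = {f. \<exists>S c. finite S \<and> S \<subseteq> {\<mu>. is_partition \<mu>} - Bn n
                     \<and> f = (\<lambda>\<alpha>. \<Sum>\<mu>\<in>S. c \<mu> * msym \<mu> \<alpha>)}"

definition seq_prod :: "(nat \<Rightarrow> int \<Rightarrow> int) \<Rightarrow> nat \<Rightarrow> int \<Rightarrow> int" where
  "seq_prod v N = foldr (\<lambda>i f. v i \<circ> f) [0..<N] id"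

definition Ftil :: "nat \<Rightarrow> (int \<Rightarrow> int) \<Rightarrow> fps_inf" where
  "Ftil n w \<alpha> = (if fin_monom \<alpha> then
      int (card {v :: nat \<Rightarrow> int \<Rightarrow> int.
        (\<forall>i. cyc_dec n (v i) \<and> alen n (v i) = \<alpha> i)
        \<and> finite {i. v i \<noteq> id}
        \<and> (\<exists>N. (\<forall>i\<ge>N. v i = id) \<and> seq_prod v N = w \<and> (\<Sum>i<N. alen n (v i)) = alen n w)})
    else 0)"

definition Ftil_part :: "nat \<Rightarrow> nat list \<Rightarrow> fps_inf" where
  "Ftil_part n la = Ftil n (THE w. aff_grass n w \<and> lam n w = la)"

end

theory Submission
  imports Defs "HOL-Computational_Algebra.Polynomial" "HOL-Combinatorics.Permutations"
begin

text \<open>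
  An affine permutation \<open>w\<close> is studied through the one-line notation of \<open>w\<inverse>\<close>. Multiplying on the left by
  a cyclically decreasing element \<open>v\<close> amounts to choosing a proper set \<open>A\<close> of residues and moving the
  value at each position outside \<open>A\<close> to the next such position. The lengths add iff the moved values
  are smaller than all values they jump over, and then the code grows by one exactly on \<open>A\<close>.

  Symmetry: in this picture a carrier travels through one period, swapping its value with the site or
  passing it with weight \<open>x\<close> when its value is the smaller one. These vertex weights satisfy the
  Yang--Baxter equation with the R-matrix \<open>1 + (x - y) u\<close>, where \<open>u\<close> exchanges the two carriers if
  they are in decreasing order and is \<open>0\<close> otherwise. Hence exchanging \<open>x\<close> and \<open>y\<close> preserves the twisted
  trace of two consecutive rows, and comparing coefficients shows that the order of two adjacent factors of
  given lengths is irrelevant.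

  Unitriangularity: each factor lowers code entries by at most one, so the exponents of a monomial
  in the function of \<open>w\<close> are dominated by the partition \<open>lam n w\<close>. If they are equal to it, every
  factor must lower all nonzero entries, which determines it. For affine Grassmannian \<open>w\<close> this peels
  off one part of the partition at a time and shows that \<open>lam n\<close> is a bijection onto \<open>Bn n\<close>.
\<close>

section \<open>Periodic bijections and their codes\<close>

text \<open>Symmetry is not visible from the definition: no matching suggests itself between the
  pairs (A, B) of sizes (a, b) and those of sizes (b, a) that lead to the same result. Generating
  functions in x and y and a trace over the carriers replace such a bijection by an operator
  identity. Two facts make this work on a circle. First, u squares to 0, since carriers exchanged
  once stand in increasing order; so 1 + z u has the inverse 1 - z u and no denominators arise.
  Second, after one period a carrier must return as its initial colour plus n, because one-line
  notation repeats up to that shift. Adding n preserves order, so this twist commutes with u; it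
  also excludes the carrier that never swaps, whose colour would come back unchanged. The result
  holds over the integers because the triangular system has ones on its diagonal.\<close>

locale affine =
  fixes n :: nat
  assumes n_gt_2: "n > 2"
begin

abbreviation N :: int where "N \<equiv> int n"

lemma N_pos [simp]: "N > 0" "0 \<le> N" "N \<noteq> 0" "n > 0" "n \<noteq> 0"
  using n_gt_2 by auto

text \<open>The sum condition is left out so that index shifts and \<open>rot\<close> qualify as
  well: \<open>rot A\<close> has total displacement -n for proper A, and only the extra shift in
  \<open>cyc A\<close> brings it back to 0.\<close>

definition periodic_bij :: "(int \<Rightarrow> int) \<Rightarrow> bool" where
  "periodic_bij f \<longleftrightarrow> bij f \<and> (\<forall>i. f (i + N) = f i + N)"

definition proper :: "int set \<Rightarrow> bool" where
  "proper A \<longleftrightarrow> A \<subset> {0..<N}"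

definition pred_out :: "int set \<Rightarrow> int \<Rightarrow> int" where
  "pred_out A j = j - 1 - int (LEAST k. (j - 1 - int k) mod N \<notin> A)"

definition rot :: "int set \<Rightarrow> int \<Rightarrow> int" where
  "rot A j = (if j mod N \<in> A then j else pred_out A j)"

text \<open>For a proper set \<open>A\<close> of residues, \<open>cyc A\<close> is the inverse of the cyclically decreasing element
  whose letters are the \<open>a\<close> with \<open>a + 1 \<in> A\<close> modulo \<open>n\<close>. Splitting off the index shift leaves
  \<open>rot A\<close>, for which \<open>f \<circ> rot A\<close> agrees with \<open>f\<close> on \<open>A\<close> and has every other value of \<open>f\<close> moved to the
  next position outside \<open>A\<close>.\<close>

definition cyc :: "int set \<Rightarrow> int \<Rightarrow> int" where
  "cyc A j = rot A (j + 1)"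

definition valid :: "(int \<Rightarrow> int) \<Rightarrow> int set \<Rightarrow> bool" where
  "valid f A \<longleftrightarrow> (\<forall>j. j mod N \<in> A \<longrightarrow> f (pred_out A j) < f j)"

text \<open>Inversions of f up to simultaneous translation by n; for affine permutations this is the
  Coxeter length of \<open>inv f\<close>, see \<open>alen_eq\<close>.\<close>

definition ninv :: "(int \<Rightarrow> int) \<Rightarrow> nat" where
  "ninv f = (\<Sum>j\<in>{0..<N}. code_entry f j)"

lemma proper_finite: "proper A \<Longrightarrow> finite A"
  unfolding proper_def by (meson finite_atLeastLessThan_int finite_subset psubset_imp_subset)

lemma finite_proper [simp]: "finite {A. proper A}"
  unfolding proper_def by (rule finite_subset[of _ "Pow {0..<N}"]) auto

lemma periodic_add:
  assumes "\<And>i. f (i + N) = f i + N"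
  shows "f (i + m * N) = f i + m * N"
proof -
  have nat: "f (i + int k * N) = f i + int k * N" for i k
  proof (induction k)
    case (Suc k)
    have "f (i + int (Suc k) * N) = f ((i + int k * N) + N)" by (simp add: algebra_simps)
    also have "\<dots> = f (i + int k * N) + N" by (rule assms)
    finally show ?case using Suc by (simp add: algebra_simps)
  qed simp
  show ?thesis
  proof (cases "m \<ge> 0")
    case True
    then show ?thesis using nat[of i "nat m"] by simp
  next
    case False
    then show ?thesis using nat[of "i + m * N" "nat (- m)"] by simp
  qed
qed

lemma invariant_add:
  assumes "\<And>i. f (i + N) = f i"
  shows "f (i + m * N) = f i"
proof -
  have nat: "f (i + int k * N) = f i" for i k
  proof (induction k)
    case (Suc k)
    have "f (i + int (Suc k) * N) = f ((i + int k * N) + N)" by (simp add: algebra_simps)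
    also have "\<dots> = f (i + int k * N)" by (rule assms)
    finally show ?case using Suc by (simp add: algebra_simps)
  qed simp
  show ?thesis
  proof (cases "m \<ge> 0")
    case True
    then show ?thesis using nat[of i "nat m"] by simp
  next
    case False
    then show ?thesis using nat[of "i + m * N" "nat (- m)"] by simp
  qed
qed

lemma invariant_mod:
  assumes "\<And>i. f (i + N) = f i"
  shows "f (i mod N) = f i"
  using invariant_add[of f "i mod N" "i div N", OF assms] by simp

lemma periodic_mod:
  assumes "\<And>i. f (i + N) = f i + N"
  shows "f i = f (i mod N) + (i div N) * N"
  using periodic_add[of f "i mod N" "i div N", OF assms] by simp

lemma periodic_bij_add: "periodic_bij f \<Longrightarrow> f (i + m * N) = f i + m * N"
  using periodic_add unfolding periodic_bij_def by blast

lemma periodic_bij_id [simp]: "periodic_bij id"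
  by (simp add: periodic_bij_def)

lemma periodic_bij_comp: "periodic_bij f \<Longrightarrow> periodic_bij g \<Longrightarrow> periodic_bij (f \<circ> g)"
  unfolding periodic_bij_def by (auto simp: bij_comp)

lemma periodic_bij_inj: "periodic_bij f \<Longrightarrow> f i = f j \<longleftrightarrow> i = j"
  unfolding periodic_bij_def bij_def inj_def by auto

lemma periodic_bij_inv:
  assumes "periodic_bij f" shows "periodic_bij (inv f)"
proof -
  have b: "bij f" using assms by (simp add: periodic_bij_def)
  have "inv f (i + N) = inv f i + N" for i
  proof -
    have "f (inv f i + N) = i + N"
      using assms b by (simp add: periodic_bij_def bij_is_surj surj_f_inv_f)
    then show ?thesis using b by (metis bij_inv_eq_iff)
  qed
  then show ?thesis using b by (simp add: periodic_bij_def bij_imp_bij_inv)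
qed

lemma sum_shift_invariant:
  fixes h :: "int \<Rightarrow> 'b::comm_monoid_add"
  assumes "\<And>i. h (i + N) = h i"
  shows "(\<Sum>j\<in>{0..<N}. h (j + 1)) = (\<Sum>j\<in>{0..<N}. h j)"
    and "(\<Sum>j\<in>{1..N}. h j) = (\<Sum>j\<in>{0..<N}. h j)"
proof -
  have im: "(\<lambda>j. j + 1) ` {0..<N} = {1..N}"
    by (auto simp: image_iff intro!: bexI[of _ "_ - 1"])
  have 1: "(\<Sum>j\<in>{0..<N}. h (j + 1)) = (\<Sum>j\<in>{1..N}. h j)"
    unfolding im[symmetric] by (subst sum.reindex) (auto simp: inj_on_def)
  have "{1..N} = insert N {1..<N}" "{0..<N} = insert 0 {1..<N}"
    using N_pos(1) by (auto simp del: N_pos)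
  then have "(\<Sum>j\<in>{1..N}. h j) = (\<Sum>j\<in>{0..<N}. h j)"
    using assms[of 0] by simp
  then show "(\<Sum>j\<in>{1..N}. h j) = (\<Sum>j\<in>{0..<N}. h j)"
    and "(\<Sum>j\<in>{0..<N}. h (j + 1)) = (\<Sum>j\<in>{0..<N}. h j)" using 1 by auto
qed

lemma bij_betw_mod:
  assumes "periodic_bij f"
  shows "bij_betw (\<lambda>j. f j mod N) {0..<N} {0..<N}"
proof -
  have inj: "inj_on (\<lambda>j. f j mod N) {0..<N}"
  proof (rule inj_onI)
    fix i j assume ij: "i \<in> {0..<N}" "j \<in> {0..<N}" "f i mod N = f j mod N"
    then obtain m where "f i = f j + m * N"
      by (metis mod_eqE mult.commute)
    then have "f i = f (j + m * N)" using periodic_bij_add[OF assms] by simp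
    then have "i = j + m * N" using periodic_bij_inj[OF assms] by blast
    then have "i mod N = j mod N" by simp
    then show "i = j" using ij by simp
  qed
  moreover have "(\<lambda>j. f j mod N) ` {0..<N} \<subseteq> {0..<N}" by auto
  ultimately show ?thesis
    by (simp add: bij_betw_def endo_inj_surj)
qed

lemma sum_reindex_invariant:
  fixes h :: "int \<Rightarrow> 'b::comm_monoid_add"
  assumes "periodic_bij f" "\<And>i. h (i + N) = h i"
  shows "(\<Sum>j\<in>{0..<N}. h (f j)) = (\<Sum>j\<in>{0..<N}. h j)"
proof -
  have "(\<Sum>j\<in>{0..<N}. h (f j)) = (\<Sum>j\<in>{0..<N}. h (f j mod N))"
    using invariant_mod[of h] assms(2) by simp
  also have "\<dots> = (\<Sum>j\<in>{0..<N}. h j)"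
    by (rule sum.reindex_bij_betw[OF bij_betw_mod[OF assms(1)]])
  finally show ?thesis .
qed

section \<open>The preceding site outside a proper set, and the row move\<close>

lemma pred_out_ex:
  assumes "proper A" shows "\<exists>k. (j - 1 - int k) mod N \<notin> A"
proof -
  obtain a where a: "a \<in> {0..<N}" "a \<notin> A" using assms unfolding proper_def by blast
  have "(j - 1 - int (nat ((j - 1 - a) mod N))) mod N = a mod N"
    by (simp add: mod_diff_right_eq)
  then show ?thesis using a by (intro exI[of _ "nat ((j - 1 - a) mod N)"]) auto
qed

lemma pred_out_props:
  assumes "proper A"
  shows pred_out_less: "pred_out A j < j"
    and pred_out_notin: "pred_out A j mod N \<notin> A"
    and pred_out_between: "pred_out A j < k \<Longrightarrow> k < j \<Longrightarrow> k mod N \<in> A"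
proof -
  define l where "l = (LEAST k. (j - 1 - int k) mod N \<notin> A)"
  have p: "pred_out A j = j - 1 - int l" by (simp add: pred_out_def l_def)
  show "pred_out A j < j" by (simp add: p)
  show "pred_out A j mod N \<notin> A"
    unfolding p l_def using LeastI_ex[OF pred_out_ex[OF assms]] .
  show "k mod N \<in> A" if "pred_out A j < k" "k < j"
  proof -
    have "nat (j - 1 - k) < l" using that p by linarith
    from not_less_Least[OF this[unfolded l_def]]
    show ?thesis using that by simp
  qed
qed

lemma pred_outI:
  assumes "proper A" "e < j" "e mod N \<notin> A" "\<And>k. e < k \<Longrightarrow> k < j \<Longrightarrow> k mod N \<in> A"
  shows "pred_out A j = e"
  by (rule ccontr)
    (metis assms linorder_neqE_linordered_idom pred_out_props)

text \<open>This site-by-site recursion lets a carrier compute \<open>pred_out\<close> while it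
  scans a period, and it makes sums over \<open>pred_out\<close> telescope.\<close>

lemma pred_out_Suc:
  assumes "proper A"
  shows "pred_out A (j + 1) = (if j mod N \<in> A then pred_out A j else j)"
proof (cases "j mod N \<in> A")
  case True
  have "pred_out A (j + 1) = pred_out A j"
  proof (rule pred_outI[OF assms])
    fix k assume k: "pred_out A j < k" "k < j + 1"
    then show "k mod N \<in> A" using True pred_out_between[OF assms] by (cases "k = j") auto
  qed (use pred_out_less[OF assms, of j] pred_out_notin[OF assms] in auto)
  then show ?thesis using True by simp
next
  case False
  then show ?thesis by (simp add: pred_outI[OF assms])
qed

lemma pred_out_add:
  assumes "proper A" shows "pred_out A (j + N) = pred_out A j + N"
proof (rule pred_outI[OF assms])
  fix k assume "pred_out A j + N < k" "k < j + N"
  then have "(k - N) mod N \<in> A" using pred_out_between[OF assms, of j "k - N"] by simp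
  then show "k mod N \<in> A" by simp
qed (use pred_out_less[OF assms, of j] pred_out_notin[OF assms] in auto)

lemma next_out:
  assumes "proper A" "e mod N \<notin> A"
  shows "\<exists>j>e. j mod N \<notin> A \<and> pred_out A j = e"
proof -
  define P where "P k \<longleftrightarrow> (e + 1 + int k) mod N \<notin> A" for k
  have "P (n - 1)" unfolding P_def using assms(2) n_gt_2 by (simp add: of_nat_diff)
  then have L: "P (LEAST k. P k)" by (rule LeastI)
  let ?j = "e + 1 + int (LEAST k. P k)"
  have "pred_out A ?j = e"
  proof (rule pred_outI[OF assms(1) _ assms(2)])
    fix k assume k: "e < k" "k < ?j"
    then have "nat (k - e - 1) < (LEAST k. P k)" by linarith
    from not_less_Least[OF this] show "k mod N \<in> A" using k by (simp add: P_def)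
  qed simp
  moreover have "?j mod N \<notin> A" using L unfolding P_def .
  ultimately show ?thesis by (intro exI[of _ ?j]) auto
qed

lemma rot_add: "proper A \<Longrightarrow> rot A (j + N) = rot A j + N"
  by (simp add: rot_def pred_out_add)

lemma rot_eq_iff: "proper A \<Longrightarrow> rot A j = j \<longleftrightarrow> j mod N \<in> A"
  using pred_out_less[of A j] by (auto simp: rot_def)

lemma inj_rot:
  assumes "proper A" shows "inj (rot A)"
proof (rule injI)
  fix i j assume eq: "rot A i = rot A j"
  have aux: False if "i < j" "pred_out A i = pred_out A j" "i mod N \<notin> A" for i j
    using that pred_out_between[OF assms, of j i] pred_out_less[OF assms, of i] by auto
  show "i = j"
  proof (cases "i mod N \<in> A \<or> j mod N \<in> A")
    case True
    then show ?thesis using eq pred_out_notin[OF assms] by (metis rot_def)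
  next
    case False
    then have "pred_out A i = pred_out A j" using eq by (simp add: rot_def)
    then show ?thesis using aux[of i j] aux[of j i] False by (metis linorder_less_linear)
  qed
qed

text \<open>A cut after j separates exactly one moving value from its destination, the one that
  comes from \<open>pred_out A (j + 1)\<close>. Code entries after the move are therefore counts of
  old values on the tail enlarged by this one site.\<close>

lemma rot_image:
  assumes "proper A"
  shows "rot A ` {j<..} = insert (pred_out A (j + 1)) {j<..}"
proof (intro equalityI subsetI)
  fix x assume "x \<in> rot A ` {j<..}"
  then obtain k where k: "k > j" "x = rot A k" by auto
  show "x \<in> insert (pred_out A (j + 1)) {j<..}"
  proof (cases "x > j")
    case False
    then have x: "x = pred_out A k" "k mod N \<notin> A"
      using k by (auto simp: rot_def split: if_splits)
    have "pred_out A (j + 1) = x"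
      using pred_out_between[OF assms, of k] pred_out_notin[OF assms, of k] False k x
      by (intro pred_outI[OF assms]) auto
    then show ?thesis by simp
  qed simp
next
  fix x assume x: "x \<in> insert (pred_out A (j + 1)) {j<..}"
  show "x \<in> rot A ` {j<..}"
  proof (cases "x mod N \<in> A")
    case True
    then have "x > j" using x pred_out_notin[OF assms] by auto
    then show ?thesis using True by (auto simp: rot_def intro!: image_eqI[of _ _ x])
  next
    case False
    then obtain k where k: "k > x" "k mod N \<notin> A" "pred_out A k = x"
      using next_out[OF assms] by blast
    have "k > j"
    proof (cases "x > j")
      case False
      then have "x = pred_out A (j + 1)" using x by auto
      then show ?thesis using pred_out_between[OF assms, of "j + 1" k] k by force
    qed (use k in auto)
    then show ?thesis using k by (auto simp: rot_def intro!: image_eqI[of _ _ k])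
  qed
qed

lemma periodic_bij_rot:
  assumes "proper A" shows "periodic_bij (rot A)"
proof -
  have "surj (rot A)"
  proof -
    have "x \<in> range (rot A)" for x
    proof -
      have "x \<in> rot A ` {x - 1<..}" unfolding rot_image[OF assms] by simp
      then show ?thesis by blast
    qed
    then show ?thesis by auto
  qed
  then show ?thesis using inj_rot[OF assms] rot_add[OF assms]
    by (simp add: periodic_bij_def bij_def)
qed

lemma periodic_bij_shift: "periodic_bij (\<lambda>j. j + c)"
proof -
  have "bij (\<lambda>j::int. j + c)"
    by (rule bijI) (auto simp: inj_def intro: surjI[of _ "\<lambda>j. j - c"])
  then show ?thesis by (simp add: periodic_bij_def)
qed

lemma cyc_comp: "cyc A = rot A \<circ> (\<lambda>j. j + 1)"
  by (simp add: fun_eq_iff cyc_def)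

lemma periodic_bij_cyc: "proper A \<Longrightarrow> periodic_bij (cyc A)"
  unfolding cyc_comp by (intro periodic_bij_comp periodic_bij_rot periodic_bij_shift)

lemma cyc_inj:
  assumes "proper A" "proper B" "cyc A = cyc B" shows "A = B"
proof -
  have "rot A j = rot B j" for j using fun_cong[OF assms(3), of "j - 1"] by (simp add: cyc_def)
  then have "j mod N \<in> A \<longleftrightarrow> j mod N \<in> B" for j
    using rot_eq_iff assms by metis
  moreover have "j mod N = j" if "j \<in> A \<union> B" for j
    using that assms unfolding proper_def by auto
  ultimately show ?thesis by (metis UnI1 UnI2 subsetI subset_antisym)
qed

section \<open>Code entries and their change under a row move\<close>

lemma finite_code:
  assumes "periodic_bij f" shows "finite {k. j < k \<and> f k < x}"
proof -
  define M where "M = Min (f ` {0..<N})"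
  \<comment> \<open>The difference f k - k is periodic, so f stays within a bounded distance below
    the diagonal and falls under x only finitely often to the right of j.\<close>
  have gt: "f k > M + k - N" for k
  proof -
    have "M \<le> f (k mod N)" unfolding M_def by (intro Min_le) auto
    moreover have "f k = f (k mod N) + (k div N) * N"
      using periodic_mod[of f k] assms unfolding periodic_bij_def by blast
    moreover have "(k div N) * N = k - k mod N" by (simp add: minus_mod_eq_div_mult)
    moreover have "k mod N < N" by simp
    ultimately show ?thesis by linarith
  qed
  have "{k. j < k \<and> f k < x} \<subseteq> {j<..<x - M + N}"
  proof
    fix k assume "k \<in> {k. j < k \<and> f k < x}"
    then show "k \<in> {j<..<x - M + N}" using gt[of k] by auto
  qed
  then show ?thesis by (rule finite_subset) simp
qed

lemma code_entry_add:
  assumes "periodic_bij f" shows "code_entry f (j + N) = code_entry f j"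
proof -
  have "{k. k > j + N \<and> f k < f (j + N)} = (\<lambda>k. k + N) ` {k. k > j \<and> f k < f j}"
    (is "?L = ?R")
  proof (intro equalityI subsetI)
    fix k assume "k \<in> ?L"
    then have "k - N > j \<and> f (k - N) < f j"
      using periodic_bij_add[OF assms, of "k - N" 1] periodic_bij_add[OF assms, of j 1] by simp
    then show "k \<in> ?R" by (intro image_eqI[of _ _ "k - N"]) auto
  next
    fix k assume "k \<in> ?R"
    then show "k \<in> ?L" using periodic_bij_add[OF assms, of _ 1] by auto
  qed
  then show ?thesis unfolding code_entry_def by (simp add: card_image)
qed

lemma code_entry_shift: "code_entry (f \<circ> (\<lambda>j. j + 1)) j = code_entry f (j + 1)"
proof -
  have "{k. k > j + 1 \<and> f k < f (j + 1)} = (\<lambda>k. k + 1) ` {k. k > j \<and> f (k + 1) < f (j + 1)}"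
    (is "?L = ?R")
  proof (intro equalityI subsetI)
    fix k assume "k \<in> ?L"
    then show "k \<in> ?R" by (intro image_eqI[of _ _ "k - 1"]) auto
  qed auto
  then show ?thesis unfolding code_entry_def by (simp add: card_image)
qed

lemma ninv_shift:
  assumes "periodic_bij f" shows "ninv (f \<circ> (\<lambda>j. j + 1)) = ninv f"
  unfolding ninv_def code_entry_shift
  by (rule sum_shift_invariant(1)) (rule code_entry_add[OF assms])

lemma code_entry_rot:
  assumes "periodic_bij f" "proper A"
  shows "code_entry (f \<circ> rot A) j
    = card {k \<in> insert (pred_out A (j + 1)) {j<..}. f k < f (rot A j)}"
proof -
  have "rot A ` {k. k > j \<and> f (rot A k) < f (rot A j)}
      = {k \<in> rot A ` {j<..}. f k < f (rot A j)}" by auto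
  then have "card {k \<in> insert (pred_out A (j + 1)) {j<..}. f k < f (rot A j)}
      = card (rot A ` {k. k > j \<and> f (rot A k) < f (rot A j)})"
    unfolding rot_image[OF assms(2)] by simp
  also have "\<dots> = code_entry (f \<circ> rot A) j"
    unfolding code_entry_def by (simp add: card_image inj_on_subset[OF inj_rot[OF assms(2)]])
  finally show ?thesis by simp
qed

text \<open>The value at j stays while the tail to its right gains the single value carried over j,
  which is a new inversion exactly when the jump is allowed.\<close>

lemma code_entry_rot_in:
  assumes "periodic_bij f" "proper A" "j mod N \<in> A"
  shows "code_entry (f \<circ> rot A) j
    = code_entry f j + (if f (pred_out A j) < f j then 1 else 0)"
proof -
  have r: "rot A j = j" "pred_out A (j + 1) = pred_out A j"
    using assms by (simp_all add: rot_def pred_out_Suc)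
  have "{k \<in> insert (pred_out A j) {j<..}. f k < f j}
     = (if f (pred_out A j) < f j then insert (pred_out A j) else id) {k. j < k \<and> f k < f j}"
    by auto
  moreover have "\<not> pred_out A j > j" using pred_out_less[OF assms(2), of j] by simp
  ultimately show ?thesis
    unfolding code_entry_rot[OF assms(1,2)] r
    using finite_code[OF assms(1)] by (simp add: code_entry_def)
qed

text \<open>Moving a value to the right can only shed inversions, namely those with the values
  jumped over; validity says that there were none.\<close>

lemma code_entry_rot_notin:
  assumes "periodic_bij f" "proper A" "j mod N \<notin> A"
  shows "code_entry (f \<circ> rot A) j \<le> code_entry f (pred_out A j)"
    and "valid f A \<Longrightarrow> code_entry (f \<circ> rot A) j = code_entry f (pred_out A j)"
proof -
  let ?p = "pred_out A j"
  have r: "rot A j = ?p" "pred_out A (j + 1) = j"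
    using assms by (simp_all add: rot_def pred_out_Suc)
  have sub: "{k \<in> insert j {j<..}. f k < f ?p} \<subseteq> {k. ?p < k \<and> f k < f ?p}"
    using pred_out_less[OF assms(2), of j] by auto
  show "code_entry (f \<circ> rot A) j \<le> code_entry f ?p"
    unfolding code_entry_rot[OF assms(1,2)] r
    unfolding code_entry_def by (rule card_mono[OF finite_code[OF assms(1)] sub])
  assume v: "valid f A"
  have "{k. ?p < k \<and> f k < f ?p} \<subseteq> {k \<in> insert j {j<..}. f k < f ?p}"
  proof
    fix k assume k: "k \<in> {k. ?p < k \<and> f k < f ?p}"
    show "k \<in> {k \<in> insert j {j<..}. f k < f ?p}"
    proof (rule ccontr)
      assume "\<not> ?thesis"
      then have kj: "k < j" using k by auto
      then have "k mod N \<in> A" using k pred_out_between[OF assms(2)] by auto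
      \<comment> \<open>All sites strictly between \<open>?p\<close> and j have \<open>?p\<close> as
        their preceding outside site, so validity at k is a comparison with the moving
        value.\<close>
      moreover have "pred_out A k = ?p"
        using kj k pred_out_notin[OF assms(2)] pred_out_between[OF assms(2), of j]
        by (intro pred_outI[OF assms(2)]) auto
      ultimately show False using v k unfolding valid_def by force
    qed
  qed
  then have "{k \<in> insert j {j<..}. f k < f ?p} = {k. ?p < k \<and> f k < f ?p}"
    using sub by (rule subset_antisym[rotated])
  then show "code_entry (f \<circ> rot A) j = code_entry f ?p"
    using code_entry_rot[OF assms(1,2), of j] unfolding r by (simp add: code_entry_def)
qed

text \<open>Just after a site outside A, \<open>pred_out\<close> equals that site, so the
  differences telescope and the two ends of the period agree. In effect \<open>pred_out\<close>
  permutes the residues outside A.\<close>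

lemma sum_pred_out:
  fixes h :: "int \<Rightarrow> int"
  assumes "proper A" "\<And>i. h (i + N) = h i"
  shows "(\<Sum>j\<in>{0..<N} - A. h (pred_out A j)) = (\<Sum>j\<in>{0..<N} - A. h j)"
proof -
  let ?d = "\<lambda>j. if j mod N \<in> A then 0 else h (pred_out A j) - h j"
  have tel: "(\<Sum>j\<in>{0..<int m}. ?d j) = h (pred_out A 0) - h (pred_out A (int m))" for m
  proof (induction m)
    case (Suc m)
    have "{0..<int (Suc m)} = insert (int m) {0..<int m}" by auto
    then show ?case using Suc pred_out_Suc[OF assms(1), of "int m"]
      by (simp add: add.commute)
  qed simp
  have "pred_out A N = pred_out A 0 + N" using pred_out_add[OF assms(1), of 0] by simp
  then have "(\<Sum>j\<in>{0..<N}. ?d j) = 0" using tel[of n] assms(2) by simp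
  moreover have "(\<Sum>j\<in>{0..<N}. ?d j) = (\<Sum>j\<in>{0..<N} - A. h (pred_out A j) - h j)"
    by (rule sum.mono_neutral_cong_right) auto
  ultimately show ?thesis by (simp add: sum_subtractf)
qed

lemma sum_pred_out_nat:
  fixes h :: "int \<Rightarrow> nat"
  assumes "proper A" "\<And>i. h (i + N) = h i"
  shows "(\<Sum>j\<in>{0..<N} - A. h (pred_out A j)) = (\<Sum>j\<in>{0..<N} - A. h j)"
proof -
  have "int (\<Sum>j\<in>{0..<N} - A. h (pred_out A j)) = int (\<Sum>j\<in>{0..<N} - A. h j)"
    unfolding of_nat_sum using sum_pred_out[OF assms(1), of "\<lambda>j. int (h j)"] assms(2) by simp
  then show ?thesis by (rule iffD1[OF of_nat_eq_iff])
qed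

lemma sum_split_proper:
  fixes h :: "int \<Rightarrow> 'b::comm_monoid_add"
  assumes "proper A"
  shows "(\<Sum>j\<in>{0..<N}. h j) = (\<Sum>j\<in>A. h j) + (\<Sum>j\<in>{0..<N} - A. h j)"
  using sum.subset_diff[of A "{0..<N}" h] assms unfolding proper_def
  by (simp add: add.commute psubset_imp_subset)

lemma proper_mod: "proper A \<Longrightarrow> j \<in> A \<Longrightarrow> j mod N = j"
  unfolding proper_def by auto

lemma valid_iff_window:
  assumes "periodic_bij f" "proper A"
  shows "valid f A \<longleftrightarrow> (\<forall>j\<in>A. f (pred_out A j) < f j)"
proof
  assume R: "\<forall>j\<in>A. f (pred_out A j) < f j"
  show "valid f A" unfolding valid_def
  proof (intro allI impI)
    fix j assume "j mod N \<in> A"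
    then have "f (pred_out A (j mod N)) < f (j mod N)" using R by blast
    moreover have "f j = f (j mod N) + (j div N) * N"
      using periodic_mod[of f j] assms(1) unfolding periodic_bij_def by blast
    moreover have "pred_out A j = pred_out A (j mod N) + (j div N) * N"
      using periodic_mod[of "pred_out A" j] pred_out_add[OF assms(2)] by blast
    ultimately show "f (pred_out A j) < f j" using periodic_bij_add[OF assms(1)] by simp
  qed
qed (auto simp: valid_def proper_mod[OF assms(2)])

text \<open>Entries outside A are relocated, possibly with losses, so every gain comes from a site
  of A, one for each allowed jump.\<close>

lemma ninv_rot:
  assumes "periodic_bij f" "proper A"
  shows "ninv (f \<circ> rot A) \<le> ninv f + card {j\<in>A. f (pred_out A j) < f j}"
    and "valid f A \<Longrightarrow> ninv (f \<circ> rot A) = ninv f + card A"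
proof -
  let ?V = "{j\<in>A. f (pred_out A j) < f j}"
  have inA: "(\<Sum>j\<in>A. code_entry (f \<circ> rot A) j) = (\<Sum>j\<in>A. code_entry f j) + card ?V"
  proof -
    have "(\<Sum>j\<in>A. code_entry (f \<circ> rot A) j)
        = (\<Sum>j\<in>A. code_entry f j + (if f (pred_out A j) < f j then 1 else 0))"
      by (rule sum.cong) (auto simp: code_entry_rot_in[OF assms] proper_mod[OF assms(2)])
    also have "(\<Sum>j\<in>A. (if f (pred_out A j) < f j then 1 else 0::nat)) = card ?V"
      using proper_finite[OF assms(2)] by (simp add: sum.If_cases Int_def)
    ultimately show ?thesis by (simp add: sum.distrib)
  qed
  have pe: "(\<Sum>j\<in>{0..<N} - A. code_entry f (pred_out A j)) = (\<Sum>j\<in>{0..<N} - A. code_entry f j)"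
    using sum_pred_out_nat[OF assms(2)] code_entry_add[OF assms(1)] by blast
  have le: "(\<Sum>j\<in>{0..<N} - A. code_entry (f \<circ> rot A) j) \<le> (\<Sum>j\<in>{0..<N} - A. code_entry f j)"
    unfolding pe[symmetric] by (rule sum_mono) (auto intro!: code_entry_rot_notin(1)[OF assms])
  show "ninv (f \<circ> rot A) \<le> ninv f + card ?V"
    unfolding ninv_def sum_split_proper[OF assms(2)] inA using le by simp
  assume v: "valid f A"
  have "(\<Sum>j\<in>{0..<N} - A. code_entry (f \<circ> rot A) j) = (\<Sum>j\<in>{0..<N} - A. code_entry f j)"
    unfolding pe[symmetric] by (rule sum.cong) (auto intro!: code_entry_rot_notin(2)[OF assms _ v])
  moreover have "?V = A" using v valid_iff_window[OF assms] by auto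
  ultimately show "ninv (f \<circ> rot A) = ninv f + card A"
    unfolding ninv_def sum_split_proper[OF assms(2)] inA by simp
qed

text \<open>This turns additivity of lengths into the local condition \<open>valid\<close>: each
  forbidden jump forgoes a gain that nothing else can make up for.\<close>

lemma ninv_cyc:
  assumes "periodic_bij f" "proper A"
  shows "ninv (f \<circ> cyc A) \<le> ninv f + card A"
    and "ninv (f \<circ> cyc A) = ninv f + card A \<longleftrightarrow> valid f A"
proof -
  have eq: "ninv (f \<circ> cyc A) = ninv (f \<circ> rot A)"
    using ninv_shift[OF periodic_bij_comp[OF assms(1) periodic_bij_rot[OF assms(2)]]]
    by (simp add: cyc_comp comp_assoc)
  have sub: "{j\<in>A. f (pred_out A j) < f j} \<subseteq> A" by auto
  note c = card_mono[OF proper_finite[OF assms(2)] sub]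
  show "ninv (f \<circ> cyc A) \<le> ninv f + card A"
    using ninv_rot(1)[OF assms] c eq by simp
  show "ninv (f \<circ> cyc A) = ninv f + card A \<longleftrightarrow> valid f A"
  proof
    assume "ninv (f \<circ> cyc A) = ninv f + card A"
    then have "card {j\<in>A. f (pred_out A j) < f j} = card A"
      using ninv_rot(1)[OF assms] c eq by simp
    then have "{j\<in>A. f (pred_out A j) < f j} = A"
      using card_subset_eq[OF proper_finite[OF assms(2)] sub] by blast
    then show "valid f A" using valid_iff_window[OF assms] by blast
  qed (use ninv_rot(2)[OF assms] eq in simp)
qed

section \<open>Length and cyclically decreasing elements\<close>

lemma mod_add_cancel: "(x + c) mod N = (y + c) mod N \<longleftrightarrow> x mod N = y mod N"
  by (simp add: mod_eq_dvd_iff)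

lemma mod_succ_neq: "(x + 1) mod N \<noteq> x mod N" "(x + 2) mod N \<noteq> x mod N"
proof -
  have "\<not> N dvd 1" "\<not> N dvd 2"
    using n_gt_2 zdvd_imp_le[of N 1] zdvd_imp_le[of N 2] by auto
  then show "(x + 1) mod N \<noteq> x mod N" "(x + 2) mod N \<noteq> x mod N"
    by (simp_all add: mod_eq_dvd_iff)
qed

lemma cyc_empty: "cyc {} = id"
proof -
  have "proper {}" unfolding proper_def using N_pos(1) by (auto simp del: N_pos)
  then show ?thesis by (simp add: fun_eq_iff cyc_def rot_def pred_out_Suc)
qed

lemma proper_empty [simp]: "proper {}"
  unfolding proper_def using N_pos(1) by (auto simp del: N_pos)

lemma pred_out_cong:
  assumes "proper A" "proper B" "pred_out B j = e" "e mod N \<notin> A"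
    "\<And>k. e < k \<Longrightarrow> k < j \<Longrightarrow> k mod N \<in> B \<Longrightarrow> k mod N \<in> A"
  shows "pred_out A j = e"
  using assms pred_out_less[OF assms(2), of j] pred_out_between[OF assms(2), of j]
  by (intro pred_outI) auto

text \<open>Prepending s_a to a word multiplies the inverse by s_a on the right. That neither a nor
  a + 1 is a letter yet reads, after the index shift, as a + 1 and a + 2 lying outside A; the free
  residue a + 2 also keeps the enlarged set proper.\<close>

lemma cyc_insert:
  assumes "proper A" "(int a + 1) mod N \<notin> A" "(int a + 2) mod N \<notin> A" "a < n"
  shows "proper (insert ((int a + 1) mod N) A)"
    and "cyc (insert ((int a + 1) mod N) A) = cyc A \<circ> sgen n a"
proof -
  let ?x = "(int a + 1) mod N"
  let ?B = "insert ?x A"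
  have ne: "(int a + 2) mod N \<noteq> ?x" using mod_succ_neq(1)[of "int a + 1"] by (simp add: add.assoc)
  have "?B \<subseteq> {0..<N}" using assms(1) unfolding proper_def by auto
  moreover have "(int a + 2) mod N \<in> {0..<N} - ?B" using ne assms(3) by simp
  ultimately show pB: "proper ?B" unfolding proper_def by blast
  have am: "int a mod N = int a" using assms(4) by simp
  show "cyc ?B = cyc A \<circ> sgen n a"
  proof
    fix j
    consider (1) "j mod N = int a" | (2) "j mod N = ?x" "j mod N \<noteq> int a"
      | (3) "j mod N \<noteq> int a" "j mod N \<noteq> ?x" by blast
    then show "cyc ?B j = (cyc A \<circ> sgen n a) j"
    proof cases
      case 1
      have 2: "(j + 1) mod N = ?x" using 1 am mod_add_cancel[of j 1 "int a"] by simp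
      have 3: "(j + 1 + 1) mod N = (int a + 2) mod N"
        using 1 am mod_add_cancel[of j 2 "int a"] by (simp add: add.commute)
      have "cyc A (j + 1) = j + 1"
        unfolding cyc_def rot_def using 2 3 assms pred_out_Suc[OF assms(1), of "j + 1"] by simp
      then show ?thesis using 1 2 by (simp add: sgen_def cyc_def rot_def)
    next
      case 2
      have 3: "(j + 1) mod N = (int a + 2) mod N"
        using 2(1) mod_add_cancel[of j 1 "int a + 1"] by (simp add: add.assoc)
      have 4: "j mod N \<notin> A" using 2 assms by simp
      define e where "e = pred_out A j"
      \<comment> \<open>The site j - N + 1 has residue a + 2, so it is outside A and stops the
        backward search before it can come round to j - N, which has the newly inserted
        residue.\<close>
      have e1: "j - N + 1 \<le> e"
      proof (rule ccontr)
        assume "\<not> ?thesis"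
        then have "(j - N + 1) mod N \<in> A"
          using pred_out_between[OF assms(1), of j "j - N + 1"] n_gt_2 unfolding e_def by simp
        moreover have "(j - N + 1) mod N = (j + 1) mod N"
          by (metis add_diff_eq diff_add_eq minus_mod_self2)
        ultimately show False using 3 assms by simp
      qed
      have e2: "e mod N \<noteq> ?x"
      proof
        assume "e mod N = ?x"
        then have "j mod N = e mod N" using 2(1) by simp
        then have "N dvd j - e" by (simp only: mod_eq_dvd_iff)
        moreover have "0 < j - e" "j - e < N" using e1 pred_out_less[OF assms(1), of j] e_def by auto
        ultimately show False using zdvd_imp_le by fastforce
      qed
      have "pred_out ?B j = e"
        by (rule pred_out_cong[OF pB assms(1)])
          (use e2 pred_out_notin[OF assms(1), of j] in \<open>auto simp: e_def\<close>)
      then have "pred_out ?B (j + 1) = e"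
        using pred_out_Suc[OF pB, of j] 2 by simp
      moreover have "(j + 1) mod N \<notin> ?B" using 3 ne assms by simp
      ultimately show ?thesis using 2 4 by (simp add: sgen_def cyc_def rot_def e_def)
    next
      case 3
      have j1: "(j + 1) mod N \<noteq> ?x" using 3 am mod_add_cancel[of j 1 "int a"] by simp
      show ?thesis
      proof (cases "(j + 1) mod N \<in> A")
        case True
        then show ?thesis using 3 by (simp add: sgen_def cyc_def rot_def)
      next
        case False
        define e where "e = pred_out A (j + 1)"
        have e2: "e mod N \<noteq> ?x"
        proof
          assume e: "e mod N = ?x"
          then have "(e + 1) mod N = (int a + 2) mod N"
            using mod_add_cancel[of e 1 "int a + 1"] by (simp add: add.assoc)
          then have "(e + 1) mod N \<notin> A" using assms by simp
          moreover have "e < j + 1" unfolding e_def by (rule pred_out_less[OF assms(1)])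
          ultimately have "e = j"
            using pred_out_between[OF assms(1), of "j + 1" "e + 1"] unfolding e_def by force
          then show False using 3 e by simp
        qed
        have "pred_out ?B (j + 1) = e"
          by (rule pred_out_cong[OF pB assms(1)])
            (use e2 pred_out_notin[OF assms(1)] in \<open>auto simp: e_def\<close>)
        then show ?thesis using 3 j1 False by (simp add: sgen_def cyc_def rot_def e_def)
      qed
    qed
  qed
qed

lemma sgen_cyc: "a < n \<Longrightarrow> sgen n a = cyc {(int a + 1) mod N}"
  using cyc_insert(2)[of "{}" a] by (simp add: cyc_empty)

lemma proper_singleton: "a < n \<Longrightarrow> proper {(int a + 1) mod N}"
  using cyc_insert(1)[of "{}" a] by simp

lemma periodic_bij_sgen: "a < n \<Longrightarrow> periodic_bij (sgen n a)"
  by (simp add: sgen_cyc periodic_bij_cyc proper_singleton)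

lemma sgen_invol:
  assumes "a < n" shows "sgen n a \<circ> sgen n a = id"
proof
  fix j
  have am: "int a mod N = int a" using assms by simp
  have 1: "(j + 1) mod N = (int a + 1) mod N" "(j + 1) mod N \<noteq> int a" if "j mod N = int a"
    using that am mod_add_cancel[of j 1 "int a"] mod_succ_neq(1)[of j] by auto
  have 2: "(j - 1) mod N = int a" if "j mod N = (int a + 1) mod N"
    using that am mod_add_cancel[of "j - 1" 1 "int a"] by simp
  show "(sgen n a \<circ> sgen n a) j = id j"
    using 1 2 by (simp add: sgen_def)
qed

lemma inv_sgen: "a < n \<Longrightarrow> inv (sgen n a) = sgen n a"
  using sgen_invol inv_unique_comp by blast

lemma inv_comp_periodic:
  "periodic_bij f \<Longrightarrow> periodic_bij g \<Longrightarrow> inv (f \<circ> g) = inv g \<circ> inv f"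
  by (intro o_inv_distrib) (auto simp: periodic_bij_def)

lemma comp_inv_periodic:
  assumes "periodic_bij f"
  shows "f \<circ> inv f = id" "inv f \<circ> f = id" "inv (inv f) = f" "f (inv f x) = x" "inv f (f x) = x"
  using assms unfolding periodic_bij_def
  by (auto simp: bij_is_surj bij_is_inj inv_inv_eq surj_f_inv_f fun_eq_iff)

lemma ninv_sgen_up:
  assumes "periodic_bij f" "a < n" "f (int a) < f (int a + 1)"
  shows "ninv (f \<circ> sgen n a) = ninv f + 1"
proof -
  let ?x = "(int a + 1) mod N"
  have p: "proper {?x}" using assms proper_singleton by blast
  have "valid f {?x}" unfolding valid_def
  proof (intro allI impI)
    fix j assume "j mod N \<in> {?x}"
    then have j: "j mod N = ?x" by simp
    obtain m where m: "j = int a + 1 + m * N"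
      using j by (metis mod_eqE mult.commute)
    have "(j - 1) mod N \<noteq> ?x"
      using mod_succ_neq(1)[of "j - 1"] j by simp
    then have "pred_out {?x} j = j - 1" by (intro pred_outI[OF p]) auto
    moreover have "f (j - 1) < f j"
      using assms(3) periodic_bij_add[OF assms(1), of "int a" m]
        periodic_bij_add[OF assms(1), of "int a + 1" m] m by (simp add: algebra_simps)
    ultimately show "f (pred_out {?x} j) < f j" by simp
  qed
  then show ?thesis using ninv_cyc(2)[OF assms(1) p] assms(2) by (simp add: sgen_cyc)
qed

lemma sgen_at: "a < n \<Longrightarrow> sgen n a (int a) = int a + 1" "a < n \<Longrightarrow> sgen n a (int a + 1) = int a"
proof -
  assume a: "a < n"
  have "(int a + 1) mod N \<noteq> int a" using a mod_succ_neq(1)[of "int a"] by simp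
  then show "sgen n a (int a) = int a + 1" "sgen n a (int a + 1) = int a"
    using a by (auto simp: sgen_def)
qed

lemma ninv_sgen_down:
  assumes "periodic_bij f" "a < n" "f (int a) > f (int a + 1)"
  shows "ninv f = ninv (f \<circ> sgen n a) + 1"
proof -
  let ?g = "f \<circ> sgen n a"
  have "?g (int a) < ?g (int a + 1)" using assms sgen_at by simp
  moreover have "periodic_bij ?g" using assms periodic_bij_sgen periodic_bij_comp by blast
  ultimately have "ninv (?g \<circ> sgen n a) = ninv ?g + 1" using ninv_sgen_up assms by blast
  then show ?thesis using sgen_invol[OF assms(2)] by (simp add: comp_assoc)
qed

section \<open>Displacement, reduced words and the length function\<close>

definition disp :: "(int \<Rightarrow> int) \<Rightarrow> int" where
  "disp f = (\<Sum>j\<in>{0..<N}. f j - j)"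

lemma affine_perm_iff: "affine_perm n w \<longleftrightarrow> periodic_bij w \<and> disp w = 0"
proof -
  have "disp w = 0 \<longleftrightarrow> (\<Sum>i\<in>{1..N}. w i) = (\<Sum>i\<in>{1..N}. i)" if "periodic_bij w"
  proof -
    have "(\<Sum>j\<in>{1..N}. w j - j) = disp w" unfolding disp_def
      by (rule sum_shift_invariant(2)) (use that in \<open>simp add: periodic_bij_def\<close>)
    then have "disp w = (\<Sum>i\<in>{1..N}. w i) - (\<Sum>i\<in>{1..N}. i)" by (simp add: sum_subtractf)
    then show ?thesis by linarith
  qed
  then show ?thesis unfolding affine_perm_def periodic_bij_def by blast
qed

text \<open>Since f j - j depends on the residue of j alone and g permutes residues, displacement is
  a homomorphism; the normalised sum in \<open>affine_perm\<close> describes its kernel.\<close>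

lemma disp_comp:
  assumes "periodic_bij f" "periodic_bij g"
  shows "disp (f \<circ> g) = disp f + disp g"
proof -
  have "(\<Sum>j\<in>{0..<N}. f (g j) - g j) = disp f" unfolding disp_def
    by (rule sum_reindex_invariant[OF assms(2), of "\<lambda>j. f j - j"])
      (use assms(1) in \<open>simp add: periodic_bij_def\<close>)
  then show ?thesis by (simp add: disp_def sum_subtractf)
qed

lemma disp_id: "disp id = 0"
  by (simp add: disp_def)

lemma affine_perm_id: "affine_perm n id"
  by (simp add: affine_perm_iff disp_id)

lemma affine_perm_comp: "affine_perm n f \<Longrightarrow> affine_perm n g \<Longrightarrow> affine_perm n (f \<circ> g)"
  by (auto simp: affine_perm_iff disp_comp periodic_bij_comp)

lemma affine_perm_inv:
  assumes "affine_perm n f" shows "affine_perm n (inv f)"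
proof -
  have p: "periodic_bij f" using assms by (simp add: affine_perm_iff)
  have "disp f + disp (inv f) = 0"
    using disp_comp[OF p periodic_bij_inv[OF p]] comp_inv_periodic(1)[OF p] disp_id by simp
  then show ?thesis using assms p by (simp add: affine_perm_iff periodic_bij_inv)
qed

lemma affine_perm_sgen:
  assumes "a < n" shows "affine_perm n (sgen n a)"
proof -
  let ?x = "(int a + 1) mod N"
  have x: "?x \<in> {0..<N}" "int a \<in> {0..<N}" "?x \<noteq> int a"
    using assms mod_succ_neq(1)[of "int a"] by auto
  have "disp (sgen n a) = (\<Sum>j\<in>{0..<N}. (if j = int a then 1 else 0) - (if j = ?x then 1 else 0))"
    unfolding disp_def by (rule sum.cong) (use x in \<open>auto simp: sgen_def\<close>)
  also have "\<dots> = 0" unfolding sum_subtractf using x by simp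
  finally show ?thesis using assms by (simp add: affine_perm_iff periodic_bij_sgen)
qed

lemma word_prod_simps [simp]:
  "word_prod n [] = id" "word_prod n (a # ws) = sgen n a \<circ> word_prod n ws"
  by (simp_all add: word_prod_def)

lemma is_word_simps [simp]: "is_word n []" "is_word n (a # ws) \<longleftrightarrow> a < n \<and> is_word n ws"
  by (auto simp: is_word_def)

lemma affine_perm_word: "is_word n ws \<Longrightarrow> affine_perm n (word_prod n ws)"
proof (induction ws)
  case Nil
  then show ?case using affine_perm_id by (simp only: word_prod_simps)
next
  case (Cons a ws)
  then have "affine_perm n (sgen n a \<circ> word_prod n ws)"
    by (intro affine_perm_comp affine_perm_sgen) simp_all
  then show ?case by (simp only: word_prod_simps)
qed

lemma affine_periodic: "affine_perm n w \<Longrightarrow> periodic_bij w"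
  by (simp add: affine_perm_iff)

lemma inv_word_Cons:
  assumes "is_word n (a # ws)"
  shows "inv (word_prod n (a # ws)) = inv (word_prod n ws) \<circ> sgen n a"
  using assms inv_comp_periodic[OF periodic_bij_sgen affine_periodic[OF affine_perm_word]]
  by (simp add: inv_sgen)

lemma ninv_sgen_le:
  assumes "periodic_bij f" "a < n" shows "ninv (f \<circ> sgen n a) \<le> ninv f + 1"
  using ninv_cyc(1)[OF assms(1) proper_singleton[OF assms(2)]] assms by (simp add: sgen_cyc)

lemma ninv_id: "ninv id = 0"
  by (simp add: ninv_def code_entry_def)

lemma ninv_word: "is_word n ws \<Longrightarrow> ninv (inv (word_prod n ws)) \<le> length ws"
proof (induction ws)
  case Nil
  then show ?case using ninv_id by (simp del: id_apply add: inv_id)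
next
  case (Cons a ws)
  then have "ninv (inv (word_prod n ws) \<circ> sgen n a) \<le> length ws + 1"
    using ninv_sgen_le[OF periodic_bij_inv[OF affine_periodic[OF affine_perm_word]], of ws a]
    by force
  then show ?case unfolding inv_word_Cons[OF Cons.prems] by (simp only: list.size)
qed

text \<open>An increasing bijection of the integers cannot skip a value, so it is a translation, and
  zero displacement makes the translation trivial.\<close>

lemma increasing_affine_id:
  assumes "affine_perm n f" "\<And>a. a < n \<Longrightarrow> f (int a) < f (int a + 1)"
  shows "f = id"
proof -
  have p: "periodic_bij f" using assms affine_periodic by blast
  have step: "f j < f (j + 1)" for j
  proof -
    have "f (j mod N) < f (j mod N + 1)"
      using assms(2)[of "nat (j mod N)"] by (simp add: nat_less_iff)
    then show ?thesis
      using periodic_bij_add[OF p, of "j mod N" "j div N"]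
        periodic_bij_add[OF p, of "j mod N + 1" "j div N"]
      by (simp add: algebra_simps)
  qed
  have mono: "f i < f (i + 1 + int k)" for i k
  proof (induction k)
    case (Suc k)
    then show ?case using step[of "i + 1 + int k"] by (simp add: algebra_simps)
  qed (use step in simp)
  have mono': "f i < f j" if "i < j" for i j
    using mono[of i "nat (j - i - 1)"] that by simp
  have succ: "f (j + 1) = f j + 1" for j
  proof (rule ccontr)
    assume "f (j + 1) \<noteq> f j + 1"
    then have gt: "f j + 1 < f (j + 1)" using step[of j] by linarith
    obtain k where k: "f k = f j + 1" using comp_inv_periodic(4)[OF p] by metis
    have "j < k"
    proof (rule ccontr)
      assume "\<not> j < k"
      then show False using mono'[of k j] k by (cases "k = j") auto
    qed
    moreover have "k < j + 1"
    proof (rule ccontr)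
      assume "\<not> k < j + 1"
      then show False using mono'[of "j + 1" k] k gt by (cases "k = j + 1") auto
    qed
    ultimately show False by simp
  qed
  have lin: "f (int k) = f 0 + int k" for k
  proof (induction k)
    case (Suc k)
    then show ?case using succ[of "int k"] by (simp add: algebra_simps)
  qed simp
  have f: "f j - j = f 0" if "j \<in> {0..<N}" for j using lin[of "nat j"] that by simp
  have "disp f = (\<Sum>j\<in>{0..<N}. f 0)" unfolding disp_def by (rule sum.cong) (use f in auto)
  then have "f 0 = 0" using assms(1) by (simp add: affine_perm_iff)
  then have "f j = j" for j
    using periodic_bij_add[OF p, of "j mod N" "j div N"] f[of "j mod N"] by simp
  then show ?thesis by auto
qed

text \<open>A non-identity element has a descent in its inverse, and stripping the corresponding
  generator on the left removes exactly one inversion.\<close>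

lemma reduced_word_exists:
  assumes "affine_perm n w"
  shows "\<exists>ws. is_word n ws \<and> word_prod n ws = w \<and> length ws = ninv (inv w)"
  using assms
proof (induction "ninv (inv w)" arbitrary: w rule: less_induct)
  case less
  note pw = affine_periodic[OF less.prems]
  show ?case
  proof (cases "inv w = id")
    case True
    then have "w = id" using comp_inv_periodic(3)[OF pw] by (metis inv_id)
    then show ?thesis using ninv_id by (intro exI[of _ "[]"]) simp
  next
    case False
    then obtain a where a: "a < n" "\<not> inv w (int a) < inv w (int a + 1)"
      using increasing_affine_id[OF affine_perm_inv[OF less.prems]] by blast
    then have gt: "inv w (int a) > inv w (int a + 1)"
      using periodic_bij_inj[OF periodic_bij_inv[OF pw], of "int a" "int a + 1"] by simp
    let ?u = "sgen n a \<circ> w"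
    have iu: "inv ?u = inv w \<circ> sgen n a"
      using inv_comp_periodic[OF periodic_bij_sgen[OF a(1)] pw] inv_sgen[OF a(1)] by simp
    have ni: "ninv (inv w) = ninv (inv ?u) + 1"
      unfolding iu by (rule ninv_sgen_down[OF periodic_bij_inv[OF pw] a(1) gt])
    have "affine_perm n ?u" using affine_perm_comp[OF affine_perm_sgen[OF a(1)] less.prems] .
    then obtain ws where ws: "is_word n ws" "word_prod n ws = ?u" "length ws = ninv (inv ?u)"
      using less.hyps[of ?u] ni by auto
    have "sgen n a \<circ> ?u = w" using sgen_invol[OF a(1)] by (simp add: comp_assoc[symmetric])
    then show ?thesis using ws a ni by (intro exI[of _ "a # ws"]) simp
  qed
qed

lemma alen_eq:
  assumes "affine_perm n w" shows "alen n w = ninv (inv w)"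
  unfolding alen_def
proof (rule Least_equality)
  show "\<exists>ws. is_word n ws \<and> length ws = ninv (inv w) \<and> word_prod n ws = w"
    using reduced_word_exists[OF assms] by blast
  show "ninv (inv w) \<le> k" if "\<exists>ws. is_word n ws \<and> length ws = k \<and> word_prod n ws = w" for k
    using that ninv_word by blast
qed

section \<open>Cyclically decreasing words as proper sets of residues\<close>

definition dec_word :: "nat list \<Rightarrow> bool" where
  "dec_word ws \<longleftrightarrow> is_word n ws \<and> distinct ws \<and>
      (\<forall>p q. p < length ws \<and> q < length ws \<and> ws ! q = (ws ! p + 1) mod n \<longrightarrow> q < p)"

text \<open>The offset by one records the site that is jumped over: the generator s_a lets the value
  at a pass the site a + 1.\<close>

definition letters :: "nat list \<Rightarrow> int set" where
  "letters ws = (\<lambda>i. (int i + 1) mod N) ` set ws"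

lemma dec_wordD: "dec_word ws \<Longrightarrow> is_word n ws" "dec_word ws \<Longrightarrow> distinct ws"
  by (simp_all add: dec_word_def)

text \<open>Since a + 1 may not occur after a, the condition on pairs of places reduces to a test of
  the first letter against the remaining ones, which suits induction.\<close>

lemma dec_word_Cons:
  "dec_word (a # ws) \<longleftrightarrow> a < n \<and> a \<notin> set ws \<and> (a + 1) mod n \<notin> set ws \<and> dec_word ws"
proof
  assume d: "dec_word (a # ws)"
  then have c: "q < p" if "p < length (a # ws)" "q < length (a # ws)"
      "(a # ws) ! q = ((a # ws) ! p + 1) mod n" for p q
    using that unfolding dec_word_def by blast
  have "(a + 1) mod n \<notin> set ws"
  proof
    assume "(a + 1) mod n \<in> set ws"
    then obtain q where "q < length ws" "ws ! q = (a + 1) mod n" by (auto simp: in_set_conv_nth)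
    then show False using c[of 0 "Suc q"] by simp
  qed
  moreover have "dec_word ws"
    unfolding dec_word_def
  proof (intro conjI allI impI)
    fix p q assume "p < length ws \<and> q < length ws \<and> ws ! q = (ws ! p + 1) mod n"
    then show "q < p" using c[of "Suc p" "Suc q"] by simp
  qed (use dec_wordD[OF d] in simp_all)
  ultimately show "a < n \<and> a \<notin> set ws \<and> (a + 1) mod n \<notin> set ws \<and> dec_word ws"
    using dec_wordD[OF d] by simp
next
  assume r: "a < n \<and> a \<notin> set ws \<and> (a + 1) mod n \<notin> set ws \<and> dec_word ws"
  have a1: "(a + 1) mod n \<noteq> a"
    using mod_succ_neq(1)[of "int a"] r
    by (metis mod_less of_nat_1 of_nat_add of_nat_mod)
  have "q < p" if pq: "p < length (a # ws)" "q < length (a # ws)"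
      "(a # ws) ! q = ((a # ws) ! p + 1) mod n" for p q
  proof (cases p)
    case 0
    show ?thesis
    proof (cases q)
      case 0
      then show ?thesis using pq \<open>p = 0\<close> a1 by simp
    next
      case (Suc q')
      then have "(a + 1) mod n \<in> set ws" using pq \<open>p = 0\<close> nth_mem[of q' ws] by simp
      then show ?thesis using r by blast
    qed
  next
    case (Suc p')
    show ?thesis
    proof (cases q)
      case (Suc q')
      have "q' < p'" using pq r \<open>p = Suc p'\<close> Suc unfolding dec_word_def by (metis Suc_less_eq length_Cons nth_Cons_Suc)
      then show ?thesis using \<open>p = Suc p'\<close> Suc by simp
    qed (simp add: \<open>p = Suc p'\<close>)
  qed
  then have "\<forall>p q. p < length (a # ws) \<and> q < length (a # ws)
      \<and> (a # ws) ! q = ((a # ws) ! p + 1) mod n \<longrightarrow> q < p" by blast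
  moreover have "is_word n (a # ws)" "distinct (a # ws)" using r dec_wordD[of ws] by simp_all
  ultimately show "dec_word (a # ws)" unfolding dec_word_def by blast
qed

lemma letters_Cons: "letters (a # ws) = insert ((int a + 1) mod N) (letters ws)"
  by (simp add: letters_def)

lemma in_letters: "a < n \<Longrightarrow> is_word n ws \<Longrightarrow> (int a + 1) mod N \<in> letters ws \<longleftrightarrow> a \<in> set ws"
proof
  assume a: "a < n" "is_word n ws" "(int a + 1) mod N \<in> letters ws"
  then obtain b where b: "b \<in> set ws" "(int a + 1) mod N = (int b + 1) mod N"
    by (auto simp: letters_def)
  then have "b < n" using a by (auto simp: is_word_def)
  then show "a \<in> set ws" using b a(1) mod_add_cancel[of "int a" 1 "int b"] by simp
qed (auto simp: letters_def)

lemma in_letters_2: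
  assumes "a < n" "is_word n ws"
  shows "(int a + 2) mod N \<in> letters ws \<longleftrightarrow> (a + 1) mod n \<in> set ws"
proof -
  have "(int ((a + 1) mod n) + 1) mod N = (int a + 2) mod N"
    by (simp only: of_nat_mod of_nat_add of_nat_1 mod_add_left_eq) (simp add: add.assoc)
  then show ?thesis using in_letters[of "(a + 1) mod n" ws] assms by simp
qed

lemma dec_word_cyc:
  "dec_word ws \<Longrightarrow> proper (letters ws) \<and> card (letters ws) = length ws
     \<and> inv (word_prod n ws) = cyc (letters ws)"
proof (induction ws)
  case Nil
  then show ?case by (simp add: letters_def cyc_empty)
next
  case (Cons a ws)
  then have "is_word n ws" "a < n" using dec_wordD(1)[of ws] by (simp_all add: dec_word_Cons)
  then have w: "is_word n ws" "is_word n (a # ws)" by simp_all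
  have a: "a < n" "a \<notin> set ws" "(a + 1) mod n \<notin> set ws"
    and IH: "proper (letters ws)" "card (letters ws) = length ws"
      "inv (word_prod n ws) = cyc (letters ws)"
    using Cons by (simp_all add: dec_word_Cons)
  have ni: "(int a + 1) mod N \<notin> letters ws" "(int a + 2) mod N \<notin> letters ws"
    using in_letters[OF a(1) w(1)] in_letters_2[OF a(1) w(1)] a by auto
  show ?case
    unfolding letters_Cons inv_word_Cons[OF w(2)] IH(3)
    using cyc_insert[OF IH(1) ni a(1)] ni IH(2) proper_finite[OF IH(1)] by simp
qed

text \<open>A proper nonempty set contains some x with x + 1 outside it, the top of a cyclic run.
  Its letter x - 1 may come first, because neither x - 1 nor x is a letter of the rest.\<close>

lemma dec_word_exists: "proper A \<Longrightarrow> \<exists>ws. dec_word ws \<and> letters ws = A"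
proof (induction "card A" arbitrary: A)
  case 0
  then have "A = {}" using proper_finite[of A] by simp
  then show ?case by (intro exI[of _ "[]"]) (auto simp: dec_word_def letters_def)
next
  case (Suc k)
  note fin = proper_finite[OF Suc.prems]
  have "A \<noteq> {}" using Suc.hyps by auto
  have "\<exists>x\<in>A. (x + 1) mod N \<notin> A"
  proof (rule ccontr)
    assume neg: "\<not> (\<exists>x\<in>A. (x + 1) mod N \<notin> A)"
    obtain x where x: "x \<in> A" using \<open>A \<noteq> {}\<close> by blast
    have all: "(x + int k) mod N \<in> A" for k
    proof (induction k)
      case 0
      then show ?case using x proper_mod[OF Suc.prems] by simp
    next
      case (Suc k)
      then have "((x + int k) mod N + 1) mod N \<in> A" using neg by blast
      moreover have "((x + int k) mod N + 1) mod N = (x + int (Suc k)) mod N"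
        by (simp only: mod_add_left_eq of_nat_Suc) (simp add: algebra_simps)
      ultimately show ?case by simp
    qed
    obtain y where y: "y \<in> {0..<N}" "y \<notin> A" using Suc.prems unfolding proper_def by blast
    have "(x + int (nat ((y - x) mod N))) mod N = y"
      using y by (simp add: mod_add_right_eq)
    then show False using all[of "nat ((y - x) mod N)"] y by simp
  qed
  then obtain x where x: "x \<in> A" "(x + 1) mod N \<notin> A" by blast
  define B where "B = A - {x}"
  have pB: "proper B" using Suc.prems unfolding proper_def B_def by auto
  have "k = card B" using Suc.hyps x fin unfolding B_def by simp
  then obtain ws where ws: "dec_word ws" "letters ws = B" using Suc.hyps(1) pB by blast
  define a where "a = nat ((x - 1) mod N)"
  have a: "a < n" unfolding a_def by (simp add: nat_less_iff)
  have ia: "int a = (x - 1) mod N" unfolding a_def by simp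
  have a1: "(int a + 1) mod N = x" "(int a + 2) mod N = (x + 1) mod N"
    unfolding ia 
    using proper_mod[OF Suc.prems x(1)] mod_add_left_eq[of "x - 1" N 1] mod_add_left_eq[of "x - 1" N 2]
    by (simp_all add: add.commute)
  have w: "is_word n ws" using ws by (simp add: dec_word_def)
  have "a \<notin> set ws" "(a + 1) mod n \<notin> set ws"
    using in_letters[OF a w] in_letters_2[OF a w] x unfolding ws(2) a1 B_def by auto
  then have "dec_word (a # ws)" using a ws by (simp add: dec_word_Cons)
  moreover have "letters (a # ws) = A" unfolding letters_Cons a1 ws(2) B_def using x by auto
  ultimately show ?case by blast
qed

lemma valid_id: "proper A \<Longrightarrow> valid id A"
  by (simp add: valid_def pred_out_less)

lemma ninv_cyc_id: "proper A \<Longrightarrow> ninv (cyc A) = card A"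
  using ninv_cyc(2)[of id A] valid_id[of A] ninv_id by simp

lemma affine_perm_cyc: "proper A \<Longrightarrow> affine_perm n (cyc A)"
proof -
  assume "proper A"
  then obtain ws where ws: "dec_word ws" "letters ws = A" using dec_word_exists by blast
  then have "cyc A = inv (word_prod n ws)" using dec_word_cyc by metis
  then show ?thesis using affine_perm_inv[OF affine_perm_word] ws by (simp add: dec_word_def)
qed

text \<open>Reducedness is automatic: over the identity every jump is allowed, so
  \<open>cyc A\<close> has as many inversions as the word of A has letters.\<close>

lemma cyc_dec_iff:
  "cyc_dec n v \<and> alen n v = k \<longleftrightarrow> (\<exists>A. proper A \<and> card A = k \<and> v = inv (cyc A))"
proof
  assume v: "cyc_dec n v \<and> alen n v = k"
  then obtain ws where ws: "reduced_word n ws v" "dec_word ws"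
    unfolding cyc_dec_def dec_word_def reduced_word_def by blast
  note d = dec_word_cyc[OF ws(2)]
  have "v = inv (inv v)"
    using ws affine_periodic[OF affine_perm_word] comp_inv_periodic(3)
    unfolding reduced_word_def by metis
  then have "v = inv (cyc (letters ws))" using ws d unfolding reduced_word_def by metis
  then show "\<exists>A. proper A \<and> card A = k \<and> v = inv (cyc A)"
    using v d ws unfolding reduced_word_def by metis
next
  assume "\<exists>A. proper A \<and> card A = k \<and> v = inv (cyc A)"
  then obtain A where A: "proper A" "card A = k" "v = inv (cyc A)" by blast
  obtain ws where ws: "dec_word ws" "letters ws = A" using A dec_word_exists by blast
  note d = dec_word_cyc[OF ws(1)]
  have av: "affine_perm n v" using A affine_perm_inv[OF affine_perm_cyc] by blast
  have vw: "word_prod n ws = v"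
    using d A ws affine_periodic[OF affine_perm_word, of ws] comp_inv_periodic(3)
    unfolding dec_word_def by metis
  have "inv v = cyc A"
    using A comp_inv_periodic(3)[OF periodic_bij_cyc] by blast
  then have al: "alen n v = k" using alen_eq[OF av] ninv_cyc_id A by simp
  then have "reduced_word n ws v"
    using vw ws d A unfolding reduced_word_def dec_word_def by metis
  then show "cyc_dec n v \<and> alen n v = k"
    using al ws unfolding cyc_dec_def dec_word_def by blast
qed

end

section \<open>Commutation of the row operators\<close>

text \<open>Two carriers cross a site of colour \<open>a\<close> one after the other and leave the colour \<open>b\<close> there. A
  carrier either swaps its colour with the site, or passes it, which is allowed only if the carrier
  colour is the smaller one and costs a factor \<open>x\<close> (first carrier) or \<open>y\<close> (second carrier).\<close>

definition transfer ::
    "'r::comm_ring_1 \<Rightarrow> 'r \<Rightarrow> int \<Rightarrow> int \<Rightarrow> (int \<Rightarrow> int \<Rightarrow> 'r) \<Rightarrow> int \<Rightarrow> int \<Rightarrow> 'r" where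
  "transfer x y a b \<phi> c1 c2 =
     (if c2 = b then \<phi> a c1 else 0)
   + (if c1 < a \<and> c2 = b then x * \<phi> c1 a else 0)
   + (if c2 < c1 \<and> c1 = b then y * \<phi> a c2 else 0)
   + (if c1 < a \<and> c2 < a \<and> a = b then x * y * \<phi> c1 c2 else 0)"

definition rmat :: "'r::comm_ring_1 \<Rightarrow> (int \<Rightarrow> int \<Rightarrow> 'r) \<Rightarrow> int \<Rightarrow> int \<Rightarrow> 'r" where
  "rmat z \<phi> c1 c2 = \<phi> c1 c2 + (if c2 < c1 then z * \<phi> c2 c1 else 0)"

text \<open>Only the relative order of c1, c2, a and the question which of them equals b enter, so
  finitely many cases remain, each a polynomial identity in x and y.\<close>

lemma yang_baxter:
  "rmat (x - y) (transfer x y a b \<phi>) = transfer y x a b (rmat (x - y) \<phi>)"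
proof (intro ext)
  fix c1 c2 :: int
  have "c1 < c2 \<or> c1 = c2 \<or> c2 < c1" "c1 < a \<or> c1 = a \<or> a < c1" "c2 < a \<or> c2 = a \<or> a < c2"
    "b = a \<or> b = c1 \<or> b = c2 \<or> (b \<noteq> a \<and> b \<noteq> c1 \<and> b \<noteq> c2)" by linarith+
  then show "rmat (x - y) (transfer x y a b \<phi>) c1 c2
      = transfer y x a b (rmat (x - y) \<phi>) c1 c2"
    unfolding rmat_def transfer_def by (elim disjE conjE) (simp_all add: algebra_simps)
qed

text \<open>The operators act on functions of the outgoing carriers, which is why the last site acts
  on \<phi> first.\<close>

primrec row_transfer ::
    "'r::comm_ring_1 \<Rightarrow> 'r \<Rightarrow> (int \<Rightarrow> int) \<Rightarrow> (int \<Rightarrow> int) \<Rightarrow> nat \<Rightarrow> (int \<Rightarrow> int \<Rightarrow> 'r) \<Rightarrow> int \<Rightarrow> int \<Rightarrow> 'r"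
where
  "row_transfer x y f h 0 \<phi> = \<phi>"
| "row_transfer x y f h (Suc m) \<phi> = row_transfer x y f h m (transfer x y (f (int m)) (h (int m)) \<phi>)"

lemma yang_baxter_row:
  "rmat (x - y) (row_transfer x y f h m \<phi>) = row_transfer y x f h m (rmat (x - y) \<phi>)"
  by (induction m arbitrary: \<phi>) (simp_all add: yang_baxter)

lemma row_transfer_linear:
  "row_transfer x y f h m (\<lambda>c1 c2. \<phi> c1 c2 + z * \<psi> c1 c2) c1 c2
     = row_transfer x y f h m \<phi> c1 c2 + z * row_transfer x y f h m \<psi> c1 c2"
proof (induction m arbitrary: \<phi> \<psi> c1 c2)
  case (Suc m)
  have "transfer x y a b (\<lambda>c1 c2. \<phi> c1 c2 + z * \<psi> c1 c2)
      = (\<lambda>c1 c2. transfer x y a b \<phi> c1 c2 + z * transfer x y a b \<psi> c1 c2)" for a b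
    unfolding transfer_def by (intro ext) (auto simp: algebra_simps)
  then show ?case using Suc by simp
qed simp

definition delta :: "int \<Rightarrow> int \<Rightarrow> int \<Rightarrow> int \<Rightarrow> 'r::comm_ring_1" where
  "delta d1 d2 c1 c2 = (if c1 = d1 \<and> c2 = d2 then 1 else 0)"

text \<open>The exchange relation at a single matrix entry, from carriers (c1, c2) to (d1, d2). On
  the output side the test becomes d1 < d2, because u sends the indicator of (d1, d2) to that of
  (d2, d1).\<close>

lemma rmat_row_delta:
  "row_transfer x y f h m (delta d1 d2) c1 c2
      + (if c2 < c1 then (x - y) * row_transfer x y f h m (delta d1 d2) c2 c1 else 0)
    = row_transfer y x f h m (delta d1 d2) c1 c2
      + (if d1 < d2 then (x - y) * row_transfer y x f h m (delta d2 d1) c1 c2 else 0)"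
proof -
  have "rmat (x - y) (delta d1 d2)
      = (\<lambda>c1 c2. delta d1 d2 c1 c2 + (if d1 < d2 then x - y else 0) * delta d2 d1 c1 c2)"
    by (intro ext) (auto simp: rmat_def delta_def)
  then have "row_transfer y x f h m (rmat (x - y) (delta d1 d2)) c1 c2
      = row_transfer y x f h m (delta d1 d2) c1 c2
        + (if d1 < d2 then x - y else 0) * row_transfer y x f h m (delta d2 d1) c1 c2"
    by (simp add: row_transfer_linear)
  then show ?thesis
    using fun_cong[OF fun_cong[OF yang_baxter_row[of x y f h m "delta d1 d2"]], of c1 c2]
    by (simp add: rmat_def split: if_splits)
qed

text \<open>A twisted trace over the colours of the two carriers. Conjugation by the R-matrix, which is
  unipotent on each span of \<open>(p, q)\<close> and \<open>(q, p)\<close>, leaves it unchanged.\<close>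

lemma trace_commute:
  fixes x y :: "'r::{idom,ring_char_0}"
  shows "(\<Sum>c1\<in>X. \<Sum>c2\<in>X. row_transfer x y f h m (delta (c1 + s) (c2 + s)) c1 c2)
       = (\<Sum>c1\<in>X. \<Sum>c2\<in>X. row_transfer y x f h m (delta (c1 + s) (c2 + s)) c1 c2)"
proof -
  let ?K = "\<lambda>x y c1 c2. row_transfer x y f h m (delta (c1 + s) (c2 + s)) c1 c2"
  have pair: "?K x y p q + ?K x y q p = ?K y x p q + ?K y x q p" if "p < q" for p q
  proof -
    \<comment> \<open>The entry leading from (p, q) to the exchanged pair. The diagonal entries at
      (p, q) and (q, p) receive the corrections (x - y) L and -(x - y) L, which cancel once L is
      seen to be symmetric in x and y.\<close>
    let ?L = "\<lambda>x y. row_transfer x y f h m (delta (q + s) (p + s)) p q"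
    have "?K x y p q = ?K y x p q + (x - y) * ?L y x"
      using that rmat_row_delta[of x y f h m "p + s" "q + s" p q] by simp
    moreover have "?K x y q p = ?K y x q p - (x - y) * ?L x y"
      using that rmat_row_delta[of x y f h m "q + s" "p + s" q p] by (simp add: eq_diff_eq)
    moreover have "?L x y = ?L y x"
      using that rmat_row_delta[of x y f h m "q + s" "p + s" p q] by simp
    ultimately show ?thesis by simp
  qed
  have diag: "?K x y p p = ?K y x p p" for p
    using rmat_row_delta[of x y f h m "p + s" "p + s" p p] by simp
  have sym: "?K x y p q + ?K x y q p = ?K y x p q + ?K y x q p" for p q
    using pair[of p q] pair[of q p] diag[of p] by (cases p q rule: linorder_cases) (auto simp: add.commute)
  \<comment> \<open>Only the sum of the entries at (c1, c2) and (c2, c1) is known to be symmetric.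
    Doubling brings the two together; characteristic zero then removes the factor 2.\<close>
  have dbl: "2 * (\<Sum>c1\<in>X. \<Sum>c2\<in>X. ?K x y c1 c2) = (\<Sum>c1\<in>X. \<Sum>c2\<in>X. ?K x y c1 c2 + ?K x y c2 c1)"
    for x y :: 'r
    unfolding sum.distrib mult_2 using sum.swap[of "\<lambda>c1 c2. ?K x y c2 c1" X X] by simp
  have "2 * (\<Sum>c1\<in>X. \<Sum>c2\<in>X. ?K x y c1 c2) = 2 * (\<Sum>c1\<in>X. \<Sum>c2\<in>X. ?K y x c1 c2)"
    unfolding dbl by (intro sum.cong refl sym)
  then show ?thesis by simp
qed

section \<open>Expanding the transfer over the sets of passed sites\<close>

primrec carrier_at :: "(int \<Rightarrow> int) \<Rightarrow> int set \<Rightarrow> int \<Rightarrow> nat \<Rightarrow> int" where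
  "carrier_at f A c 0 = c"
| "carrier_at f A c (Suc j) = (if int j \<in> A then carrier_at f A c j else f (int j))"

definition row_out :: "(int \<Rightarrow> int) \<Rightarrow> int set \<Rightarrow> int \<Rightarrow> int \<Rightarrow> int" where
  "row_out f A c j = (if j \<in> A then f j else carrier_at f A c (nat j))"

definition row_ok :: "(int \<Rightarrow> int) \<Rightarrow> int set \<Rightarrow> int \<Rightarrow> nat \<Rightarrow> bool" where
  "row_ok f A c m \<longleftrightarrow> (\<forall>j<m. int j \<in> A \<longrightarrow> carrier_at f A c j < f (int j))"

lemma carrier_at_cong:
  "(\<And>i. i < j \<Longrightarrow> (int i \<in> A) = (int i \<in> A') \<and> f (int i) = f' (int i)) \<Longrightarrow>
     carrier_at f A c j = carrier_at f' A' c j"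
  by (induction j) auto

lemma row_out_cong:
  assumes "\<And>i. i \<le> j \<Longrightarrow> (int i \<in> A) = (int i \<in> A') \<and> f (int i) = f' (int i)"
  shows "row_out f A c (int j) = row_out f' A' c (int j)"
  using carrier_at_cong[of j A A' f f' c] assms[of j] assms by (simp add: row_out_def)

lemma row_ok_cong:
  assumes "\<And>i. i < m \<Longrightarrow> (int i \<in> A) = (int i \<in> A') \<and> f (int i) = f' (int i)"
  shows "row_ok f A c m = row_ok f' A' c m"
proof -
  have "carrier_at f A c j = carrier_at f' A' c j" if "j < m" for j
    using that assms by (intro carrier_at_cong) auto
  then show ?thesis using assms by (auto simp: row_ok_def)
qed

lemma row_ok_Suc:
  "row_ok f A c (Suc m) \<longleftrightarrow> row_ok f A c m \<and> (int m \<in> A \<longrightarrow> carrier_at f A c m < f (int m))"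
  by (auto simp: row_ok_def less_Suc_eq)

definition two_row_weight ::
    "'r::comm_ring_1 \<Rightarrow> 'r \<Rightarrow> (int \<Rightarrow> int) \<Rightarrow> (int \<Rightarrow> int) \<Rightarrow> nat \<Rightarrow> (int \<Rightarrow> int \<Rightarrow> 'r) \<Rightarrow> int \<Rightarrow> int
      \<Rightarrow> int set \<Rightarrow> int set \<Rightarrow> 'r" where
  "two_row_weight x y f h m \<phi> c1 c2 A B =
     (if row_ok f A c1 m \<and> row_ok (row_out f A c1) B c2 m
         \<and> (\<forall>j<m. row_out (row_out f A c1) B c2 (int j) = h (int j))
      then x ^ card A * y ^ card B * \<phi> (carrier_at f A c1 m) (carrier_at (row_out f A c1) B c2 m)
      else 0)"

lemma sum_Pow_insert:
  assumes "finite S" "a \<notin> S"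
  shows "sum F (Pow (insert a S)) = (\<Sum>A\<in>Pow S. F A + F (insert a A))"
proof -
  have "sum F (Pow (insert a S)) = sum F (Pow S) + sum F (insert a ` Pow S)"
    unfolding Pow_insert using assms by (intro sum.union_disjoint) auto
  also have "sum F (insert a ` Pow S) = (\<Sum>A\<in>Pow S. F (insert a A))"
    using assms by (intro sum.reindex_cong[of "insert a"]) (auto simp: inj_on_def)
  finally show ?thesis by (simp add: sum.distrib)
qed

text \<open>The four summands of \<open>transfer\<close> are the four choices of which carriers pass
  site m, that is, of whether m joins A and whether it joins B; nothing at earlier sites is
  affected.\<close>

lemma two_row_weight_Suc:
  assumes "A \<subseteq> {0..<int m}" "B \<subseteq> {0..<int m}"
  shows "two_row_weight x y f h m (transfer x y (f (int m)) (h (int m)) \<phi>) c1 c2 A B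
    = two_row_weight x y f h (Suc m) \<phi> c1 c2 A B
    + two_row_weight x y f h (Suc m) \<phi> c1 c2 (insert (int m) A) B
    + two_row_weight x y f h (Suc m) \<phi> c1 c2 A (insert (int m) B)
    + two_row_weight x y f h (Suc m) \<phi> c1 c2 (insert (int m) A) (insert (int m) B)"
proof -
  let ?A = "insert (int m) A" and ?B = "insert (int m) B"
  let ?g = "row_out f A c1" and ?g' = "row_out f ?A c1"
  let ?k = "carrier_at f A c1 m" and ?l = "carrier_at ?g B c2 m"
  have fin: "finite A" "finite B" using assms finite_subset by blast+
  have m: "int m \<notin> A" "int m \<notin> B" using assms by auto
  have [simp]: "card ?A = Suc (card A)" "card ?B = Suc (card B)" using fin m by auto
  have kA: "carrier_at f ?A c1 m = ?k" by (rule carrier_at_cong) auto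
  have gm: "?g (int m) = ?k" "?g' (int m) = f (int m)" using m by (simp_all add: row_out_def)
  have gj: "?g' (int j) = ?g (int j)" if "j < m" for j
    using that by (intro row_out_cong) auto
  have l: "carrier_at ?g ?B c2 m = ?l" "carrier_at ?g' B c2 m = ?l" "carrier_at ?g' ?B c2 m = ?l"
    by (rule carrier_at_cong; use gj in auto)+
  have okA: "row_ok f ?A c1 m = row_ok f A c1 m" by (rule row_ok_cong) auto
  have okB: "row_ok ?g ?B c2 m = row_ok ?g B c2 m" "row_ok ?g' B c2 m = row_ok ?g B c2 m"
      "row_ok ?g' ?B c2 m = row_ok ?g B c2 m"
    by (rule row_ok_cong; use gj in auto)+
  have outj: "row_out ?g ?B c2 (int j) = row_out ?g B c2 (int j)"
      "row_out ?g' B c2 (int j) = row_out ?g B c2 (int j)"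
      "row_out ?g' ?B c2 (int j) = row_out ?g B c2 (int j)" if "j < m" for j
    by (rule row_out_cong; use gj that in auto)+
  have outm: "row_out ?g B c2 (int m) = ?l" "row_out ?g ?B c2 (int m) = ?k"
      "row_out ?g' B c2 (int m) = ?l" "row_out ?g' ?B c2 (int m) = f (int m)"
    using m gm l by (simp_all add: row_out_def)
  let ?Q = "\<forall>j<m. row_out ?g B c2 (int j) = h (int j)"
  have out: "(\<forall>j<Suc m. row_out ?g B c2 (int j) = h (int j)) \<longleftrightarrow> ?Q \<and> ?l = h (int m)"
      "(\<forall>j<Suc m. row_out ?g ?B c2 (int j) = h (int j)) \<longleftrightarrow> ?Q \<and> ?k = h (int m)"
      "(\<forall>j<Suc m. row_out ?g' B c2 (int j) = h (int j)) \<longleftrightarrow> ?Q \<and> ?l = h (int m)"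
      "(\<forall>j<Suc m. row_out ?g' ?B c2 (int j) = h (int j)) \<longleftrightarrow> ?Q \<and> f (int m) = h (int m)"
    using outj outm by (auto simp: less_Suc_eq)
  let ?P = "row_ok f A c1 m \<and> row_ok ?g B c2 m \<and> ?Q"
  let ?w = "x ^ card A * y ^ card B" and ?a = "f (int m)" and ?b = "h (int m)"
  have W: "two_row_weight x y f h m \<psi> c1 c2 A B = (if ?P then ?w * \<psi> ?k ?l else 0)" for \<psi>
    unfolding two_row_weight_def by simp
  have W00: "two_row_weight x y f h (Suc m) \<phi> c1 c2 A B
      = (if ?P \<and> ?l = ?b then ?w * \<phi> ?a ?k else 0)"
    unfolding two_row_weight_def row_ok_Suc out carrier_at.simps gm using m by auto
  have W10: "two_row_weight x y f h (Suc m) \<phi> c1 c2 ?A B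
      = (if ?P \<and> ?k < ?a \<and> ?l = ?b then x * ?w * \<phi> ?k ?a else 0)"
    unfolding two_row_weight_def row_ok_Suc out carrier_at.simps gm okA okB kA l using m by auto
  have W01: "two_row_weight x y f h (Suc m) \<phi> c1 c2 A ?B
      = (if ?P \<and> ?l < ?k \<and> ?k = ?b then y * ?w * \<phi> ?a ?l else 0)"
    unfolding two_row_weight_def row_ok_Suc out carrier_at.simps gm okA okB kA l using m by auto
  have W11: "two_row_weight x y f h (Suc m) \<phi> c1 c2 ?A ?B
      = (if ?P \<and> ?k < ?a \<and> ?l < ?a \<and> ?a = ?b then x * y * ?w * \<phi> ?k ?l else 0)"
    unfolding two_row_weight_def row_ok_Suc out carrier_at.simps gm okA okB kA l using m by auto
  define P where "P \<longleftrightarrow> ?P"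
  note W' = W[folded P_def] W00[folded P_def] W10[folded P_def] W01[folded P_def] W11[folded P_def]
  show ?thesis
  proof (cases P)
    case True
    show ?thesis unfolding W' transfer_def if_P[OF True] distrib_left
      by (intro arg_cong2[where f = "(+)"]; use True in \<open>simp add: mult_ac\<close>)
  next
    case False
    then show ?thesis unfolding W' by simp
  qed
qed

lemma row_transfer_expand:
  "row_transfer x y f h m \<phi> c1 c2
     = (\<Sum>A\<in>Pow {0..<int m}. \<Sum>B\<in>Pow {0..<int m}. two_row_weight x y f h m \<phi> c1 c2 A B)"
proof (induction m arbitrary: \<phi>)
  case 0
  then show ?case by (simp add: two_row_weight_def row_ok_def)
next
  case (Suc m)
  have I: "{0..<int (Suc m)} = insert (int m) {0..<int m}" by auto
  have nm: "int m \<notin> {0..<int m}" by simp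
  show ?case
    unfolding I sum_Pow_insert[OF finite_atLeastLessThan_int nm] row_transfer.simps Suc
    unfolding sum.distrib[symmetric]
    by (intro sum.cong refl) (auto simp: two_row_weight_Suc algebra_simps)
qed

section \<open>Closing the rows to a circle\<close>

context affine
begin

text \<open>When it starts with the colour left over from the preceding period, the carrier always
  holds the value of the last site with which it swapped.\<close>

lemma carrier_at_pred_out:
  assumes "proper A" "j \<le> n"
  shows "carrier_at f A (f (pred_out A 0)) j = f (pred_out A (int j))"
  using assms(2)
proof (induction j)
  case (Suc j)
  then show ?case using pred_out_Suc[OF assms(1), of "int j"] by (simp add: add.commute)
qed simp

text \<open>One swap makes the carrier forget its starting colour, and a proper set leaves at least
  one site to swap with.\<close>

lemma carrier_at_end:
  assumes "proper A"
  shows "carrier_at f A c n = f (pred_out A N)"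
proof -
  have "carrier_at f A c j = (if \<exists>i<j. int i \<notin> A then f (pred_out A (int j)) else c)"
    if "j \<le> n" for j
    using that
  proof (induction j)
    case (Suc j)
    then show ?case using pred_out_Suc[OF assms(1), of "int j"]
      by (auto simp: add.commute less_Suc_eq)
  qed simp
  moreover have "\<exists>i<n. int i \<notin> A"
  proof -
    obtain a where "a \<in> {0..<N}" "a \<notin> A" using assms unfolding proper_def by blast
    then show ?thesis by (intro exI[of _ "nat a"]) auto
  qed
  ultimately show ?thesis by simp
qed

lemma carrier_at_full: "j \<le> n \<Longrightarrow> carrier_at f {0..<N} c j = c"
  by (induction j) auto

text \<open>The twist by \<open>N\<close> around one period discards the configuration in which a carrier passes every
  site, which is the one not coming from a proper subset.\<close>

lemma carrier_at_twist:
  assumes "periodic_bij f" "A \<subseteq> {0..<N}"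
  shows "carrier_at f A c n = c + N \<longleftrightarrow> proper A \<and> c = f (pred_out A 0)"
proof (cases "proper A")
  case True
  have "f (pred_out A N) = f (pred_out A 0) + N"
    using pred_out_add[OF True, of 0] periodic_bij_add[OF assms(1), of _ 1] by simp
  then show ?thesis using carrier_at_end[OF True] True by auto
next
  case False
  then have "A = {0..<N}" using assms unfolding proper_def by blast
  then show ?thesis using carrier_at_full[of n] False by simp
qed

lemma row_out_rot:
  assumes "proper A" "j < n"
  shows "row_out f A (f (pred_out A 0)) (int j) = f (rot A (int j))"
  using assms carrier_at_pred_out[OF assms(1), of j f] by (simp add: row_out_def rot_def)

lemma row_ok_valid:
  assumes "periodic_bij f" "proper A"
  shows "row_ok f A (f (pred_out A 0)) n \<longleftrightarrow> valid f A"
  unfolding valid_iff_window[OF assms] row_ok_def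
proof
  assume L: "\<forall>j<n. int j \<in> A \<longrightarrow> carrier_at f A (f (pred_out A 0)) j < f (int j)"
  show "\<forall>j\<in>A. f (pred_out A j) < f j"
  proof
    fix j assume j: "j \<in> A"
    then have "j \<in> {0..<N}" using assms(2) unfolding proper_def by blast
    then have "0 \<le> j" "nat j < n" by (simp_all add: nat_less_iff)
    then show "f (pred_out A j) < f j"
      using L[rule_format, of "nat j"] j carrier_at_pred_out[OF assms(2), of "nat j" f] by simp
  qed
next
  assume R: "\<forall>j\<in>A. f (pred_out A j) < f j"
  then show "\<forall>j<n. int j \<in> A \<longrightarrow> carrier_at f A (f (pred_out A 0)) j < f (int j)"
    using carrier_at_pred_out[OF assms(2), of _ f] by simp
qed

definition two_rows :: "(int \<Rightarrow> int) \<Rightarrow> (int \<Rightarrow> int) \<Rightarrow> (int set \<times> int set) set" where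
  "two_rows f h = {(A, B). proper A \<and> proper B \<and> valid f A \<and> valid (f \<circ> rot A) B
      \<and> f \<circ> rot A \<circ> rot B = h}"

lemma finite_two_rows [simp]: "finite (two_rows f h)"
  by (rule finite_subset[of _ "{A. proper A} \<times> {A. proper A}"]) (auto simp: two_rows_def)

text \<open>The twisted boundary condition determines both starting colours, so each pair (A, B)
  meets a single diagonal entry. The nested conditionals are the shape in which the sums over c1 and
  c2 collapse.\<close>

lemma two_row_weight_delta:
  fixes x y :: "'r::comm_ring_1"
  assumes f: "periodic_bij f" and h: "periodic_bij h"
    and A: "A \<subseteq> {0..<N}" and B: "B \<subseteq> {0..<N}"
  shows "two_row_weight x y f h n (delta (c1 + N) (c2 + N)) c1 c2 A B =
    (if c1 = f (pred_out A 0) then if c2 = f (rot A (pred_out B 0)) then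
      if (A, B) \<in> two_rows f h then x ^ card A * y ^ card B else 0 else 0 else 0)"
proof (cases "proper A \<and> c1 = f (pred_out A 0)")
  case False
  then have "carrier_at f A c1 n \<noteq> c1 + N" using carrier_at_twist[OF f A] by blast
  then show ?thesis using False by (auto simp: two_row_weight_def delta_def two_rows_def)
next
  case pA: True
  let ?g = "f \<circ> rot A" and ?o = "row_out f A c1"
  have g: "periodic_bij ?g" using f pA periodic_bij_comp periodic_bij_rot by blast
  have o: "?o (int j) = ?g (int j)" if "j < n" for j using row_out_rot pA that by simp
  have car: "carrier_at ?o B c2 n = carrier_at ?g B c2 n"
    by (rule carrier_at_cong) (use o in auto)
  have k1: "carrier_at f A c1 n = c1 + N" using carrier_at_twist[OF f A] pA by blast
  have ok1: "row_ok f A c1 n \<longleftrightarrow> valid f A" using row_ok_valid[OF f] pA by blast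
  have ok2: "row_ok ?o B c2 n \<longleftrightarrow> row_ok ?g B c2 n" by (rule row_ok_cong) (use o in auto)
  show ?thesis
  proof (cases "proper B \<and> c2 = ?g (pred_out B 0)")
    case False
    then have "carrier_at ?o B c2 n \<noteq> c2 + N" using carrier_at_twist[OF g B] car by simp
    then show ?thesis using False by (auto simp: two_row_weight_def delta_def two_rows_def)
  next
    case pB: True
    have k2: "carrier_at ?o B c2 n = c2 + N" using carrier_at_twist[OF g B] car pB by simp
    have ok2': "row_ok ?g B c2 n \<longleftrightarrow> valid ?g B" using row_ok_valid[OF g] pB by blast
    have out: "row_out ?o B c2 (int j) = (?g \<circ> rot B) (int j)" if "j < n" for j
    proof -
      have "row_out ?o B c2 (int j) = row_out ?g B c2 (int j)"
        by (rule row_out_cong) (use o that in auto)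
      then show ?thesis using row_out_rot[of B j ?g] pB that by simp
    qed
    have "(\<forall>j<n. row_out ?o B c2 (int j) = h (int j)) \<longleftrightarrow> ?g \<circ> rot B = h"
    proof
      assume L: "\<forall>j<n. row_out ?o B c2 (int j) = h (int j)"
      have pg: "periodic_bij (?g \<circ> rot B)" using g pB periodic_bij_comp periodic_bij_rot by blast
      show "?g \<circ> rot B = h"
      proof
        fix i
        have "nat (i mod N) < n" by (simp add: nat_less_iff)
        then have "(?g \<circ> rot B) (i mod N) = h (i mod N)"
          using L[rule_format, of "nat (i mod N)"] out[of "nat (i mod N)"] by simp
        then show "(?g \<circ> rot B) i = h i"
          using periodic_bij_add[OF pg, of "i mod N" "i div N"]
            periodic_bij_add[OF h, of "i mod N" "i div N"] by simp
      qed
    qed (use out in auto)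
    then show ?thesis using pA pB k1 k2 ok1 ok2 ok2'
      by (auto simp: two_row_weight_def delta_def two_rows_def)
  qed
qed

text \<open>The trace ranges over a finite X, since the colours are all integers; it suffices that X
  contains every possible starting colour.\<close>

lemma two_rows_trace:
  fixes x y :: "'r::comm_ring_1"
  assumes f: "periodic_bij f" and h: "periodic_bij h" and X: "finite X"
    and in_X: "\<And>A. A \<subseteq> {0..<N} \<Longrightarrow> f (pred_out A 0) \<in> X"
      "\<And>A B. A \<subseteq> {0..<N} \<Longrightarrow> B \<subseteq> {0..<N} \<Longrightarrow> f (rot A (pred_out B 0)) \<in> X"
  shows "(\<Sum>c1\<in>X. \<Sum>c2\<in>X. row_transfer x y f h n (delta (c1 + N) (c2 + N)) c1 c2)
    = (\<Sum>(A, B)\<in>two_rows f h. x ^ card A * y ^ card B)"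
proof -
  let ?P = "Pow {0..<N}"
  let ?W = "\<lambda>c1 c2 A B. two_row_weight x y f h n (delta (c1 + N) (c2 + N)) c1 c2 A B"
  let ?t = "\<lambda>A B. if (A, B) \<in> two_rows f h then x ^ card A * y ^ card B else 0"
  have "(\<Sum>c1\<in>X. \<Sum>c2\<in>X. \<Sum>A\<in>?P. \<Sum>B\<in>?P. ?W c1 c2 A B)
      = (\<Sum>A\<in>?P. \<Sum>B\<in>?P. \<Sum>c1\<in>X. \<Sum>c2\<in>X. ?W c1 c2 A B)"
  proof -
    have swap: "(\<Sum>c1\<in>X. \<Sum>c2\<in>X. \<Sum>B\<in>?P. F c1 c2 B) = (\<Sum>B\<in>?P. \<Sum>c1\<in>X. \<Sum>c2\<in>X. F c1 c2 B)"
      for F :: "int \<Rightarrow> int \<Rightarrow> int set \<Rightarrow> 'r"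
    proof -
      have "(\<Sum>c1\<in>X. \<Sum>c2\<in>X. \<Sum>B\<in>?P. F c1 c2 B) = (\<Sum>c1\<in>X. \<Sum>B\<in>?P. \<Sum>c2\<in>X. F c1 c2 B)"
        by (intro sum.cong refl sum.swap)
      also have "\<dots> = (\<Sum>B\<in>?P. \<Sum>c1\<in>X. \<Sum>c2\<in>X. F c1 c2 B)" by (rule sum.swap)
      finally show ?thesis .
    qed
    show ?thesis unfolding swap[of "\<lambda>c1 c2 A. \<Sum>B\<in>?P. ?W c1 c2 A B"]
      by (intro sum.cong refl swap)
  qed
  also have "\<dots> = (\<Sum>A\<in>?P. \<Sum>B\<in>?P. ?t A B)"
  proof (intro sum.cong refl)
    fix A B assume AB: "A \<in> ?P" "B \<in> ?P"
    have "(\<Sum>c1\<in>X. \<Sum>c2\<in>X. ?W c1 c2 A B)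
      = (\<Sum>c1\<in>X. \<Sum>c2\<in>X. if c1 = f (pred_out A 0) then if c2 = f (rot A (pred_out B 0))
          then ?t A B else 0 else 0)"
      using AB by (intro sum.cong refl two_row_weight_delta[OF f h]) auto
    also have "\<dots> = (\<Sum>c1\<in>X. if c1 = f (pred_out A 0) then ?t A B else 0)"
      using AB in_X(2)[of A B] X by (intro sum.cong refl) auto
    also have "\<dots> = ?t A B" using AB in_X(1)[of A] X by simp
    finally show "(\<Sum>c1\<in>X. \<Sum>c2\<in>X. ?W c1 c2 A B) = ?t A B" .
  qed
  also have "\<dots> = (\<Sum>P\<in>?P \<times> ?P. if P \<in> two_rows f h then x ^ card (fst P) * y ^ card (snd P) else 0)"
    by (simp add: sum.cartesian_product split_beta)
  also have "\<dots> = (\<Sum>P\<in>two_rows f h. x ^ card (fst P) * y ^ card (snd P))"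
    by (rule sum.mono_neutral_cong_right) (auto simp: two_rows_def proper_def)
  finally show ?thesis by (simp add: row_transfer_expand split_beta)
qed

lemma two_rows_sym:
  fixes x y :: "'r::{idom,ring_char_0}"
  assumes f: "periodic_bij f" and h: "periodic_bij h"
  shows "(\<Sum>(A, B)\<in>two_rows f h. x ^ card A * y ^ card B)
    = (\<Sum>(A, B)\<in>two_rows f h. y ^ card A * x ^ card B)"
proof -
  let ?P = "Pow {0..<N}"
  define X where "X = (\<lambda>A. f (pred_out A 0)) ` ?P
    \<union> (\<lambda>(A, B). f (rot A (pred_out B 0))) ` (?P \<times> ?P)"
  have X: "finite X" unfolding X_def by simp
  have "f (pred_out A 0) \<in> X" "f (rot A (pred_out B 0)) \<in> X"
    if "A \<subseteq> {0..<N}" "B \<subseteq> {0..<N}" for A B using that unfolding X_def by auto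
  then show ?thesis
    using two_rows_trace[OF f h X, of x y] two_rows_trace[OF f h X, of y x]
      trace_commute[of x y f h n N X] by simp
qed

lemma two_rows_ninv:
  assumes "periodic_bij f" "(A, B) \<in> two_rows f h"
  shows "ninv h = ninv f + card A + card B"
proof -
  have ab: "proper A" "proper B" "valid f A" "valid (f \<circ> rot A) B" "h = f \<circ> rot A \<circ> rot B"
    using assms by (auto simp: two_rows_def)
  have "periodic_bij (f \<circ> rot A)" using assms ab periodic_bij_comp periodic_bij_rot by blast
  then show ?thesis using ninv_rot(2) assms(1) ab by simp
qed

text \<open>Lengths fix the sum of the two sizes, so after setting y = 1 the power of x still
  records both, and one-variable polynomials suffice for comparing coefficients.\<close>

lemma two_rows_card_sym:
  assumes f: "periodic_bij f" and h: "periodic_bij h"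
  shows "card {P \<in> two_rows f h. card (fst P) = a \<and> card (snd P) = b}
    = card {P \<in> two_rows f h. card (fst P) = b \<and> card (snd P) = a}"
proof (cases "ninv h = ninv f + a + b")
  case True
  have coeff: "coeff (\<Sum>P\<in>two_rows f h. monom (1::int) 1 ^ k P) a = int (card {P \<in> two_rows f h. k P = a})"
    for k :: "int set \<times> int set \<Rightarrow> nat"
  proof -
    have "coeff (\<Sum>P\<in>two_rows f h. monom (1::int) 1 ^ k P) a = (\<Sum>P\<in>two_rows f h. if k P = a then 1 else 0)"
      by (simp add: coeff_sum monom_power)
    then show ?thesis by (simp add: sum.If_cases Int_def)
  qed
  have "(\<Sum>P\<in>two_rows f h. monom (1::int) 1 ^ card (fst P)) = (\<Sum>P\<in>two_rows f h. monom (1::int) 1 ^ card (snd P))"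
    using two_rows_sym[OF f h, of "monom (1::int) 1" 1] by (simp add: split_beta)
  then have "card {P \<in> two_rows f h. card (fst P) = a} = card {P \<in> two_rows f h. card (snd P) = a}"
    using coeff[of "\<lambda>P. card (fst P)"] coeff[of "\<lambda>P. card (snd P)"] by simp
  moreover have "card (fst P) = a \<longleftrightarrow> card (snd P) = b" "card (fst P) = b \<longleftrightarrow> card (snd P) = a"
    if "P \<in> two_rows f h" for P
    using two_rows_ninv[OF f, of "fst P" "snd P" h] that True by auto
  then have "{P \<in> two_rows f h. card (fst P) = a \<and> card (snd P) = b} = {P \<in> two_rows f h. card (fst P) = a}"
      "{P \<in> two_rows f h. card (fst P) = b \<and> card (snd P) = a} = {P \<in> two_rows f h. card (snd P) = a}"
    by auto
  ultimately show ?thesis by simp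
next
  case False
  then have "\<not> (card (fst P) = a \<and> card (snd P) = b)" "\<not> (card (fst P) = b \<and> card (snd P) = a)"
    if "P \<in> two_rows f h" for P
    using two_rows_ninv[OF f, of "fst P" "snd P" h] that by auto
  then have "{P \<in> two_rows f h. card (fst P) = a \<and> card (snd P) = b} = {}"
      "{P \<in> two_rows f h. card (fst P) = b \<and> card (snd P) = a} = {}"
    by blast+
  then show ?thesis by (simp only:)
qed

text \<open>Consecutive factors \<open>cyc A\<close>, \<open>cyc B\<close> are turned into \<open>rot\<close> factors by moving both index
  shifts to the right, which shifts \<open>B\<close>.\<close>

definition shift_set :: "int set \<Rightarrow> int set" where
  "shift_set B = (\<lambda>b. (b + 1) mod N) ` B"

lemma mod_in_shift_set:
  assumes "B \<subseteq> {0..<N}" shows "(j + 1) mod N \<in> shift_set B \<longleftrightarrow> j mod N \<in> B"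
proof
  assume "(j + 1) mod N \<in> shift_set B"
  then obtain b where "b \<in> B" "(j + 1) mod N = (b + 1) mod N" unfolding shift_set_def by blast
  then show "j mod N \<in> B" using mod_add_cancel[of j 1 b] assms by auto
next
  assume "j mod N \<in> B"
  moreover have "(j + 1) mod N = (j mod N + 1) mod N" by (simp add: mod_add_left_eq)
  ultimately show "(j + 1) mod N \<in> shift_set B" unfolding shift_set_def by blast
qed

lemma proper_subset: "proper A \<Longrightarrow> A \<subseteq> {0..<N}"
  unfolding proper_def by blast

lemma proper_shift_set:
  assumes "proper B" shows "proper (shift_set B)"
proof -
  obtain e where e: "e \<in> {0..<N}" "e \<notin> B" using assms unfolding proper_def by blast
  then have "(e + 1) mod N \<in> {0..<N} - shift_set B"
    using mod_in_shift_set[OF proper_subset[OF assms], of e] by simp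
  moreover have "shift_set B \<subseteq> {0..<N}" unfolding shift_set_def by auto
  ultimately show ?thesis unfolding proper_def by blast
qed

lemma inj_on_shift: "inj_on (\<lambda>b. (b + 1) mod N) {0..<N}"
  using mod_add_cancel by (auto intro!: inj_onI)

lemma card_shift_set: "proper B \<Longrightarrow> card (shift_set B) = card B"
  unfolding shift_set_def using proper_subset inj_on_shift by (metis card_image inj_on_subset)

lemma bij_shift_set: "bij_betw shift_set {B. proper B} {B. proper B}"
proof -
  have "inj_on shift_set {B. proper B}"
  proof (rule inj_onI)
    fix A B assume "A \<in> {B. proper B}" "B \<in> {B. proper B}" "shift_set A = shift_set B"
    then show "A = B" unfolding shift_set_def
      using inj_on_image_eq_iff[OF inj_on_shift, of A B] proper_subset by auto
  qed
  moreover have "shift_set ` {B. proper B} \<subseteq> {B. proper B}" using proper_shift_set by auto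
  ultimately show ?thesis by (simp add: bij_betw_def endo_inj_surj)
qed

lemma pred_out_shift_set:
  assumes "proper B" shows "pred_out (shift_set B) (j + 1) = pred_out B j + 1"
proof (rule pred_outI[OF proper_shift_set[OF assms]])
  note m = mod_in_shift_set[OF proper_subset[OF assms]]
  show "pred_out B j + 1 < j + 1" using pred_out_less[OF assms, of j] by linarith
  show "(pred_out B j + 1) mod N \<notin> shift_set B" using m pred_out_notin[OF assms] by blast
  fix k assume "pred_out B j + 1 < k" "k < j + 1"
  then show "k mod N \<in> shift_set B" using m[of "k - 1"] pred_out_between[OF assms, of j "k - 1"] by simp
qed

lemma rot_shift_set: "proper B \<Longrightarrow> rot (shift_set B) (j + 1) = rot B j + 1"
  using mod_in_shift_set[OF proper_subset, of B j] pred_out_shift_set[of B j] by (simp add: rot_def)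

lemma valid_shift_set:
  assumes "proper B"
  shows "valid (f \<circ> (\<lambda>j. j + 1)) B \<longleftrightarrow> valid f (shift_set B)"
proof -
  note m = mod_in_shift_set[OF proper_subset[OF assms]] and p = pred_out_shift_set[OF assms]
  have "valid f (shift_set B) \<longleftrightarrow>
      (\<forall>j. (j + 1) mod N \<in> shift_set B \<longrightarrow> f (pred_out (shift_set B) (j + 1)) < f (j + 1))"
    unfolding valid_def by (metis diff_add_cancel)
  then show ?thesis unfolding valid_def m p by simp
qed

lemma cyc_cyc:
  assumes "proper B"
  shows "f \<circ> cyc A \<circ> cyc B = f \<circ> rot A \<circ> rot (shift_set B) \<circ> (\<lambda>j. j + 2)"
proof -
  have "rot (shift_set B) (j + 2) = rot B (j + 1) + 1" for j
    using rot_shift_set[OF assms, of "j + 1"] by (simp add: add.assoc)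
  then show ?thesis by (simp add: fun_eq_iff cyc_def)
qed

text \<open>The value 0 off periodic bijections makes commutation an identity of operators on
  arbitrary functions, the form that folding over a multiset asks for.\<close>

definition add_row :: "nat \<Rightarrow> ((int \<Rightarrow> int) \<Rightarrow> int) \<Rightarrow> (int \<Rightarrow> int) \<Rightarrow> int" where
  "add_row a \<phi> f = (if periodic_bij f
     then \<Sum>A | proper A \<and> card A = a \<and> valid f A. \<phi> (f \<circ> cyc A) else 0)"

lemma finite_valid [simp]: "finite {A. proper A \<and> card A = a \<and> valid f A}"
  by (rule finite_subset[OF _ finite_proper]) auto

text \<open>Grouping the pairs of rows by their common result h isolates the counts that
  \<open>two_rows_card_sym\<close> shows to be symmetric; the remaining shift by 2 is the same for
  either order.\<close>

lemma add_row_add_row: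
  assumes "periodic_bij f"
  shows "add_row a (add_row b \<phi>) f = (\<Sum>h\<in>{h. \<exists>A B. proper A \<and> proper B \<and> h = f \<circ> rot A \<circ> rot B}.
     int (card {P \<in> two_rows f h. card (fst P) = a \<and> card (snd P) = b}) * \<phi> (h \<circ> (\<lambda>j. j + 2)))"
proof -
  let ?H = "{h. \<exists>A B. proper A \<and> proper B \<and> h = f \<circ> rot A \<circ> rot B}"
  let ?\<psi> = "\<lambda>h. \<phi> (h \<circ> (\<lambda>j. j + 2))"
  let ?VA = "{A. proper A \<and> card A = a \<and> valid f A}"
  let ?VB = "\<lambda>A. {B. proper B \<and> card B = b \<and> valid (f \<circ> rot A) B}"
  let ?h = "\<lambda>P. f \<circ> rot (fst P) \<circ> rot (snd P)"
  have "?H = ?h ` ({A. proper A} \<times> {A. proper A})"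
    by (force simp: image_iff)
  then have finH: "finite ?H" by simp
  have inner: "add_row b \<phi> (f \<circ> cyc A) = (\<Sum>B\<in>?VB A. ?\<psi> (f \<circ> rot A \<circ> rot B))"
    if A: "proper A" for A
  proof -
    have "periodic_bij (f \<circ> cyc A)" using assms A periodic_bij_comp periodic_bij_cyc by blast
    then have "add_row b \<phi> (f \<circ> cyc A)
        = (\<Sum>B | proper B \<and> card B = b \<and> valid (f \<circ> cyc A) B. \<phi> (f \<circ> cyc A \<circ> cyc B))"
      by (simp add: add_row_def)
    also have "\<dots> = (\<Sum>B\<in>?VB A. ?\<psi> (f \<circ> rot A \<circ> rot B))"
    proof (rule sum.reindex_cong[of shift_set, symmetric])
      have v: "valid (f \<circ> cyc A) B \<longleftrightarrow> valid (f \<circ> rot A) (shift_set B)" if "proper B" for B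
        using valid_shift_set[OF that, of "f \<circ> rot A"] by (simp add: cyc_comp comp_assoc)
      show "inj_on shift_set {B. proper B \<and> card B = b \<and> valid (f \<circ> cyc A) B}"
        using bij_shift_set by (auto simp: bij_betw_def intro: inj_on_subset)
      show "?VB A = shift_set ` {B. proper B \<and> card B = b \<and> valid (f \<circ> cyc A) B}"
      proof (intro equalityI subsetI)
        fix C assume C: "C \<in> ?VB A"
        then obtain B where "proper B" "C = shift_set B"
          using bij_shift_set by (auto simp: bij_betw_def)
        then show "C \<in> shift_set ` {B. proper B \<and> card B = b \<and> valid (f \<circ> cyc A) B}"
          using C v card_shift_set by auto
      qed (use v card_shift_set proper_shift_set in auto)
      show "?\<psi> (f \<circ> rot A \<circ> rot (shift_set B)) = \<phi> (f \<circ> cyc A \<circ> cyc B)"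
        if "B \<in> {B. proper B \<and> card B = b \<and> valid (f \<circ> cyc A) B}" for B
        using that cyc_cyc[of B f A] by (simp only: mem_Collect_eq)
    qed
    finally show ?thesis .
  qed
  have "add_row a (add_row b \<phi>) f = (\<Sum>A\<in>?VA. \<Sum>B\<in>?VB A. ?\<psi> (f \<circ> rot A \<circ> rot B))"
    using assms inner by (simp add: add_row_def)
  also have "\<dots> = (\<Sum>P\<in>Sigma ?VA ?VB. ?\<psi> (?h P))"
    by (simp add: sum.Sigma split_beta)
  also have "\<dots> = (\<Sum>h\<in>?H. \<Sum>P\<in>{P\<in>Sigma ?VA ?VB. ?h P = h}. ?\<psi> (?h P))"
    by (rule sum.group[symmetric], simp, rule finH, force)
  also have "\<dots> = (\<Sum>h\<in>?H. int (card {P \<in> two_rows f h. card (fst P) = a \<and> card (snd P) = b}) * ?\<psi> h)"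
  proof (rule sum.cong[OF refl])
    fix h
    have eq: "{P\<in>Sigma ?VA ?VB. ?h P = h} = {P \<in> two_rows f h. card (fst P) = a \<and> card (snd P) = b}"
      by (auto simp: two_rows_def)
    have "(\<Sum>P\<in>{P\<in>Sigma ?VA ?VB. ?h P = h}. ?\<psi> (?h P)) = (\<Sum>P\<in>{P\<in>Sigma ?VA ?VB. ?h P = h}. ?\<psi> h)"
      by (rule sum.cong) auto
    then show "(\<Sum>P\<in>{P\<in>Sigma ?VA ?VB. ?h P = h}. ?\<psi> (?h P))
        = int (card {P \<in> two_rows f h. card (fst P) = a \<and> card (snd P) = b}) * ?\<psi> h"
      unfolding eq by simp
  qed
  finally show ?thesis .
qed

lemma add_row_commute: "add_row a \<circ> add_row b = add_row b \<circ> add_row a"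
proof (intro ext)
  fix \<phi> f
  show "(add_row a \<circ> add_row b) \<phi> f = (add_row b \<circ> add_row a) \<phi> f"
  proof (cases "periodic_bij f")
    case True
    then have "periodic_bij (f \<circ> rot A \<circ> rot B)" if "proper A" "proper B" for A B
      using that periodic_bij_comp periodic_bij_rot by blast
    then show ?thesis unfolding comp_def[of "add_row _"] add_row_add_row[OF True]
      by (intro sum.cong refl) (auto simp: two_rows_card_sym[OF True, of _ a b])
  qed (simp add: add_row_def)
qed

end

section \<open>Affine Stanley functions as path counts\<close>

lemma card_bij_Collect:
  assumes "bij \<pi>" shows "card {i. P (\<pi> i)} = card {i. P i}"
proof -
  have "card (\<pi> -` {i. P i}) = card {i. P i}"
    using assms by (intro card_vimage_inj) (auto simp: bij_def)
  then show ?thesis by (simp add: vimage_def)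
qed

lemma fin_monom_bounded:
  assumes "fin_monom \<alpha>" shows "\<exists>L. \<forall>i\<ge>L. \<alpha> i = 0"
proof -
  obtain L where "\<forall>i\<in>{i. \<alpha> i \<noteq> 0}. i < L"
    using assms finite_nat_set_iff_bounded unfolding fin_monom_def by blast
  then show ?thesis by (intro exI[of _ L]) (meson linorder_not_le mem_Collect_eq)
qed

lemma bounded_support:
  fixes \<alpha> :: "nat \<Rightarrow> nat"
  assumes "\<And>i. i \<ge> L \<Longrightarrow> \<alpha> i = 0"
  shows "\<alpha> i \<noteq> 0 \<Longrightarrow> i < L" "{i. \<alpha> i \<noteq> 0} \<subseteq> {..<L}" "fin_monom \<alpha>"
proof -
  have *: "i < L" if "\<alpha> i \<noteq> 0" for i using assms[of i] that by (cases "i < L") auto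
  then show "\<alpha> i \<noteq> 0 \<Longrightarrow> i < L" .
  show sub: "{i. \<alpha> i \<noteq> 0} \<subseteq> {..<L}" using * by auto
  show "fin_monom \<alpha>" unfolding fin_monom_def by (rule finite_subset[OF sub]) simp
qed

lemma count_map_upt: "count (mset (map \<gamma> [0..<L])) k = card {i. i < L \<and> \<gamma> i = k}"
proof -
  have "count (mset (map \<gamma> [0..<L])) k = length (filter (\<lambda>i. \<gamma> i = k) [0..<L])"
    by (induction L) auto
  also have "\<dots> = card (set (filter (\<lambda>i. \<gamma> i = k) [0..<L]))"
    by (rule distinct_card[symmetric]) simp
  also have "set (filter (\<lambda>i. \<gamma> i = k) [0..<L]) = {i. i < L \<and> \<gamma> i = k}" by auto
  finally show ?thesis .
qed

text \<open>Only positive exponents are compared; the number of zeros below L is then forced,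
  because all multiplicities add up to L.\<close>

lemma mset_map_upt_eqI:
  assumes "\<And>i. i \<ge> L \<Longrightarrow> \<alpha> i = 0" "\<And>i. i \<ge> L \<Longrightarrow> \<beta> i = (0::nat)"
    and "\<And>k. k > 0 \<Longrightarrow> card {i. \<alpha> i = k} = card {i. \<beta> i = k}"
  shows "mset (map \<alpha> [0..<L]) = mset (map \<beta> [0..<L])"
proof (rule multiset_eqI)
  fix k
  show "count (mset (map \<alpha> [0..<L])) k = count (mset (map \<beta> [0..<L])) k"
  proof (cases "k = 0")
    case False
    have "{i. i < L \<and> \<gamma> i = k} = {i. \<gamma> i = k}" if "\<And>i. i \<ge> L \<Longrightarrow> \<gamma> i = 0" for \<gamma> :: "nat \<Rightarrow> nat"
      using that False by (metis (no_types, lifting) not_le_imp_less)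
    then show ?thesis using assms False unfolding count_map_upt by simp
  next
    case True
    have zero: "card {i. i < L \<and> \<gamma> i = 0} + (\<Sum>k\<in>{1..M}. card {i. \<gamma> i = k}) = L"
      if g: "\<And>i. i \<ge> L \<Longrightarrow> \<gamma> i = 0" and M: "\<And>i. i < L \<Longrightarrow> \<gamma> i \<le> M" for \<gamma> :: "nat \<Rightarrow> nat" and M
    proof -
      have fin: "finite {i. \<gamma> i = k}" if "k \<in> {1..M}" for k
        by (rule finite_subset[of _ "{..<L}"]) (use that bounded_support(1)[of L \<gamma>, OF g] in auto)
      have "(\<Sum>k\<in>{1..M}. card {i. \<gamma> i = k}) = card (\<Union>k\<in>{1..M}. {i. \<gamma> i = k})"
        by (rule card_UN_disjoint[symmetric]) (use fin in auto)
      also have "(\<Union>k\<in>{1..M}. {i. \<gamma> i = k}) = {..<L} - {i. i < L \<and> \<gamma> i = 0}"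
        using bounded_support(1)[of L \<gamma>, OF g] M by (auto simp: Suc_le_eq)
      also have "card \<dots> = L - card {i. i < L \<and> \<gamma> i = 0}"
        by (subst card_Diff_subset) auto
      finally show ?thesis
        using card_mono[of "{..<L}" "{i. i < L \<and> \<gamma> i = 0}"] by (simp add: subset_eq)
    qed
    define M where "M = Max (\<alpha> ` {..<L} \<union> \<beta> ` {..<L} \<union> {0})"
    have M: "\<alpha> i \<le> M" "\<beta> i \<le> M" if "i < L" for i
      unfolding M_def using that by (auto intro!: Max_ge)
    have "(\<Sum>k\<in>{1..M}. card {i. \<alpha> i = k}) = (\<Sum>k\<in>{1..M}. card {i. \<beta> i = k})"
      by (rule sum.cong) (use assms in auto)
    then show ?thesis using zero[of \<alpha> M] zero[of \<beta> M] assms M True unfolding count_map_upt by simp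
  qed
qed

lemma seq_prod_eq: "seq_prod v L = foldr (\<circ>) (map v [0..<L]) id"
proof -
  have "foldr (\<lambda>i f. v i \<circ> f) is id = foldr (\<circ>) (map v is) id" for "is"
    by (induction "is") auto
  then show ?thesis by (simp add: seq_prod_def)
qed

lemma foldr_comp_ids: "(\<And>u. u \<in> set us \<Longrightarrow> u = id) \<Longrightarrow> foldr (\<circ>) us id = id"
  by (induction us) auto

lemma seq_prod_extend:
  assumes "\<And>i. i \<ge> L \<Longrightarrow> v i = id" "L \<le> M"
  shows "seq_prod v M = seq_prod v L"
proof -
  have "[0..<M] = [0..<L] @ [L..<M]" using assms(2) by (metis le_add_diff_inverse upt_add_eq_append zero_le)
  moreover have "foldr (\<circ>) (map v [L..<M]) id = id"
    by (rule foldr_comp_ids) (use assms(1) in auto)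
  ultimately show ?thesis by (simp add: seq_prod_eq)
qed

section \<open>Paths of rows counting factorizations\<close>

context affine
begin

text \<open>Inverting v_1 v_2 ... reverses the product, so the head of the list, which stands for
  the leftmost factor, is the row performed last.\<close>

primrec path_end :: "int set list \<Rightarrow> int \<Rightarrow> int" where
  "path_end [] = id"
| "path_end (A # As) = path_end As \<circ> cyc A"

primrec admissible :: "int set list \<Rightarrow> bool" where
  "admissible [] \<longleftrightarrow> True"
| "admissible (A # As) \<longleftrightarrow> proper A \<and> admissible As \<and> valid (path_end As) A"

definition paths :: "nat list \<Rightarrow> (int \<Rightarrow> int) \<Rightarrow> int set list set" where
  "paths as h = {As. admissible As \<and> map card As = as \<and> path_end As = h}"

lemma affine_perm_path_end: "\<forall>A\<in>set As. proper A \<Longrightarrow> affine_perm n (path_end As)"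
proof (induction As)
  case Nil
  then show ?case using affine_perm_id by (simp only: path_end.simps)
next
  case (Cons A As)
  then show ?case unfolding path_end.simps by (intro affine_perm_comp affine_perm_cyc) auto
qed

lemma admissible_proper: "admissible As \<Longrightarrow> \<forall>A\<in>set As. proper A"
  by (induction As) auto

lemma ninv_path_end:
  assumes "\<forall>A\<in>set As. proper A"
  shows "ninv (path_end As) \<le> sum_list (map card As)
    \<and> (ninv (path_end As) = sum_list (map card As) \<longleftrightarrow> admissible As)"
  using assms
proof (induction As)
  case Nil
  then show ?case by (simp add: ninv_id[unfolded id_def] id_def)
next
  case (Cons A As)
  then have A: "proper A" and As: "\<forall>A\<in>set As. proper A" by auto
  have p: "periodic_bij (path_end As)" using affine_perm_path_end[OF As] affine_periodic by blast
  note IH = Cons.IH[OF As] and s = ninv_cyc[OF p A]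
  have "ninv (path_end (A # As)) \<le> card A + sum_list (map card As)"
    unfolding path_end.simps using IH s(1) by linarith
  moreover have "ninv (path_end (A # As)) = card A + sum_list (map card As) \<longleftrightarrow> admissible (A # As)"
    unfolding path_end.simps admissible.simps using IH s A by linarith
  ultimately show ?case by (simp only: list.map sum_list.Cons)
qed

lemma path_end_inv:
  "\<forall>A\<in>set As. proper A \<Longrightarrow> foldr (\<circ>) (map (\<lambda>A. inv (cyc A)) As) id = inv (path_end As)"
proof (induction As)
  case (Cons A As)
  then have A: "proper A" and As: "\<forall>A\<in>set As. proper A" by auto
  have p: "periodic_bij (path_end As)" using affine_perm_path_end[OF As] affine_periodic by blast
  show ?case unfolding path_end.simps inv_comp_periodic[OF p periodic_bij_cyc[OF A]]
    using Cons.IH[OF As] by (simp only: list.map foldr.simps comp_apply)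
qed (simp add: inv_id[unfolded id_def] id_def)

lemma Ftil_eq_card_paths:
  assumes w: "affine_perm n w" and L: "\<And>i. i \<ge> L \<Longrightarrow> \<alpha> i = 0"
  shows "Ftil n w \<alpha> = int (card (paths (map \<alpha> [0..<L]) (inv w)))"
proof -
  let ?V = "{v :: nat \<Rightarrow> int \<Rightarrow> int.
        (\<forall>i. cyc_dec n (v i) \<and> alen n (v i) = \<alpha> i)
        \<and> finite {i. v i \<noteq> id}
        \<and> (\<exists>N. (\<forall>i\<ge>N. v i = id) \<and> seq_prod v N = w \<and> (\<Sum>i<N. alen n (v i)) = alen n w)}"
  let ?as = "map \<alpha> [0..<L]"
  let ?\<Phi> = "\<lambda>As i. if i < L then inv (cyc (As ! i)) else id"
  have fin: "fin_monom \<alpha>" by (rule bounded_support(3)[OF L])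
  have id0: "cyc_dec n id \<and> alen n id = 0"
    using cyc_dec_iff[of id 0] by (metis card.empty cyc_empty inv_id proper_empty)
  have wi: "inv (inv w) = w" using comp_inv_periodic(3) affine_periodic[OF w] by blast
  have seq: "seq_prod (?\<Phi> As) L = inv (path_end As)" if "\<forall>A\<in>set As. proper A" "length As = L" for As
  proof -
    have "map (?\<Phi> As) [0..<L] = map (\<lambda>A. inv (cyc A)) As"
      using that(2) by (intro nth_equalityI) auto
    then show ?thesis using path_end_inv[OF that(1)] by (simp add: seq_prod_eq)
  qed
  have "bij_betw ?\<Phi> (paths ?as (inv w)) ?V"
    unfolding bij_betw_def
  proof (intro conjI)
    show "inj_on ?\<Phi> (paths ?as (inv w))"
    proof (rule inj_onI)
      fix As Bs assume As: "As \<in> paths ?as (inv w)" and Bs: "Bs \<in> paths ?as (inv w)"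
        and eq: "?\<Phi> As = ?\<Phi> Bs"
      have len: "length As = L" "length Bs = L"
        using As Bs unfolding paths_def by (auto dest: arg_cong[of _ _ length])
      have pr: "\<forall>A\<in>set As. proper A" "\<forall>A\<in>set Bs. proper A"
        using As Bs admissible_proper unfolding paths_def by auto
      show "As = Bs"
      proof (rule nth_equalityI)
        fix i assume i: "i < length As"
        then have p: "proper (As ! i)" "proper (Bs ! i)" using pr len by auto
        have "inv (cyc (As ! i)) = inv (cyc (Bs ! i))" using fun_cong[OF eq, of i] i len by simp
        then have "cyc (As ! i) = cyc (Bs ! i)"
          using comp_inv_periodic(3)[OF periodic_bij_cyc] p by metis
        then show "As ! i = Bs ! i" using cyc_inj p by blast
      qed (use len in simp)
    qed
    show "?\<Phi> ` paths ?as (inv w) = ?V"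
    proof (intro equalityI subsetI)
      fix v assume "v \<in> ?\<Phi> ` paths ?as (inv w)"
      then obtain As where As: "admissible As" "map card As = ?as" "path_end As = inv w"
        and v: "v = ?\<Phi> As" unfolding paths_def by blast
      have len: "length As = L" using arg_cong[OF As(2), of length] by simp
      note pr = admissible_proper[OF As(1)]
      have cd: "cyc_dec n (v i) \<and> alen n (v i) = \<alpha> i" for i
      proof (cases "i < L")
        case True
        then have "card (As ! i) = \<alpha> i"
          using arg_cong[OF As(2), of "\<lambda>l. l ! i"] len by simp
        then show ?thesis using cyc_dec_iff[of "v i" "\<alpha> i"] True pr len v by auto
      next
        case False
        then show ?thesis using id0 L v by simp
      qed
      moreover have "finite {i. v i \<noteq> id}"
        by (rule finite_subset[of _ "{..<L}"]) (auto simp: v)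
      moreover have "\<forall>i\<ge>L. v i = id" using v by simp
      moreover have "seq_prod v L = w" using seq[OF pr len] As wi v by simp
      moreover have "(\<Sum>i<L. alen n (v i)) = alen n w"
      proof -
        have "(\<Sum>i<L. alen n (v i)) = sum_list ?as"
          using cd by (simp add: interv_sum_list_conv_sum_set_nat atLeast0LessThan)
        then show ?thesis using ninv_path_end[OF pr] As alen_eq[OF w] by simp
      qed
      ultimately show "v \<in> ?V" by blast
    next
      fix v assume v: "v \<in> ?V"
      then obtain M where M: "\<forall>i\<ge>M. v i = id" "seq_prod v M = w" "(\<Sum>i<M. alen n (v i)) = alen n w"
        and cd: "\<And>i. cyc_dec n (v i) \<and> alen n (v i) = \<alpha> i" by blast
      have "\<forall>i. \<exists>A. proper A \<and> card A = \<alpha> i \<and> v i = inv (cyc A)"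
        using cd cyc_dec_iff by blast
      then obtain A where A: "\<And>i. proper (A i)" "\<And>i. card (A i) = \<alpha> i" "\<And>i. v i = inv (cyc (A i))"
        by metis
      have vL: "v i = id" if "i \<ge> L" for i
      proof -
        have "A i = {}" using A(1,2)[of i] L[OF that] proper_finite by simp
        then show ?thesis using A(3)[of i] cyc_empty inv_id by metis
      qed
      define As where "As = map A [0..<L]"
      have pr: "\<forall>A\<in>set As. proper A" and len: "length As = L" and cs: "map card As = ?as"
        using A unfolding As_def by auto
      have v\<Phi>: "v = ?\<Phi> As" using A(3) vL unfolding As_def by (intro ext) auto
      have "seq_prod v L = seq_prod v M"
        using seq_prod_extend[of L v "max L M"] seq_prod_extend[of M v "max L M"] vL M by simp
      then have "inv (path_end As) = w" using seq[OF pr len] v\<Phi> M by simp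
      then have pe: "path_end As = inv w"
        using comp_inv_periodic(3)[OF affine_periodic[OF affine_perm_path_end[OF pr]]] by simp
      \<comment> \<open>The bound M of the sequence and the bound L of the exponents are unrelated.
        Beyond either of them all lengths vanish, so both sums agree with the one up to the
        maximum.\<close>
      have "\<alpha> i = 0" if "i \<ge> M" for i using cd[of i] M(1) that id0 by simp
      then have "(\<Sum>i<M. \<alpha> i) = (\<Sum>i<max L M. \<alpha> i)" by (intro sum.mono_neutral_left) auto
      moreover have "(\<Sum>i<L. \<alpha> i) = (\<Sum>i<max L M. \<alpha> i)"
        using L by (intro sum.mono_neutral_left) auto
      ultimately have "(\<Sum>i<L. \<alpha> i) = alen n w" using M(3) cd by simp
      then have "sum_list (map card As) = ninv (path_end As)"
        unfolding cs pe alen_eq[OF w, symmetric]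
        by (simp add: interv_sum_list_conv_sum_set_nat atLeast0LessThan)
      then have "admissible As" using ninv_path_end[OF pr] by simp
      then show "v \<in> ?\<Phi> ` paths ?as (inv w)" using v\<Phi> cs pe unfolding paths_def by blast
    qed
  qed
  then have "card (paths ?as (inv w)) = card ?V" by (rule bij_betw_same_card)
  then show ?thesis using fin by (simp add: Ftil_def)
qed

lemma finite_admissible: "finite {As. admissible As \<and> map card As = as}"
proof (rule finite_subset)
  show "{As. admissible As \<and> map card As = as} \<subseteq> {As. set As \<subseteq> {A. proper A} \<and> length As = length as}"
    using admissible_proper by (auto dest: arg_cong[of _ _ length])
qed (simp add: finite_lists_length_eq)

text \<open>The head of a path is its last row, so the operator of the first size acts on \<phi>
  first, which is the order of \<open>fold\<close>.\<close>

lemma sum_admissible: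
  "(\<Sum>As | admissible As \<and> map card As = as. \<phi> (path_end As)) = fold add_row as \<phi> id"
proof (induction as arbitrary: \<phi>)
  case Nil
  have "{As. admissible As \<and> map card As = []} = {[]}" by auto
  then show ?case by (simp add: id_def)
next
  case (Cons a as)
  let ?S = "{As. admissible As \<and> map card As = as}"
  let ?V = "\<lambda>As. {A. proper A \<and> card A = a \<and> valid (path_end As) A}"
  have "(\<Sum>As | admissible As \<and> map card As = a # as. \<phi> (path_end As))
      = (\<Sum>(As, A)\<in>Sigma ?S ?V. \<phi> (path_end As \<circ> cyc A))"
  proof (rule sum.reindex_cong[of "\<lambda>(As, A). A # As"])
    show "inj_on (\<lambda>(As, A). A # As) (Sigma ?S ?V)" by (auto simp: inj_on_def)
    show "{As. admissible As \<and> map card As = a # as} = (\<lambda>(As, A). A # As) ` Sigma ?S ?V"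
      by (auto simp: image_iff map_eq_Cons_conv)
  qed auto
  also have "\<dots> = (\<Sum>As\<in>?S. \<Sum>A\<in>?V As. \<phi> (path_end As \<circ> cyc A))"
    by (simp add: sum.Sigma finite_admissible)
  also have "\<dots> = (\<Sum>As\<in>?S. add_row a \<phi> (path_end As))"
  proof (rule sum.cong[OF refl])
    fix As assume "As \<in> ?S"
    then have "periodic_bij (path_end As)"
      using affine_perm_path_end[OF admissible_proper] affine_periodic by blast
    then show "(\<Sum>A\<in>?V As. \<phi> (path_end As \<circ> cyc A)) = add_row a \<phi> (path_end As)"
      by (simp add: add_row_def)
  qed
  also have "\<dots> = fold add_row (a # as) \<phi> id" unfolding Cons.IH by simp
  finally show ?case .
qed

lemma card_paths: "int (card (paths as h)) = fold add_row as (\<lambda>f. if f = h then 1 else 0) id"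
proof -
  have "paths as h = {As. admissible As \<and> map card As = as} \<inter> {As. path_end As = h}"
    by (auto simp: paths_def)
  then show ?thesis unfolding sum_admissible[symmetric]
    using finite_admissible[of as] by (simp add: sum.If_cases)
qed

text \<open>Here commutation of the row operators becomes symmetry: a fold of commuting operators
  sees only the multiset of sizes.\<close>

lemma card_paths_mset:
  assumes "mset as = mset bs" shows "card (paths as h) = card (paths bs h)"
proof -
  have "fold add_row as = fold add_row bs"
    by (rule fold_multiset_equiv[OF add_row_commute assms])
  then show ?thesis using card_paths[of as h] card_paths[of bs h] by simp
qed

lemma Ftil_Sym:
  assumes w: "affine_perm n w" shows "Ftil n w \<in> Sym"
  unfolding Sym_def
proof (intro CollectI conjI allI impI)
  show "Ftil n w \<alpha> = 0" if "\<not> fin_monom \<alpha>" for \<alpha> using that by (simp add: Ftil_def)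
  show "\<exists>d. \<forall>\<alpha>. Ftil n w \<alpha> \<noteq> 0 \<longrightarrow> mdeg \<alpha> \<le> d"
  proof (intro exI allI impI)
    fix \<alpha> assume nz: "Ftil n w \<alpha> \<noteq> 0"
    then have "fin_monom \<alpha>" by (auto simp: Ftil_def split: if_splits)
    then obtain L where L: "\<And>i. i \<ge> L \<Longrightarrow> \<alpha> i = 0" using fin_monom_bounded by blast
    then have "paths (map \<alpha> [0..<L]) (inv w) \<noteq> {}" using Ftil_eq_card_paths[OF w, of L \<alpha>] nz by force
    then obtain As where As: "admissible As" "map card As = map \<alpha> [0..<L]" "path_end As = inv w"
      unfolding paths_def by blast
    have "mdeg \<alpha> = (\<Sum>i<L. \<alpha> i)" unfolding mdeg_def
      using bounded_support(2)[of L \<alpha>, OF L] by (intro sum.mono_neutral_left) auto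
    also have "\<dots> = ninv (inv w)"
      using ninv_path_end[OF admissible_proper[OF As(1)]] As
      by (simp add: interv_sum_list_conv_sum_set_nat atLeast0LessThan)
    finally show "mdeg \<alpha> \<le> ninv (inv w)" by simp
  qed
  show "Ftil n w (\<alpha> \<circ> \<pi>) = Ftil n w \<alpha>" if \<pi>: "bij \<pi>" for \<alpha> \<pi>
  proof (cases "fin_monom \<alpha>")
    case True
    then have "fin_monom (\<alpha> \<circ> \<pi>)"
      unfolding fin_monom_def using finite_vimageI[of "{i. \<alpha> i \<noteq> 0}" \<pi>] \<pi>
      by (simp add: vimage_def bij_def)
    then obtain L1 L2 where "\<forall>i\<ge>L1. \<alpha> i = 0" "\<forall>i\<ge>L2. (\<alpha> \<circ> \<pi>) i = 0"
      using True fin_monom_bounded by metis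
    then have L: "\<And>i. i \<ge> max L1 L2 \<Longrightarrow> \<alpha> i = 0" "\<And>i. i \<ge> max L1 L2 \<Longrightarrow> (\<alpha> \<circ> \<pi>) i = 0" by auto
    have m: "mset (map (\<alpha> \<circ> \<pi>) [0..<max L1 L2]) = mset (map \<alpha> [0..<max L1 L2])"
      by (rule mset_map_upt_eqI) (use L card_bij_Collect[OF \<pi>] in auto)
    have "Ftil n w (\<alpha> \<circ> \<pi>) = int (card (paths (map (\<alpha> \<circ> \<pi>) [0..<max L1 L2]) (inv w)))"
      by (rule Ftil_eq_card_paths[OF w L(2)])
    also have "\<dots> = int (card (paths (map \<alpha> [0..<max L1 L2]) (inv w)))"
      by (simp only: card_paths_mset[OF m])
    also have "\<dots> = Ftil n w \<alpha>" by (rule Ftil_eq_card_paths[OF w L(1), symmetric])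
    finally show ?thesis .
  next
    case False
    have "\<not> fin_monom (\<alpha> \<circ> \<pi>)"
    proof
      assume "fin_monom (\<alpha> \<circ> \<pi>)"
      then have "finite (\<pi> ` {i. \<alpha> (\<pi> i) \<noteq> 0})" unfolding fin_monom_def by simp
      moreover have "\<pi> ` {i. \<alpha> (\<pi> i) \<noteq> 0} = {i. \<alpha> i \<noteq> 0}"
        using \<pi> by (auto simp: bij_def surj_def image_iff)
      ultimately show False using False unfolding fin_monom_def by simp
    qed
    then show ?thesis using False by (simp add: Ftil_def)
  qed
qed

section \<open>Codes of affine Grassmannian permutations\<close>

text \<open>The number of cells in the first k columns of the diagram whose rows are the code
  entries, so the sum of the first k parts of the conjugate; \<open>code_count k\<close> is the k-th
  part itself.\<close>

definition capped_code :: "nat \<Rightarrow> (int \<Rightarrow> int) \<Rightarrow> nat" where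
  "capped_code k h = (\<Sum>j\<in>{0..<N}. min (code_entry h j) k)"

definition code_count :: "nat \<Rightarrow> (int \<Rightarrow> int) \<Rightarrow> nat" where
  "code_count k h = card {j \<in> {0..<N}. k \<le> code_entry h j}"

lemma sum_code_cyc:
  fixes \<phi> :: "nat \<Rightarrow> nat"
  assumes "periodic_bij f" "proper A"
  shows "(\<Sum>j\<in>{0..<N}. \<phi> (code_entry (f \<circ> cyc A) j)) = (\<Sum>j\<in>{0..<N}. \<phi> (code_entry (f \<circ> rot A) j))"
proof -
  have p: "periodic_bij (f \<circ> rot A)" using assms periodic_bij_comp periodic_bij_rot by blast
  have "code_entry (f \<circ> cyc A) j = code_entry (f \<circ> rot A) (j + 1)" for j
    using code_entry_shift[of "f \<circ> rot A" j] by (simp only: cyc_comp comp_assoc)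
  then show ?thesis
    using sum_shift_invariant(1)[of "\<lambda>j. \<phi> (code_entry (f \<circ> rot A) j)"] code_entry_add[OF p] by simp
qed

text \<open>Entries on A rise by one together with the cap, while the others are only relocated
  under a larger cap. If the latter vanish, nothing else changes, which gives equality in the
  construction of \<open>lam_surj\<close>.\<close>

lemma capped_code_cyc:
  assumes f: "periodic_bij f" and A: "proper A" and v: "valid f A"
  shows "capped_code k f + card A \<le> capped_code (Suc k) (f \<circ> cyc A)"
    and "(\<And>j. j mod N \<notin> A \<Longrightarrow> code_entry f j = 0) \<Longrightarrow>
      capped_code (Suc k) (f \<circ> cyc A) = capped_code k f + card A"
proof -
  let ?c = "code_entry f"
  have eq: "capped_code (Suc k) (f \<circ> cyc A) = (\<Sum>j\<in>{0..<N}. min (code_entry (f \<circ> rot A) j) (Suc k))"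
    unfolding capped_code_def by (rule sum_code_cyc[OF f A])
  have "(\<Sum>j\<in>A. min (code_entry (f \<circ> rot A) j) (Suc k)) = (\<Sum>j\<in>A. min (?c j) k + 1)"
  proof (rule sum.cong[OF refl])
    fix j assume "j \<in> A"
    then have jA: "j mod N \<in> A" using proper_mod[OF A] by simp
    then have "code_entry (f \<circ> rot A) j = ?c j + 1"
      using code_entry_rot_in[OF f A jA] v unfolding valid_def by simp
    then show "min (code_entry (f \<circ> rot A) j) (Suc k) = min (?c j) k + 1" by simp
  qed
  then have inA: "(\<Sum>j\<in>A. min (code_entry (f \<circ> rot A) j) (Suc k)) = (\<Sum>j\<in>A. min (?c j) k) + card A"
    by (simp add: sum_Suc)
  have out: "(\<Sum>j\<in>{0..<N} - A. min (code_entry (f \<circ> rot A) j) (Suc k))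
      = (\<Sum>j\<in>{0..<N} - A. min (?c j) (Suc k))"
  proof -
    have "(\<Sum>j\<in>{0..<N} - A. min (code_entry (f \<circ> rot A) j) (Suc k))
        = (\<Sum>j\<in>{0..<N} - A. min (?c (pred_out A j)) (Suc k))"
      by (rule sum.cong) (auto simp: code_entry_rot_notin(2)[OF f A _ v])
    then show ?thesis
      using sum_pred_out_nat[OF A, of "\<lambda>j. min (?c j) (Suc k)"] code_entry_add[OF f] by simp
  qed
  have split: "capped_code k f = (\<Sum>j\<in>A. min (?c j) k) + (\<Sum>j\<in>{0..<N} - A. min (?c j) k)"
    unfolding capped_code_def by (rule sum_split_proper[OF A])
  have "(\<Sum>j\<in>{0..<N} - A. min (?c j) k) \<le> (\<Sum>j\<in>{0..<N} - A. min (?c j) (Suc k))"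
    by (rule sum_mono) auto
  then show "capped_code k f + card A \<le> capped_code (Suc k) (f \<circ> cyc A)"
    unfolding eq sum_split_proper[OF A] inA out split by simp
  assume z: "\<And>j. j mod N \<notin> A \<Longrightarrow> ?c j = 0"
  have "(\<Sum>j\<in>{0..<N} - A. min (?c j) m) = 0" for m using z by simp
  then show "capped_code (Suc k) (f \<circ> cyc A) = capped_code k f + card A"
    unfolding eq sum_split_proper[OF A] inA out split by simp
qed

text \<open>Undoing the last row lowers the cap by one and the capped sum by at least the size of
  that row. Read over all k, this is the dominance bound on exponents.\<close>

lemma sum_take_admissible:
  "admissible As \<Longrightarrow> sum_list (take k (map card As)) \<le> capped_code k (path_end As)"
proof (induction As arbitrary: k)
  case (Cons A As)
  then have A: "proper A" "valid (path_end As) A" and As: "admissible As" by auto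
  have p: "periodic_bij (path_end As)"
    using affine_perm_path_end[OF admissible_proper[OF As]] affine_periodic by blast
  show ?case
  proof (cases k)
    case (Suc m)
    have "capped_code m (path_end As) + card A \<le> capped_code (Suc m) (path_end As \<circ> cyc A)"
      by (rule capped_code_cyc(1)[OF p A])
    then show ?thesis unfolding Suc path_end.simps list.map take_Suc_Cons sum_list.Cons
      using Cons.IH[OF As, of m] by linarith
  qed simp
qed simp

text \<open>The definition of \<open>lam\<close> reads the code on 1..n, whereas residues live in
  0..n-1; periodicity makes the two windows interchangeable.\<close>

lemma code_count_window:
  assumes "periodic_bij h"
  shows "card {j \<in> {1..N}. k \<le> code_entry h j} = code_count k h"
proof -
  have "(\<Sum>j\<in>{1..N}. if k \<le> code_entry h j then 1 else 0) = (\<Sum>j\<in>{0..<N}. if k \<le> code_entry h j then 1 else (0::nat))"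
    by (rule sum_shift_invariant(2)) (simp add: code_entry_add[OF assms])
  then show ?thesis unfolding code_count_def by (simp add: sum.If_cases Int_def)
qed

definition max_code :: "(int \<Rightarrow> int) \<Rightarrow> nat" where
  "max_code h = Max (insert 0 (code_entry h ` {1..N}))"

lemma max_code_iff:
  assumes "periodic_bij h" "k > 0"
  shows "k \<le> max_code h \<longleftrightarrow> code_count k h > 0"
proof -
  have "k \<le> max_code h \<longleftrightarrow> {j \<in> {1..N}. k \<le> code_entry h j} \<noteq> {}"
    unfolding max_code_def using assms(2) by (subst Max_ge_iff) auto
  also have "\<dots> \<longleftrightarrow> card {j \<in> {1..N}. k \<le> code_entry h j} > 0" 
    by (subst card_gt_0_iff) (use finite_subset[of "{j \<in> {1..N}. k \<le> code_entry h j}" "{1..N}"] in blast)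
  finally show ?thesis using code_count_window[OF assms(1)] by simp
qed

lemma lam_eq:
  assumes "periodic_bij w"
  shows "lam n w = map (\<lambda>k. code_count k (inv w)) [1..<Suc (max_code (inv w))]"
proof -
  define h where "h = inv w"
  have h: "periodic_bij h" unfolding h_def by (rule periodic_bij_inv[OF assms])
  let ?xs = "map (\<lambda>i. code_entry h (int i)) [1..<Suc n]"
  let ?\<mu> = "rev (sort ?xs)"
  have im: "int ` {1..n} = {1..N}" by (simp add: image_int_atLeastAtMost)
  then have "set ?xs = code_entry h ` {1..N}"
    by (simp add: image_image[symmetric] atLeastLessThanSuc_atLeastAtMost del: upt_Suc)
  then have "fold max ?\<mu> 0 = max_code h"
    unfolding max_code_def Max.set_eq_fold[symmetric] by (simp del: upt_Suc)
  moreover have "length (filter (\<lambda>x. k \<le> x) ?\<mu>) = code_count k h" for k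
  proof -
    have "length (filter (\<lambda>x. k \<le> x) ?\<mu>) = length (filter (\<lambda>x. k \<le> x) ?xs)"
      by (metis mset_filter mset_rev mset_sort size_mset)
    also have "\<dots> = length (filter (\<lambda>i. k \<le> code_entry h (int i)) [1..<Suc n])"
      by (simp add: filter_map comp_def del: upt_Suc)
    also have "\<dots> = card {i \<in> {1..n}. k \<le> code_entry h (int i)}"
      by (subst distinct_card[symmetric]) (auto intro!: arg_cong[of _ _ card])
    also have "\<dots> = card (int ` {i \<in> {1..n}. k \<le> code_entry h (int i)})"
      by (simp add: card_image)
    also have "int ` {i \<in> {1..n}. k \<le> code_entry h (int i)} = {j \<in> {1..N}. k \<le> code_entry h j}"
      unfolding im[symmetric] by auto
    finally show ?thesis using code_count_window[OF h] by simp
  qed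
  ultimately show ?thesis unfolding lam_def conj_part_def h_def[symmetric] by simp
qed

lemma code_entry_id: "code_entry id j = 0"
proof -
  have "{k. k > j \<and> id k < id j} = {}" by auto
  then show ?thesis unfolding code_entry_def by (simp only: card.empty)
qed

lemma lam_id: "lam n id = []"
proof -
  have "code_count k id = 0" if "k > 0" for k
    using that by (simp add: code_count_def code_entry_id)
  then have "\<not> 1 \<le> max_code id" using max_code_iff[of id 1] by simp
  then show ?thesis using lam_eq[OF periodic_bij_id] by (simp add: inv_id[unfolded id_def] id_def)
qed

section \<open>Affine Grassmannian windows: adding and removing a part\<close>

lemma aff_grass_less:
  assumes "aff_grass n w" "1 \<le> k" "k < l" "l \<le> N"
  shows "w k < w l"
proof -
  have "w k < w (k + 1 + int m)" if "k + 1 + int m \<le> N" for m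
    using that
  proof (induction m)
    case 0
    then show ?case using assms unfolding aff_grass_def by simp
  next
    case (Suc m)
    then have i: "k + 1 + int m \<in> {1..<N}" using assms by simp
    have "w (k + 1 + int m) < w (k + 1 + int m + 1)"
      using assms(1) i unfolding aff_grass_def by blast
    moreover have "k + 1 + int (Suc m) = k + 1 + int m + 1" by simp
    moreover have "w k < w (k + 1 + int m)" using Suc by simp
    ultimately show ?case by (metis less_trans)
  qed
  from this[of "nat (l - k - 1)"] show ?thesis using assms by simp
qed

lemma aff_grass_le: "aff_grass n w \<Longrightarrow> 1 \<le> k \<Longrightarrow> k \<le> l \<Longrightarrow> l \<le> N \<Longrightarrow> w k \<le> w l"
  using aff_grass_less[of w k l] by (cases "k = l") auto

definition initial_residues :: "nat \<Rightarrow> (int \<Rightarrow> int) \<Rightarrow> int set" where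
  "initial_residues r u = (\<lambda>k. u k mod N) ` {1..int r}"

text \<open>The number (i - 1) mod n is the zero-based index of i in its window, so the positions
  after the first r of each window carry left-to-right maxima. Equivalently, the code of
  \<open>inv u\<close> vanishes at their values.\<close>

definition dominated :: "nat \<Rightarrow> (int \<Rightarrow> int) \<Rightarrow> bool" where
  "dominated r u \<longleftrightarrow> (\<forall>l i. l < i \<longrightarrow> int r \<le> (i - 1) mod N \<longrightarrow> u l < u i)"

lemma window_decomp:
  obtains i0 a where "i = i0 + a * N" "1 \<le> i0" "i0 \<le> N" "(i - 1) mod N = i0 - 1"
proof
  show "i = ((i - 1) mod N + 1) + ((i - 1) div N) * N"
    using mod_mult_div_eq[of "i - 1" N] by (simp add: algebra_simps)
  have "0 \<le> (i - 1) mod N" "(i - 1) mod N < N" by simp_all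
  then show "1 \<le> (i - 1) mod N + 1" "(i - 1) mod N + 1 \<le> N" by linarith+
qed simp

lemma mod_eq_periodic:
  assumes "periodic_bij u" shows "u i mod N = u j mod N \<longleftrightarrow> i mod N = j mod N"
proof
  assume "u i mod N = u j mod N"
  then obtain m where "u i = u j + m * N" by (metis mod_eqE mult.commute)
  then have "u i = u (j + m * N)" using periodic_bij_add[OF assms] by simp
  then have "i = j + m * N" using periodic_bij_inj[OF assms] by blast
  then show "i mod N = j mod N" by simp
next
  assume "i mod N = j mod N"
  then obtain m where "i = j + m * N" by (metis mod_eqE mult.commute)
  then show "u i mod N = u j mod N" using periodic_bij_add[OF assms] by simp
qed

lemma in_initial_residues:
  assumes u: "periodic_bij u" and r: "r \<le> n"
  shows "u i mod N \<in> initial_residues r u \<longleftrightarrow> (i - 1) mod N < int r"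
proof
  assume "u i mod N \<in> initial_residues r u"
  then obtain k where k: "1 \<le> k" "k \<le> int r" "u i mod N = u k mod N"
    unfolding initial_residues_def by auto
  then have "i mod N = k mod N" using mod_eq_periodic[OF u] by blast
  then have "(i - 1) mod N = (k - 1) mod N" using mod_add_cancel[of i "-1" k] by simp
  also have "\<dots> = k - 1" using k r by simp
  finally show "(i - 1) mod N < int r" using k by simp
next
  assume L: "(i - 1) mod N < int r"
  obtain i0 a where i: "i = i0 + a * N" "1 \<le> i0" "i0 \<le> N" "(i - 1) mod N = i0 - 1"
    by (rule window_decomp)
  then have "u i mod N = u i0 mod N" using periodic_bij_add[OF u] by simp
  then show "u i mod N \<in> initial_residues r u" using L i unfolding initial_residues_def by auto
qed

lemma initial_residues_props:
  assumes u: "periodic_bij u" and r: "r < n"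
  shows proper_initial_residues: "proper (initial_residues r u)"
    and card_initial_residues: "card (initial_residues r u) = r"
proof -
  have "u 0 mod N \<notin> initial_residues r u"
  proof -
    have "(0 - 1) mod N = N - 1" using n_gt_2 by (simp add: zmod_minus1)
    then show ?thesis using in_initial_residues[OF u, of r 0] r by simp
  qed
  moreover have "initial_residues r u \<subseteq> {0..<N}" unfolding initial_residues_def by auto
  moreover have "u 0 mod N \<in> {0..<N}" by simp
  ultimately show "proper (initial_residues r u)" unfolding proper_def by blast
  have "inj_on (\<lambda>k. u k mod N) {1..int r}"
    using mod_eq_periodic[OF u] r by (auto intro!: inj_onI)
  then show "card (initial_residues r u) = r" unfolding initial_residues_def by (simp add: card_image)
qed

text \<open>Values increase inside a window and gain n from one window to the next. The one
  comparison left is between the largest value of the preceding window, u 0 = u n - n, and the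
  smallest value that has to dominate.\<close>

lemma dominatedI:
  assumes u: "aff_grass n u" and r: "r < n" and le: "u N - N \<le> u (int r + 1)"
  shows "dominated r u"
  unfolding dominated_def
proof (intro allI impI)
  fix l i assume li: "l < i" "int r \<le> (i - 1) mod N"
  have pu: "periodic_bij u" using u affine_periodic unfolding aff_grass_def by blast
  obtain i0 a where i: "i = i0 + a * N" "1 \<le> i0" "i0 \<le> N" "(i - 1) mod N = i0 - 1"
    by (rule window_decomp)
  obtain l0 b where l: "l = l0 + b * N" "1 \<le> l0" "l0 \<le> N" "(l - 1) mod N = l0 - 1"
    by (rule window_decomp)
  have ui: "u i = u i0 + a * N" and ul: "u l = u l0 + b * N"
    using i l periodic_bij_add[OF pu] by auto
  consider "a = b" | "a < b" | "b < a" by linarith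
  then show "u l < u i"
  proof cases
    case 1
    then show ?thesis using aff_grass_less[OF u, of l0 i0] i l li ui ul by simp
  next
    case 2
    then have "(a + 1) * N \<le> b * N" by (intro mult_right_mono) auto
    then show ?thesis using i l li by (simp add: algebra_simps)
  next
    case 3
    then have ab: "(b + 1) * N \<le> a * N" by (intro mult_right_mono) auto
    have "u l0 \<le> u N" using aff_grass_le[OF u] l by simp
    moreover have "u (int r + 1) \<le> u i0" using aff_grass_le[OF u, of "int r + 1" i0] i li by simp
    moreover have "u l \<noteq> u i" using periodic_bij_inj[OF pu] li by simp
    ultimately show ?thesis using ui ul ab le by (simp add: algebra_simps)
  qed
qed

lemma dominated_code_zero:
  assumes u: "periodic_bij u" and r: "r < n" and d: "dominated r u"
    and j: "j mod N \<notin> initial_residues r u"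
  shows "code_entry (inv u) j = 0"
proof -
  let ?i = "inv u j"
  have i: "u ?i = j" using comp_inv_periodic(4)[OF u] .
  then have ri: "int r \<le> (?i - 1) mod N" using in_initial_residues[OF u, of r ?i] j r by simp
  have "{k. k > j \<and> inv u k < ?i} = {}"
  proof -
    have "\<not> (k > j \<and> inv u k < ?i)" for k
    proof
      assume k: "k > j \<and> inv u k < ?i"
      then have "u (inv u k) < u ?i" using d ri unfolding dominated_def by blast
      then show False using k i comp_inv_periodic(4)[OF u, of k] by simp
    qed
    then show ?thesis by blast
  qed
  then show ?thesis unfolding code_entry_def by (simp only: card.empty)
qed

lemma dominated_valid:
  assumes u: "periodic_bij u" and r: "r < n" and d: "dominated r u"
  shows "valid (inv u) (initial_residues r u)"
  unfolding valid_def
proof (intro allI impI)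
  let ?A = "initial_residues r u"
  note A = proper_initial_residues[OF u r]
  fix j assume j: "j mod N \<in> ?A"
  let ?p = "pred_out ?A j"
  have up: "u (inv u ?p) = ?p" "u (inv u j) = j" using comp_inv_periodic(4)[OF u] by auto
  then have rp: "int r \<le> (inv u ?p - 1) mod N"
    using in_initial_residues[OF u, of r "inv u ?p"] pred_out_notin[OF A, of j] r by simp
  show "inv u ?p < inv u j"
  proof (rule ccontr)
    assume "\<not> ?thesis"
    moreover have "inv u ?p \<noteq> inv u j" using up pred_out_less[OF A, of j] by (metis less_irrefl)
    ultimately have "u (inv u j) < u (inv u ?p)" using d rp unfolding dominated_def by simp
    then show False using up pred_out_less[OF A, of j] by simp
  qed
qed

text \<open>Prepends the part \<open>r\<close> to the partition of \<open>u\<close>: if the positions \<open>u (r + 1), \<dots>, u n\<close> have code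
  \<open>0\<close>, all other code entries increase by one and these stay \<open>0\<close>.\<close>

definition grow :: "nat \<Rightarrow> (int \<Rightarrow> int) \<Rightarrow> int \<Rightarrow> int" where
  "grow r u = inv (cyc (initial_residues r u)) \<circ> u"

lemma inv_grow:
  assumes "periodic_bij u" "r < n"
  shows "inv (grow r u) = inv u \<circ> cyc (initial_residues r u)"
proof -
  note c = periodic_bij_cyc[OF proper_initial_residues[OF assms]]
  show ?thesis unfolding grow_def
    using inv_comp_periodic[OF periodic_bij_inv[OF c] assms(1)] comp_inv_periodic(3)[OF c] by simp
qed

lemma grow_eqI:
  assumes "periodic_bij u" "r < n" "rot (initial_residues r u) (x + 1) = u k"
  shows "grow r u k = x"
proof -
  have "cyc (initial_residues r u) x = u k" using assms by (simp add: cyc_def)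
  then show ?thesis unfolding grow_def
    using comp_inv_periodic(5)[OF periodic_bij_cyc[OF proper_initial_residues[OF assms(1,2)]], of x] by simp
qed

text \<open>The new window is u 1 - 1, ..., u r - 1, u (r+2) - 1, ..., u n - 1, u (r+1) + n - 1:
  apart from the index shift the first r values stay, and each of the others is replaced by its
  successor in cyclic order. Dominance makes this list increasing.\<close>

lemma aff_grass_grow:
  assumes u: "aff_grass n u" and r: "r < n" and d: "dominated r u"
  shows "aff_grass n (grow r u)"
proof -
  let ?A = "initial_residues r u" and ?w = "grow r u"
  have au: "affine_perm n u" using u unfolding aff_grass_def by blast
  note pu = affine_periodic[OF au]
  note A = proper_initial_residues[OF pu r]
  have small: "?w k = u k - 1" if k: "1 \<le> k" "k \<le> int r" for k
  proof (rule grow_eqI[OF pu r])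
    have "(k - 1) mod N = k - 1" using k r by simp
    then have "u k mod N \<in> ?A" using in_initial_residues[OF pu, of r k] k r by simp
    then show "rot ?A (u k - 1 + 1) = u k" by (simp add: rot_def)
  qed
  \<comment> \<open>Dominated positions carry increasing values, so between the values of two
    neighbouring ones lie only values from the first r slots of windows, that is, residues in
    \<open>?A\<close>. Hence \<open>rot\<close> links the two.\<close>
  have step: "?w k = u k' - 1" if k: "k < k'" "int r \<le> (k - 1) mod N" "int r \<le> (k' - 1) mod N"
      "\<And>l. k < l \<Longrightarrow> l < k' \<Longrightarrow> (l - 1) mod N < int r" for k k'
  proof (rule grow_eqI[OF pu r])
    have notin: "u k mod N \<notin> ?A" "u k' mod N \<notin> ?A"
      using in_initial_residues[OF pu, of r] k r by (auto simp: not_less)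
    have "pred_out ?A (u k') = u k"
    proof (rule pred_outI[OF A _ notin(1)])
      show "u k < u k'" using d k unfolding dominated_def by blast
      fix j assume j: "u k < j" "j < u k'"
      define l where "l = inv u j"
      have l: "u l = j" unfolding l_def using comp_inv_periodic(4)[OF pu] .
      show "j mod N \<in> ?A"
      proof (rule ccontr)
        assume "j mod N \<notin> ?A"
        then have rl: "int r \<le> (l - 1) mod N" using in_initial_residues[OF pu, of r l] l r by simp
        have "\<not> l < k" using d k(2) j l unfolding dominated_def by (metis less_asym)
        moreover have "l \<noteq> k" using j l by auto
        moreover have "\<not> k' < l" using d rl j l unfolding dominated_def by (metis less_asym)
        moreover have "l \<noteq> k'" using j l by auto
        ultimately show False using k(4)[of l] rl by simp
      qed
    qed
    then show "rot ?A (u k' - 1 + 1) = u k" using notin by (simp add: rot_def)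
  qed
  have mid: "?w k = u (k + 1) - 1" if k: "int r < k" "k < N" for k
    by (rule step) (use k in auto)
  have last: "?w N = u (int r + 1) + N - 1"
  proof -
    have "?w N = u (int r + 1 + 1 * N) - 1"
    proof (rule step)
      show "int r \<le> (int r + 1 + 1 * N - 1) mod N" using r by simp
      fix l assume l: "N < l" "l < int r + 1 + 1 * N"
      have "(l - 1) mod N = (l - 1 - N) mod N" by simp
      also have "\<dots> = l - 1 - N" using l r by (intro mod_pos_pos_trivial) auto
      finally show "(l - 1) mod N < int r" using l by simp
    qed (use r in \<open>auto simp: zmod_minus1\<close>)
    then show ?thesis using periodic_bij_add[OF pu, of "int r + 1" 1] by simp
  qed
  have dless: "u l < u i" if "l < i" "int r < i" "i \<le> N" for l i
    using d that unfolding dominated_def by simp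
  have "?w i < ?w (i + 1)" if i: "i \<in> {1..<N}" for i
  proof -
    consider "i + 1 \<le> int r" | "i = int r" "i + 1 < N" | "i = int r" "i + 1 = N"
      | "i > int r" "i + 1 < N" | "i > int r" "i + 1 = N" using i by fastforce
    then show ?thesis
    proof cases
      case 1
      then show ?thesis using small[of i] small[of "i + 1"] i aff_grass_less[OF u, of i "i + 1"] by simp
    next
      case 2
      then show ?thesis using small[of i] mid[of "i + 1"] i dless[of i "i + 1 + 1"] by simp
    next
      case 3
      then show ?thesis using small[of i] last i dless[of i "i + 1"] by simp
    next
      case 4
      then show ?thesis using mid[of i] mid[of "i + 1"] i dless[of "i + 1" "i + 1 + 1"] by simp
    next
      case 5
      have "int r \<le> (int r + 1 + 1 * N - 1) mod N" using r by simp
      then have "u N < u (int r + 1 + 1 * N)" using d unfolding dominated_def by simp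
      then have "u N < u (int r + 1) + N" using periodic_bij_add[OF pu, of "int r + 1" 1] by simp
      then show ?thesis using mid[of i] last 5 by simp
    qed
  qed
  moreover have "affine_perm n ?w" unfolding grow_def
    by (intro affine_perm_comp affine_perm_inv affine_perm_cyc A au)
  ultimately show ?thesis unfolding aff_grass_def by blast
qed

lemma code_count_grow:
  assumes u: "periodic_bij u" and r: "r < n" and d: "dominated r u"
  shows "code_count 1 (inv (grow r u)) = r"
    and "k > 0 \<Longrightarrow> code_count (Suc k) (inv (grow r u)) = code_count k (inv u)"
proof -
  let ?A = "initial_residues r u" and ?f = "inv u"
  note A = proper_initial_residues[OF u r] and f = periodic_bij_inv[OF u]
  note v = dominated_valid[OF u r d]
  have ge: "code_count m h = (\<Sum>j\<in>{0..<N}. if m \<le> code_entry h j then 1 else 0)" for m h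
    unfolding code_count_def by (simp add: sum.If_cases Int_def)
  have eq: "code_count m (inv (grow r u)) = card {j \<in> {0..<N}. m \<le> code_entry (?f \<circ> rot ?A) j}" for m
    unfolding inv_grow[OF u r] ge sum_code_cyc[OF f A, of "\<lambda>c. if m \<le> c then 1 else 0"]
    by (simp add: sum.If_cases Int_def)
  have inA: "code_entry (?f \<circ> rot ?A) j = code_entry ?f j + 1" if "j \<in> ?A" for j
    using code_entry_rot_in[OF f A, of j] that proper_mod[OF A that] v unfolding valid_def by simp
  have out: "code_entry (?f \<circ> rot ?A) j = 0" "code_entry ?f j = 0" if "j \<in> {0..<N}" "j \<notin> ?A" for j
    using that code_entry_rot_notin(2)[OF f A _ v, of j] dominated_code_zero[OF u r d]
      pred_out_notin[OF A] by auto
  have sub: "?A \<subseteq> {0..<N}" using proper_subset[OF A] .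
  have "{j \<in> {0..<N}. 1 \<le> code_entry (?f \<circ> rot ?A) j} = ?A"
    using inA out sub by fastforce
  then show "code_count 1 (inv (grow r u)) = r"
    unfolding eq using card_initial_residues[OF u r] by simp
  assume k: "k > 0"
  have "{j \<in> {0..<N}. Suc k \<le> code_entry (?f \<circ> rot ?A) j} = {j \<in> {0..<N}. k \<le> code_entry ?f j}"
    using inA out k by (intro Collect_cong) (metis Suc_eq_plus1 Suc_le_mono le_zero_eq less_not_refl not_less_eq_eq zero_less_Suc)
  then show "code_count (Suc k) (inv (grow r u)) = code_count k (inv u)"
    unfolding eq by (simp add: code_count_def)
qed

lemma lam_grow:
  assumes u: "aff_grass n u" and r: "0 < r" "r < n" and d: "dominated r u"
  shows "lam n (grow r u) = r # lam n u"
proof -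
  have pu: "periodic_bij u" and pw: "periodic_bij (grow r u)"
    using u aff_grass_grow[OF u r(2) d] affine_periodic unfolding aff_grass_def by auto
  note c = code_count_grow[OF pu r(2) d]
  note iu = periodic_bij_inv[OF pu] and iw = periodic_bij_inv[OF pw]
  let ?M = "max_code (inv u)" and ?M' = "max_code (inv (grow r u))"
  have "k \<le> ?M' \<longleftrightarrow> k \<le> Suc ?M" if k: "k > 0" for k
  proof (cases "k = 1")
    case True
    then show ?thesis using max_code_iff[OF iw, of 1] c(1) r by simp
  next
    case False
    then obtain m where m: "k = Suc m" "m > 0" using k by (cases k) auto
    then show ?thesis using max_code_iff[OF iw, of k] max_code_iff[OF iu, of m] c(2)[of m] by simp
  qed
  from this[of ?M'] this[of "Suc ?M"] have "?M' = Suc ?M" by (cases "?M' = 0") auto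
  then have "lam n (grow r u) = map (\<lambda>k. code_count k (inv (grow r u))) (1 # [Suc 1..<Suc (Suc ?M)])"
    unfolding lam_eq[OF pw] by (simp add: upt_conv_Cons del: upt_Suc)
  also have "\<dots> = r # map (\<lambda>k. code_count (Suc k) (inv (grow r u))) [1..<Suc ?M]"
    unfolding map_Suc_upt[symmetric] using c(1) by (simp del: upt_Suc)
  also have "map (\<lambda>k. code_count (Suc k) (inv (grow r u))) [1..<Suc ?M] = lam n u"
    unfolding lam_eq[OF pu] by (rule map_cong) (use c(2) in auto)
  finally show ?thesis .
qed

text \<open>The last row B makes every code entry on B positive, so B lies in the support of the
  final code, which is contained in \<open>initial_residues r u\<close>. Both have r elements, so
  the last row is forced and only the earlier ones remain free.\<close>

lemma paths_grow:
  assumes u: "periodic_bij u" and r: "r < n" and d: "dominated r u"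
  shows "card (paths (r # as) (inv (grow r u))) = card (paths as (inv u))"
proof -
  let ?A = "initial_residues r u" and ?f = "inv u"
  note A = proper_initial_residues[OF u r] and f = periodic_bij_inv[OF u]
  note v = dominated_valid[OF u r d]
  have "paths (r # as) (inv (grow r u)) = (#) ?A ` paths as ?f"
  proof (intro equalityI subsetI)
    fix Bs assume "Bs \<in> paths (r # as) (inv (grow r u))"
    then obtain B As where Bs: "Bs = B # As" and B: "proper B" "valid (path_end As) B" "card B = r"
      and As: "admissible As" "map card As = as" and e: "path_end As \<circ> cyc B = ?f \<circ> cyc ?A"
      unfolding paths_def inv_grow[OF u r] by (auto simp: map_eq_Cons_conv)
    have p: "periodic_bij (path_end As)"
      using affine_perm_path_end[OF admissible_proper[OF As(1)]] affine_periodic by blast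
    have e': "path_end As \<circ> rot B = ?f \<circ> rot ?A"
    proof
      fix x show "(path_end As \<circ> rot B) x = (?f \<circ> rot ?A) x"
        using fun_cong[OF e, of "x - 1"] by (simp add: cyc_def)
    qed
    have "B \<subseteq> ?A"
    proof
      fix j assume j: "j \<in> B"
      then have jB: "j mod N \<in> B" "j mod N = j" using proper_mod[OF B(1)] by auto
      have "code_entry (?f \<circ> rot ?A) j \<noteq> 0"
        using code_entry_rot_in[OF p B(1) jB(1)] B(2) jB(1) unfolding valid_def e' by simp
      then show "j \<in> ?A"
        using code_entry_rot_notin(2)[OF f A _ v, of j] dominated_code_zero[OF u r d]
          pred_out_notin[OF A, of j] jB by force
    qed
    then have BA: "B = ?A"
      using card_subset_eq[OF proper_finite[OF A]] B(3) card_initial_residues[OF u r] by simp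
    have "path_end As = path_end As \<circ> cyc ?A \<circ> inv (cyc ?A)"
      using comp_inv_periodic(1)[OF periodic_bij_cyc[OF A]] by (simp add: comp_assoc)
    also have "\<dots> = ?f"
      using comp_inv_periodic(1)[OF periodic_bij_cyc[OF A]] e by (simp add: BA comp_assoc)
    finally show "Bs \<in> (#) ?A ` paths as ?f" using Bs BA As unfolding paths_def by blast
  next
    fix Bs assume "Bs \<in> (#) ?A ` paths as ?f"
    then obtain As where "Bs = ?A # As" "admissible As" "map card As = as" "path_end As = ?f"
      unfolding paths_def by blast
    then show "Bs \<in> paths (r # as) (inv (grow r u))"
      using A v card_initial_residues[OF u r] unfolding paths_def inv_grow[OF u r]
      by (simp only: mem_Collect_eq admissible.simps list.map path_end.simps)
  qed
  then show ?thesis by (simp add: card_image)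
qed

text \<open>If the comparison with u 0 failed, then u 0 would exceed u 1, ..., u (r+1) from an
  earlier position, and r + 1 different residues would have nonzero code.\<close>

lemma dominated_of_code_count:
  assumes u: "aff_grass n u" and r: "r < n" and c: "code_count 1 (inv u) \<le> r"
  shows "dominated r u"
proof (rule dominatedI[OF u r], rule ccontr)
  assume "\<not> u N - N \<le> u (int r + 1)"
  then have lt: "u (int r + 1) < u N - N" by simp
  have pu: "periodic_bij u" using u affine_periodic unfolding aff_grass_def by blast
  have u0: "u 0 = u N - N" using periodic_bij_add[OF pu, of 0 1] by simp
  have fi: "periodic_bij (inv u)" by (rule periodic_bij_inv[OF pu])
  have pos: "1 \<le> code_entry (inv u) (u k mod N)" if k: "k \<in> {1..int r + 1}" for k
  proof -
    have "u k \<le> u (int r + 1)" using aff_grass_le[OF u, of k "int r + 1"] k r by simp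
    then have "u 0 \<in> {j. j > u k \<and> inv u j < inv u (u k)}"
      using lt u0[symmetric] k comp_inv_periodic(5)[OF pu] by simp
    then have "card {j. j > u k \<and> inv u j < inv u (u k)} \<noteq> 0"
      using finite_code[OF fi, of "u k" "inv u (u k)"] by (metis card_0_eq empty_iff)
    then have "1 \<le> code_entry (inv u) (u k)" unfolding code_entry_def by linarith
    then show ?thesis using invariant_mod[of "code_entry (inv u)" "u k"] code_entry_add[OF fi] by simp
  qed
  have "inj_on (\<lambda>k. u k mod N) {1..int r + 1}"
  proof (rule inj_onI)
    fix x y assume xy: "x \<in> {1..int r + 1}" "y \<in> {1..int r + 1}" "u x mod N = u y mod N"
    then have "x mod N = y mod N" using mod_eq_periodic[OF pu] by blast
    then have "(x - 1) mod N = (y - 1) mod N" using mod_add_cancel[of x "-1" y] by simp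
    then show "x = y" using xy r by simp
  qed
  then have "card ((\<lambda>k. u k mod N) ` {1..int r + 1}) = r + 1" by (simp add: card_image)
  moreover have "(\<lambda>k. u k mod N) ` {1..int r + 1} \<subseteq> {j \<in> {0..<N}. 1 \<le> code_entry (inv u) j}"
    using pos by auto
  ultimately have "r + 1 \<le> code_count 1 (inv u)"
    unfolding code_count_def
    using card_mono[of "{j \<in> {0..<N}. 1 \<le> code_entry (inv u) j}" "(\<lambda>k. u k mod N) ` {1..int r + 1}"]
      finite_subset[of "{j \<in> {0..<N}. 1 \<le> code_entry (inv u) j}" "{0..<N}"]
    by (metis (no_types, lifting) finite_atLeastLessThan_int mem_Collect_eq subsetI)
  then show False using c by simp
qed

text \<open>This inverts \<open>grow\<close>. The window values below w 0 are those with nonzero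
  code, and r is their number. The smaller element has the window w 1 + 1, ..., w r + 1, w 0 + 1, w
  (r+1) + 1, ..., w (n-1) + 1.\<close>

lemma peel:
  assumes w: "aff_grass n w" and ne: "w \<noteq> id"
  shows "\<exists>u r. aff_grass n u \<and> 0 < r \<and> r < n \<and> dominated r u \<and> w = grow r u"
proof -
  have aw: "affine_perm n w" using w unfolding aff_grass_def by blast
  note pw = affine_periodic[OF aw]
  have w0: "w 0 = w N - N" using periodic_bij_add[OF pw, of 0 1] by simp
  define S where "S = {k \<in> {1..n}. w (int k) < w 0}"
  have "S \<noteq> {}"
  proof
    assume S: "S = {}"
    have "w (int a) < w (int a + 1)" if a: "a < n" for a
    proof (cases "a = 0")
      case True
      have "1 \<notin> S" using S by simp
      then have "\<not> w 1 < w 0" using n_gt_2 unfolding S_def by simp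
      moreover have "w 1 \<noteq> w 0" using periodic_bij_inj[OF pw] by simp
      ultimately show ?thesis using True by simp
    next
      case False
      then show ?thesis using a aff_grass_less[OF w, of "int a" "int a + 1"] by simp
    qed
    then show False using increasing_affine_id[OF aw] ne by blast
  qed
  moreover have finS: "finite S" unfolding S_def by simp
  define r where "r = Max S"
  ultimately have rS: "r \<in> S" using Max_in[OF finS] unfolding r_def by simp
  then have r: "0 < r" "r \<le> n" "w (int r) < w 0" unfolding S_def by auto
  moreover have "r \<noteq> n" using r w0 by auto
  ultimately have rn: "r < n" by simp
  have "Suc r \<notin> S" using Max_ge[OF finS, of "Suc r"] unfolding r_def by auto
  then have "w 0 \<le> w (int r + 1)" using rn unfolding S_def by (simp add: add.commute)
  moreover have "w 0 \<noteq> w (int r + 1)" using periodic_bij_inj[OF pw] by simp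
  ultimately have lt: "w 0 < w (int r + 1)" by simp
  \<comment> \<open>The index shift inside \<open>cyc\<close> is absorbed here, so that u becomes
    \<open>rot A \<circ> t\<close>.\<close>
  define t where "t = (\<lambda>k. w k + 1)"
  have pt: "periodic_bij t"
    using periodic_bij_comp[OF periodic_bij_shift[of 1] pw] by (simp add: t_def comp_def)
  define A where "A = initial_residues r t"
  note A = proper_initial_residues[OF pt rn, folded A_def]
  have inA: "t i mod N \<in> A \<longleftrightarrow> (i - 1) mod N < int r" for i
    unfolding A_def by (rule in_initial_residues[OF pt]) (use rn in simp)
  define u where "u = cyc A \<circ> w"
  have ut: "u k = rot A (t k)" for k by (simp add: u_def t_def cyc_def)
  have small: "u k = w k + 1" if "1 \<le> k" "k \<le> int r" for k
    using inA[of k] that rn unfolding ut by (simp add: rot_def t_def)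
  \<comment> \<open>No value outside A falls strictly between consecutive entries of w 0 + 1, t (r +
    1), ..., t n: such values are translates of t (r + 1), ..., t n, and as w 0 = w n - n,
    nontrivial translates miss this range.\<close>
  have gap: "j mod N \<in> A" if k: "int r < k" "k \<le> N" and j: "j < t k"
      "w 0 + 1 < j" "int r + 1 < k \<Longrightarrow> t (k - 1) < j" for k j
  proof (rule ccontr)
    assume jA: "j mod N \<notin> A"
    define l where "l = inv t j"
    have l: "t l = j" unfolding l_def using comp_inv_periodic(4)[OF pt] .
    then have rl: "int r \<le> (l - 1) mod N" using inA[of l] jA by simp
    obtain l0 a where ld: "l = l0 + a * N" "1 \<le> l0" "l0 \<le> N" "(l - 1) mod N = l0 - 1"
      by (rule window_decomp)
    have wl: "j = w l0 + 1 + a * N" using l ld periodic_bij_add[OF pw, of l0 a] by (simp add: t_def)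
    consider "a = 0" | "a \<ge> 1" | "a \<le> -1" by linarith
    then show False
    proof cases
      case 1
      have "l0 < k"
      proof (rule ccontr)
        assume "\<not> l0 < k"
        then have "w k \<le> w l0" using aff_grass_le[OF w, of k l0] k ld by simp
        then show False using wl 1 j by (simp add: t_def)
      qed
      then have "int r + 1 < k" "l0 \<le> k - 1" using rl ld by auto
      then have "t (k - 1) < j" "w l0 \<le> w (k - 1)" using j(3) aff_grass_le[OF w, of l0 "k - 1"] k ld by auto
      then show False using wl 1 by (simp add: t_def)
    next
      case 2
      then have "N \<le> a * N" using mult_right_mono[of 1 a N] by simp
      moreover have "w (int r + 1) \<le> w l0" using aff_grass_le[OF w, of "int r + 1" l0] rl ld by simp
      moreover have "w k \<le> w N" using aff_grass_le[OF w, of k N] k by simp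
      ultimately show False using wl j(1) lt w0 unfolding t_def by linarith
    next
      case 3
      then have "a * N \<le> - N" using mult_right_mono[of a "-1" N] by simp
      moreover have "w l0 \<le> w N" using aff_grass_le[OF w, of l0 N] ld by simp
      ultimately show False using wl j(2) w0 by linarith
    qed
  qed
  have notin: "t k mod N \<notin> A" if "int r < k" "k \<le> N" for k using inA[of k] that by simp
  have notin0: "t 0 mod N \<notin> A"
    using notin[of N] rn periodic_bij_add[OF pt, of 0 1] by simp
  have first: "u (int r + 1) = w 0 + 1"
  proof -
    have "pred_out A (t (int r + 1)) = t 0"
      by (rule pred_outI[OF A]) (use lt rn gap[of "int r + 1"] notin0 in \<open>auto simp: t_def\<close>)
    then show ?thesis using notin[of "int r + 1"] rn unfolding ut by (simp add: rot_def t_def)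
  qed
  have mid: "u k = w (k - 1) + 1" if k: "int r + 1 < k" "k \<le> N" for k
  proof -
    have wk: "w (k - 1) < w k" using aff_grass_less[OF w, of "k - 1" k] k by simp
    have wr: "w (int r + 1) \<le> w (k - 1)" using aff_grass_le[OF w, of "int r + 1" "k - 1"] k by simp
    have "pred_out A (t k) = t (k - 1)"
    proof (rule pred_outI[OF A])
      show "t (k - 1) < t k" using wk by (simp add: t_def)
      show "t (k - 1) mod N \<notin> A" using notin[of "k - 1"] k by simp
      show "j mod N \<in> A" if "t (k - 1) < j" "j < t k" for j
        by (rule gap[of k]) (use that k wr lt in \<open>auto simp: t_def\<close>)
    qed
    then show ?thesis using notin[of k] k unfolding ut by (simp add: rot_def t_def)
  qed
  have au: "affine_perm n u" unfolding u_def by (intro affine_perm_comp affine_perm_cyc A aw)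
  have gu: "aff_grass n u" unfolding aff_grass_def
  proof (intro conjI ballI au)
    fix i assume i: "i \<in> {1..<N}"
    consider "i + 1 \<le> int r" | "i = int r" | "i = int r + 1" | "i > int r + 1" by linarith
    then show "u i < u (i + 1)"
    proof cases
      case 1
      then show ?thesis using small[of i] small[of "i + 1"] i aff_grass_less[OF w, of i "i + 1"] by simp
    next
      case 2
      then show ?thesis using small[of i] first i r by simp
    next
      case 3
      then show ?thesis using first mid[of "i + 1"] i lt by (simp add: add.commute)
    next
      case 4
      then show ?thesis using mid[of i] mid[of "i + 1"] i aff_grass_less[OF w, of "i - 1" i] by simp
    qed
  qed
  have "u N - N \<le> u (int r + 1)"
  proof (cases "int r + 1 = N")
    case False
    then show ?thesis
      using first mid[of N] rn aff_grass_less[OF w, of "N - 1" N] w0 n_gt_2 by simp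
  qed simp
  then have d: "dominated r u" by (rule dominatedI[OF gu rn])
  have "initial_residues r u = A"
    unfolding A_def initial_residues_def by (rule image_cong) (use small in \<open>auto simp: t_def\<close>)
  then have "grow r u = inv (cyc A) \<circ> cyc A \<circ> w" by (simp add: grow_def u_def comp_assoc)
  also have "\<dots> = w" using comp_inv_periodic(2)[OF periodic_bij_cyc[OF A]] by simp
  finally show ?thesis using gu r rn d by metis
qed

lemma aff_grass_id: "aff_grass n id"
  unfolding aff_grass_def using affine_perm_id by simp

text \<open>By \<open>peel\<close> and \<open>lam_grow\<close> the first part of the partition
  recovers r and the rest belongs to the smaller element, so equal partitions unwind through the
  same rows down to the identity.\<close>

lemma lam_inj:
  "aff_grass n w \<Longrightarrow> aff_grass n w' \<Longrightarrow> lam n w = la \<Longrightarrow> lam n w' = la \<Longrightarrow> w = w'"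
proof (induction la arbitrary: w w')
  case Nil
  have "x = id" if "aff_grass n x" "lam n x = []" for x
    using peel[of x] lam_grow that by fastforce
  then show ?case using Nil by metis
next
  case (Cons r la)
  have *: "\<exists>u. aff_grass n u \<and> lam n u = la \<and> x = grow r u" if "aff_grass n x" "lam n x = r # la" for x
    using peel[of x] lam_grow lam_id that by fastforce
  from *[of w] *[of w'] obtain u u' where
    "aff_grass n u" "lam n u = la" "w = grow r u" "aff_grass n u'" "lam n u' = la" "w' = grow r u'"
    using Cons.prems by auto
  then show ?case using Cons.IH by blast
qed

text \<open>The extra clauses travel with the induction because they concern the element being
  built: the capped sums turn \<open>sum_take_admissible\<close> into dominance by la, and the
  unique path yields the diagonal coefficient 1.\<close>

lemma lam_surj:
  assumes "la \<in> Bn n"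
  shows "\<exists>w. aff_grass n w \<and> lam n w = la \<and> (\<forall>k. capped_code k (inv w) = sum_list (take k la))
    \<and> card (paths la (inv w)) = 1"
  using assms
proof (induction la)
  case Nil
  have "capped_code k (inv id) = 0" for k
    by (simp only: inv_id) (simp add: capped_code_def code_entry_id)
  moreover have "paths [] (inv id) = {[]}" by (simp only: inv_id) (auto simp: paths_def)
  ultimately show ?case using aff_grass_id lam_id by (intro exI[of _ id]) (simp only: take_Nil sum_list.Nil, simp)
next
  case (Cons r la)
  then have la: "la \<in> Bn n" and r: "0 < r" "r < n" and le: "\<forall>x\<in>set la. x \<le> r"
    unfolding Bn_def is_partition_def by (auto simp: sorted_append)
  from Cons.IH[OF la] obtain u where u: "aff_grass n u" "lam n u = la"
      "\<And>k. capped_code k (inv u) = sum_list (take k la)" "card (paths la (inv u)) = 1" by blast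
  have pu: "periodic_bij u" using u affine_periodic unfolding aff_grass_def by blast
  note iu = periodic_bij_inv[OF pu]
  \<comment> \<open>The ordering of the parts enters here: the number of nonzero code entries of u
    is the first part of la, or 0 if la is empty.\<close>
  have "code_count 1 (inv u) \<le> r"
  proof (cases "max_code (inv u) = 0")
    case True
    then show ?thesis using max_code_iff[OF iu, of 1] by simp
  next
    case False
    then have "1 \<in> set [1..<Suc (max_code (inv u))]" by (simp del: upt_Suc)
    then have "code_count 1 (inv u) \<in> set (lam n u)" unfolding lam_eq[OF pu] set_map by (rule imageI)
    then show ?thesis using le u by simp
  qed
  then have d: "dominated r u" by (rule dominated_of_code_count[OF u(1) r(2)])
  have "capped_code k (inv (grow r u)) = sum_list (take k (r # la))" for k
  proof (cases k)
    case (Suc m)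
    have "capped_code (Suc m) (inv u \<circ> cyc (initial_residues r u))
        = capped_code m (inv u) + card (initial_residues r u)"
      by (rule capped_code_cyc(2)[OF iu proper_initial_residues[OF pu r(2)] dominated_valid[OF pu r(2) d]
          dominated_code_zero[OF pu r(2) d]])
    then show ?thesis
      using card_initial_residues[OF pu r(2)] u(3) Suc unfolding inv_grow[OF pu r(2)] by simp
  qed (simp add: capped_code_def)
  then show ?case
    using aff_grass_grow[OF u(1) r(2) d] lam_grow[OF u(1) r d] u paths_grow[OF pu r(2) d] by metis
qed

end

section \<open>Symmetric functions and the change of basis\<close>

definition part_monom :: "nat list \<Rightarrow> nat \<Rightarrow> nat" where
  "part_monom \<mu> i = (if i < length \<mu> then \<mu> ! i else 0)"

lemma map_part_monom: "map (part_monom \<mu>) [0..<length \<mu>] = \<mu>"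
  by (rule nth_equalityI) (auto simp: part_monom_def)

lemma part_monom_beyond: "i \<ge> length \<mu> \<Longrightarrow> part_monom \<mu> i = 0"
  by (simp add: part_monom_def)

lemma fin_monom_part_monom [simp]: "fin_monom (part_monom \<mu>)"
  by (rule bounded_support(3)[OF part_monom_beyond])

lemma card_level_set:
  fixes \<alpha> :: "nat \<Rightarrow> nat"
  assumes "\<And>i. i \<ge> L \<Longrightarrow> \<alpha> i = 0" "k > 0"
  shows "card {i. \<alpha> i = k} = count_list (map \<alpha> [0..<L]) k"
proof -
  have "{i. \<alpha> i = k} = {i. i < L \<and> \<alpha> i = k}"
    using bounded_support(1)[of L \<alpha>, OF assms(1)] assms(2) by auto
  then show ?thesis using count_map_upt[of \<alpha> L k] by (simp only: count_mset)
qed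

lemma card_part_monom: "k > 0 \<Longrightarrow> card {i. part_monom \<mu> i = k} = count_list \<mu> k"
  using card_level_set[of "length \<mu>" "part_monom \<mu>" k] part_monom_beyond map_part_monom by metis

lemma mdeg_part_monom: "mdeg (part_monom \<mu>) = sum_list \<mu>"
proof -
  have "mdeg (part_monom \<mu>) = (\<Sum>i<length \<mu>. part_monom \<mu> i)"
    unfolding mdeg_def using bounded_support(2)[of "length \<mu>" "part_monom \<mu>", OF part_monom_beyond]
    by (intro sum.mono_neutral_left) auto
  also have "\<dots> = sum_list (map (part_monom \<mu>) [0..<length \<mu>])"
    by (simp add: interv_sum_list_conv_sum_set_nat atLeast0LessThan)
  finally show ?thesis by (simp only: map_part_monom)
qed

lemma partition_eqI:
  assumes "is_partition \<mu>" "is_partition \<nu>" "\<And>k. k > 0 \<Longrightarrow> count_list \<mu> k = count_list \<nu> k"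
  shows "\<mu> = \<nu>"
proof -
  have "count_list \<mu> k = count_list \<nu> k" for k
    using assms by (cases "k = 0") (auto simp: is_partition_def count_list_0_iff)
  then have "mset (rev \<mu>) = mset (rev \<nu>)" by (intro multiset_eqI) (simp add: count_mset)
  then have "rev \<mu> = rev \<nu>"
    using assms(1,2) properties_for_sort[of "rev \<mu>" "rev \<nu>"] properties_for_sort[of "rev \<nu>" "rev \<nu>"]
    unfolding is_partition_def by metis
  then show ?thesis by simp
qed

lemma msym_part_monom:
  assumes "is_partition \<mu>" "is_partition \<nu>"
  shows "msym \<nu> (part_monom \<mu>) = (if \<mu> = \<nu> then 1 else 0)"
  using partition_eqI[OF assms] by (auto simp: msym_def card_part_monom)

text \<open>Equal multiplicities of positive exponents give a permutation of the variables below L,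
  and the identity beyond, that carries one monomial to the other.\<close>

lemma Sym_eqI:
  assumes f: "f \<in> Sym" and fin: "fin_monom \<alpha>" "fin_monom \<beta>"
    and eq: "\<And>k. k > 0 \<Longrightarrow> card {i. \<alpha> i = k} = card {i. \<beta> i = k}"
  shows "f \<alpha> = f \<beta>"
proof -
  obtain L1 L2 where "\<forall>i\<ge>L1. \<alpha> i = 0" "\<forall>i\<ge>L2. \<beta> i = 0"
    using fin fin_monom_bounded by metis
  then obtain L where L: "\<And>i. i \<ge> L \<Longrightarrow> \<alpha> i = 0" "\<And>i. i \<ge> L \<Longrightarrow> \<beta> i = 0"
    by (metis max.bounded_iff)
  have "mset (map \<alpha> [0..<L]) = mset (map \<beta> [0..<L])" by (rule mset_map_upt_eqI[OF L eq])
  then obtain p where p: "p permutes {..<L}" "permute_list p (map \<beta> [0..<L]) = map \<alpha> [0..<L]"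
    by (rule mset_eq_permutation) auto
  have "\<alpha> i = \<beta> (p i)" for i
  proof (cases "i < L")
    case True
    then have "p i < L" using permutes_in_image[OF p(1), of i] by simp
    then show ?thesis
      using arg_cong[OF p(2), of "\<lambda>l. l ! i"] True permute_list_nth[of p "map \<beta> [0..<L]" i] p(1) by simp
  next
    case False
    then have "p i = i" using permutes_not_in[OF p(1)] by simp
    then show ?thesis using L False by simp
  qed
  then have "\<alpha> = \<beta> \<circ> p" by (simp add: fun_eq_iff)
  then show ?thesis using f permutes_bij[OF p(1)] unfolding Sym_def by blast
qed

lemma obtain_partition:
  assumes "fin_monom \<alpha>"
  obtains \<nu> where "is_partition \<nu>" "\<And>k. k > 0 \<Longrightarrow> card {i. \<alpha> i = k} = count_list \<nu> k"
proof -
  obtain L where L: "\<And>i. i \<ge> L \<Longrightarrow> \<alpha> i = 0" using assms fin_monom_bounded by blast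
  let ?\<nu> = "rev (sort (filter (\<lambda>x. x \<noteq> 0) (map \<alpha> [0..<L])))"
  have "count_list ?\<nu> k = count_list (map \<alpha> [0..<L]) k" if "k > 0" for k
    using that by (simp only: count_mset[symmetric] mset_rev mset_sort mset_filter count_filter_mset) simp
  then have "card {i. \<alpha> i = k} = count_list ?\<nu> k" if "k > 0" for k
    using card_level_set[of L \<alpha> k, OF L] that by simp
  moreover have "is_partition ?\<nu>" by (simp add: is_partition_def)
  ultimately show ?thesis using that by blast
qed

lemma Sym_diff_smult:
  assumes "f \<in> Sym" "g \<in> Sym" shows "(\<lambda>\<alpha>. f \<alpha> - c * g \<alpha>) \<in> Sym"
proof -
  obtain d e where "\<forall>\<alpha>. f \<alpha> \<noteq> 0 \<longrightarrow> mdeg \<alpha> \<le> d" "\<forall>\<alpha>. g \<alpha> \<noteq> 0 \<longrightarrow> mdeg \<alpha> \<le> e"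
    using assms unfolding Sym_def by blast
  then have "\<forall>\<alpha>. f \<alpha> - c * g \<alpha> \<noteq> 0 \<longrightarrow> mdeg \<alpha> \<le> max d e"
    by (metis diff_zero max.coboundedI1 max.coboundedI2 mult_zero_right)
  then show ?thesis using assms unfolding Sym_def by auto
qed

lemma Sym_diff_sum:
  assumes "finite S" "f \<in> Sym" "\<And>s. s \<in> S \<Longrightarrow> g s \<in> Sym"
  shows "(\<lambda>\<alpha>. f \<alpha> - (\<Sum>s\<in>S. c s * g s \<alpha>)) \<in> Sym"
  using assms
proof (induction S rule: finite_induct)
  case (insert s S)
  have "(\<lambda>\<alpha>. (f \<alpha> - (\<Sum>s\<in>S. c s * g s \<alpha>)) - c s * g s \<alpha>) \<in> Sym"
    by (rule Sym_diff_smult) (use insert in auto)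
  moreover have "(\<lambda>\<alpha>. (f \<alpha> - (\<Sum>s\<in>S. c s * g s \<alpha>)) - c s * g s \<alpha>)
      = (\<lambda>\<alpha>. f \<alpha> - (\<Sum>s\<in>insert s S. c s * g s \<alpha>))"
    using insert.hyps by (simp add: algebra_simps)
  ultimately show ?case by simp
qed simp

lemma length_le_sum_list: "0 \<notin> set \<mu> \<Longrightarrow> length \<mu> \<le> sum_list (\<mu> :: nat list)"
  by (induction \<mu>) auto

lemma finite_partitions: "finite {\<mu>. is_partition \<mu> \<and> sum_list \<mu> \<le> d}"
proof (rule finite_subset)
  show "{\<mu>. is_partition \<mu> \<and> sum_list \<mu> \<le> d} \<subseteq> {\<mu>. set \<mu> \<subseteq> {..d} \<and> length \<mu> \<le> d}"
  proof
    fix \<mu> assume "\<mu> \<in> {\<mu>. is_partition \<mu> \<and> sum_list \<mu> \<le> d}"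
    then have \<mu>: "0 \<notin> set \<mu>" "sum_list \<mu> \<le> d" by (auto simp: is_partition_def)
    have "x \<le> d" if "x \<in> set \<mu>" for x using member_le_sum_list[OF that] \<mu> by linarith
    then show "\<mu> \<in> {\<mu>. set \<mu> \<subseteq> {..d} \<and> length \<mu> \<le> d}" using length_le_sum_list[OF \<mu>(1)] \<mu>(2) by auto
  qed
qed (simp add: finite_lists_length_le)

lemma In_ideal_part_monom:
  assumes "f \<in> In_ideal n" "\<mu> \<in> Bn n" shows "f (part_monom \<mu>) = 0"
proof -
  obtain S c where S: "S \<subseteq> {\<mu>. is_partition \<mu>} - Bn n" "f = (\<lambda>\<alpha>. \<Sum>\<mu>\<in>S. c \<mu> * msym \<mu> \<alpha>)"
    using assms unfolding In_ideal_def by blast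
  have "msym \<nu> (part_monom \<mu>) = 0" if "\<nu> \<in> S" for \<nu>
  proof -
    have "is_partition \<nu>" "is_partition \<mu>" "\<mu> \<noteq> \<nu>" using that S(1) assms(2) by (auto simp: Bn_def)
    then show ?thesis by (simp add: msym_part_monom)
  qed
  then show ?thesis using S by simp
qed

text \<open>In the expansion of f into monomial symmetric functions the coefficient of m_\<mu> is
  the value at \<open>part_monom \<mu>\<close>. Only partitions outside \<open>Bn n\<close> survive,
  finitely many by the degree bound.\<close>

lemma In_idealI:
  assumes f: "f \<in> Sym" and zero: "\<And>\<mu>. \<mu> \<in> Bn n \<Longrightarrow> f (part_monom \<mu>) = 0"
  shows "f \<in> In_ideal n"
proof -
  obtain d where d: "\<And>\<alpha>. f \<alpha> \<noteq> 0 \<Longrightarrow> mdeg \<alpha> \<le> d" using f unfolding Sym_def by blast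
  let ?S = "{\<mu>. is_partition \<mu> \<and> sum_list \<mu> \<le> d} - Bn n"
  have "f \<alpha> = (\<Sum>\<mu>\<in>?S. f (part_monom \<mu>) * msym \<mu> \<alpha>)" for \<alpha>
  proof (cases "fin_monom \<alpha>")
    case True
    then obtain \<nu> where \<nu>: "is_partition \<nu>" "\<And>k. k > 0 \<Longrightarrow> card {i. \<alpha> i = k} = count_list \<nu> k"
      using obtain_partition by blast
    have f\<nu>: "f \<alpha> = f (part_monom \<nu>)"
      by (rule Sym_eqI[OF f True]) (simp_all add: \<nu> card_part_monom)
    have "msym \<mu> \<alpha> = (if \<mu> = \<nu> then 1 else 0)" if "\<mu> \<in> ?S" for \<mu>
      using partition_eqI[of \<nu> \<mu>] that \<nu> True unfolding msym_def by auto
    then have "(\<Sum>\<mu>\<in>?S. f (part_monom \<mu>) * msym \<mu> \<alpha>)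
        = (\<Sum>\<mu>\<in>?S. if \<mu> = \<nu> then f (part_monom \<mu>) else 0)"
      by (intro sum.cong refl) auto
    also have "\<dots> = (if \<nu> \<in> ?S then f (part_monom \<nu>) else 0)"
      using finite_partitions[of d] by simp
    also have "\<dots> = f (part_monom \<nu>)"
      using d[of "part_monom \<nu>"] mdeg_part_monom[of \<nu>] zero[of \<nu>] \<nu>(1) by auto
    finally show ?thesis using f\<nu> by simp
  next
    case False
    then show ?thesis using f unfolding Sym_def by (simp add: msym_def)
  qed
  then have "f = (\<lambda>\<alpha>. \<Sum>\<mu>\<in>?S. f (part_monom \<mu>) * msym \<mu> \<alpha>)" by blast
  moreover have "finite ?S" using finite_partitions[of d] by simp
  moreover have "?S \<subseteq> {\<mu>. is_partition \<mu>} - Bn n" by blast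
  ultimately show ?thesis unfolding In_ideal_def mem_Collect_eq
    by (intro exI[of _ ?S] exI[of _ "\<lambda>\<mu>. f (part_monom \<mu>)"] conjI)
qed

section \<open>A numerical key for dominance, and unitriangular systems\<close>

definition dominance_key :: "nat list \<Rightarrow> nat" where
  "dominance_key \<mu> = (\<Sum>k\<le>sum_list \<mu>. sum_list (take k \<mu>))"

lemma eq_of_partial_sums:
  fixes \<mu> \<nu> :: "nat list"
  assumes "0 \<notin> set \<mu>" "0 \<notin> set \<nu>" "\<And>k. sum_list (take k \<mu>) = sum_list (take k \<nu>)"
  shows "\<mu> = \<nu>"
  using assms
proof (induction \<mu> arbitrary: \<nu>)
  case Nil
  then show ?case using Nil.prems(3)[of 1] by (cases \<nu>) auto
next
  case (Cons a \<mu>)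
  then obtain b \<nu>' where \<nu>: "\<nu> = b # \<nu>'" using Cons.prems(3)[of 1] by (cases \<nu>) auto
  have ab: "a = b" using Cons.prems(3)[of 1] \<nu> by simp
  have "sum_list (take k \<mu>) = sum_list (take k \<nu>')" for k
    using Cons.prems(3)[of "Suc k"] \<nu> ab by simp
  then show ?case using Cons.IH[of \<nu>'] Cons.prems \<nu> ab by simp
qed

text \<open>Different lists of positive parts with the same total differ in some partial sum, and at
  an index up to that total, as neither has more parts. Adding up partial sums thus refines
  dominance to an order by natural numbers.\<close>

lemma dominance_key_less:
  assumes "0 \<notin> set \<mu>" "0 \<notin> set \<nu>" "sum_list \<mu> = sum_list \<nu>" "\<mu> \<noteq> \<nu>"
    and le: "\<And>k. sum_list (take k \<mu>) \<le> sum_list (take k \<nu>)"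
  shows "dominance_key \<mu> < dominance_key \<nu>"
proof -
  have "\<exists>k\<le>sum_list \<nu>. sum_list (take k \<mu>) < sum_list (take k \<nu>)"
  proof (rule ccontr)
    assume neg: "\<not> ?thesis"
    have "sum_list (take k \<mu>) = sum_list (take k \<nu>)" for k
    proof (cases "k \<le> sum_list \<nu>")
      case True
      then show ?thesis using neg le[of k] by (metis le_neq_implies_less)
    next
      case False
      then show ?thesis using assms length_le_sum_list[of \<mu>] length_le_sum_list[of \<nu>] by simp
    qed
    then show False using eq_of_partial_sums assms by blast
  qed
  then show ?thesis unfolding dominance_key_def assms(3)
    using le by (intro sum_strict_mono_ex1) auto
qed

text \<open>Take an index of largest key among those with nonzero coefficient. In its column every
  other term has a zero coefficient or a zero entry, so the equation says that its own coefficient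
  vanishes.\<close>

lemma unitriangular_inj:
  fixes U :: "'a \<Rightarrow> 'a \<Rightarrow> 'b::idom" and key :: "'a \<Rightarrow> nat"
  assumes T: "finite T" and diag: "\<And>t. t \<in> T \<Longrightarrow> U t t = 1"
    and tri: "\<And>s t. s \<in> T \<Longrightarrow> t \<in> T \<Longrightarrow> U s t \<noteq> 0 \<Longrightarrow> s \<noteq> t \<Longrightarrow> key t < key s"
    and zero: "\<And>t. t \<in> T \<Longrightarrow> (\<Sum>s\<in>T. e s * U s t) = 0" and t: "t \<in> T"
  shows "e t = 0"
proof (rule ccontr)
  assume "e t \<noteq> 0"
  define T' where "T' = {s \<in> T. e s \<noteq> 0}"
  have T': "finite T'" "T' \<noteq> {}" using T t \<open>e t \<noteq> 0\<close> unfolding T'_def by auto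
  then have "Max (key ` T') \<in> key ` T'" by (intro Max_in) auto
  then obtain m where m: "m \<in> T'" "key m = Max (key ` T')" by auto
  have max: "key s \<le> key m" if "s \<in> T'" for s using T' that m(2) by simp
  have mT: "m \<in> T" "e m \<noteq> 0" using m unfolding T'_def by auto
  have "(\<Sum>s\<in>T. e s * U s m) = (\<Sum>s\<in>T. if s = m then e m else 0)"
  proof (rule sum.cong[OF refl])
    fix s assume s: "s \<in> T"
    show "e s * U s m = (if s = m then e m else 0)"
    proof (cases "s = m \<or> e s = 0")
      case False
      then have "key s \<le> key m" using max[of s] s unfolding T'_def by blast
      then have "U s m = 0" using tri[OF s mT(1)] False by force
      then show ?thesis using False by simp
    qed (use diag[OF mT(1)] mT(2) in auto)
  qed
  then show False using zero[OF mT(1)] T mT by simp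
qed

text \<open>Back substitution: the index m added last has the largest key, and no other row reaches
  column m, so its coefficient is b m. The earlier equations are solved after subtracting its row,
  hence the arbitrary b in the induction.\<close>

lemma unitriangular_surj:
  fixes U :: "'a \<Rightarrow> 'a \<Rightarrow> 'b::idom" and key :: "'a \<Rightarrow> nat"
  assumes T: "finite T" and diag: "\<And>t. t \<in> T \<Longrightarrow> U t t = 1"
    and tri: "\<And>s t. s \<in> T \<Longrightarrow> t \<in> T \<Longrightarrow> U s t \<noteq> 0 \<Longrightarrow> s \<noteq> t \<Longrightarrow> key t < key s"
  shows "\<exists>e. \<forall>t\<in>T. (\<Sum>s\<in>T. e s * U s t) = b t"
  using assms
proof (induction T arbitrary: b rule: finite_ranking_induct[where f = key])
  case (insert m T)
  show ?case
  proof (cases "m \<in> T")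
    case True
    then show ?thesis using insert by (simp add: insert_absorb)
  next
    case False
    have "\<exists>e. \<forall>t\<in>T. (\<Sum>s\<in>T. e s * U s t) = b t - b m * U m t"
      using insert.prems by (intro insert.IH) auto
    then obtain e where e: "\<And>t. t \<in> T \<Longrightarrow> (\<Sum>s\<in>T. e s * U s t) = b t - b m * U m t" by blast
    let ?e = "e(m := b m)"
    have sum: "(\<Sum>s\<in>insert m T. ?e s * U s t) = b m * U m t + (\<Sum>s\<in>T. e s * U s t)" for t
    proof -
      have "(\<Sum>s\<in>T. ?e s * U s t) = (\<Sum>s\<in>T. e s * U s t)" using False by (intro sum.cong) auto
      then show ?thesis using False insert.hyps by simp
    qed
    have "U s m = 0" if "s \<in> T" for s
      using insert.prems(2)[of s m] insert.hyps(2)[of s] that False by fastforce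
    then have "(\<Sum>s\<in>T. e s * U s m) = 0" by simp
    then have "\<forall>t\<in>insert m T. (\<Sum>s\<in>insert m T. ?e s * U s t) = b t"
      unfolding sum using e insert.prems(1)[of m] by auto
    then show ?thesis by blast
  qed
qed simp

section \<open>Unitriangularity and the basis property\<close>

context affine
begin

text \<open>By \<open>lam_inj\<close> the description in \<open>Ftil_part\<close> denotes the very
  element produced by \<open>lam_surj\<close>, so the extra clauses of that lemma apply to
  it.\<close>

lemma Ftil_part_props:
  assumes la: "la \<in> Bn n"
  shows Ftil_part_Sym: "Ftil_part n la \<in> Sym"
    and Ftil_part_diag: "Ftil_part n la (part_monom la) = 1"
    and Ftil_part_tri: "\<mu> \<in> Bn n \<Longrightarrow> Ftil_part n la (part_monom \<mu>) \<noteq> 0 \<Longrightarrow>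
      sum_list \<mu> = sum_list la \<and> (\<mu> = la \<or> dominance_key \<mu> < dominance_key la)"
proof -
  obtain w where w: "aff_grass n w" "lam n w = la"
      "\<And>k. capped_code k (inv w) = sum_list (take k la)" "card (paths la (inv w)) = 1"
    using lam_surj[OF la] by blast
  have "(THE w. aff_grass n w \<and> lam n w = la) = w"
    by (rule the_equality) (use w lam_inj in auto)
  then have F: "Ftil_part n la = Ftil n w" by (simp add: Ftil_part_def)
  have aw: "affine_perm n w" using w unfolding aff_grass_def by blast
  show "Ftil_part n la \<in> Sym" unfolding F by (rule Ftil_Sym[OF aw])
  have Fm: "Ftil n w (part_monom \<mu>) = int (card (paths \<mu> (inv w)))" for \<mu>
    using Ftil_eq_card_paths[OF aw, of "length \<mu>" "part_monom \<mu>", OF part_monom_beyond] by (simp only: map_part_monom)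
  show "Ftil_part n la (part_monom la) = 1" using Fm w F by simp
  have sums: "sum_list \<mu> = ninv (inv w) \<and> (\<forall>k. sum_list (take k \<mu>) \<le> sum_list (take k la))"
    if ne: "paths \<mu> (inv w) \<noteq> {}" for \<mu>
  proof -
    obtain As where As: "admissible As" "map card As = \<mu>" "path_end As = inv w"
      using ne unfolding paths_def by blast
    then show ?thesis
      using ninv_path_end[OF admissible_proper[OF As(1)]] sum_take_admissible[OF As(1)] w(3) by metis
  qed
  assume \<mu>: "\<mu> \<in> Bn n" and "Ftil_part n la (part_monom \<mu>) \<noteq> 0"
  then have s: "sum_list \<mu> = ninv (inv w)" "\<And>k. sum_list (take k \<mu>) \<le> sum_list (take k la)"
    using sums[of \<mu>] F Fm by force+
  moreover have "sum_list la = ninv (inv w)" using sums[of la] w(4) by force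
  ultimately show "sum_list \<mu> = sum_list la \<and> (\<mu> = la \<or> dominance_key \<mu> < dominance_key la)"
    using dominance_key_less[of \<mu> la] \<mu> la unfolding Bn_def is_partition_def by auto
qed

text \<open>Membership in the ideal becomes a linear system indexed by \<open>Bn n\<close>. The set
  T may exceed the support, so that several solutions can be compared over one finite index
  set.\<close>

lemma In_ideal_diff_iff:
  assumes f: "f \<in> Sym" and T: "finite T" "{la. c la \<noteq> 0} \<subseteq> T" "T \<subseteq> Bn n"
  shows "(\<lambda>\<alpha>. f \<alpha> - (\<Sum>la\<in>{la. c la \<noteq> 0}. c la * Ftil_part n la \<alpha>)) \<in> In_ideal n \<longleftrightarrow>
    (\<forall>\<mu>\<in>Bn n. (\<Sum>la\<in>T. c la * Ftil_part n la (part_monom \<mu>)) = f (part_monom \<mu>))"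
proof -
  have eq: "(\<Sum>la\<in>{la. c la \<noteq> 0}. c la * Ftil_part n la \<alpha>) = (\<Sum>la\<in>T. c la * Ftil_part n la \<alpha>)" for \<alpha>
    using T by (intro sum.mono_neutral_left) auto
  have S: "(\<lambda>\<alpha>. f \<alpha> - (\<Sum>la\<in>T. c la * Ftil_part n la \<alpha>)) \<in> Sym"
    by (rule Sym_diff_sum[OF T(1) f]) (use Ftil_part_Sym T in auto)
  show ?thesis unfolding eq using In_ideal_part_monom[of _ n] In_idealI[OF S, of n] by fastforce
qed

lemma Ftil_part_basis:
  assumes f: "f \<in> Sym"
  shows "\<exists>!c. finite {la. c la \<noteq> 0} \<and> {la. c la \<noteq> 0} \<subseteq> Bn n \<and>
    (\<lambda>\<alpha>. f \<alpha> - (\<Sum>la\<in>{la. c la \<noteq> 0}. c la * Ftil_part n la \<alpha>)) \<in> In_ideal n"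
proof -
  let ?U = "\<lambda>la \<mu>. Ftil_part n la (part_monom \<mu>)"
  have tri: "dominance_key t < dominance_key s" if "T \<subseteq> Bn n" "s \<in> T" "t \<in> T" "?U s t \<noteq> 0" "s \<noteq> t" for s t T
    using that Ftil_part_tri[of s t] by auto
  obtain d where d: "\<And>\<alpha>. f \<alpha> \<noteq> 0 \<Longrightarrow> mdeg \<alpha> \<le> d" using f unfolding Sym_def by blast
  \<comment> \<open>The degree of f is at most d, and coefficients of \<open>Ftil_part n la\<close>
    occur only at partitions of the size of la. Equations at larger partitions then read 0 = 0,
    which leaves a finite system.\<close>
  define T where "T = {\<mu> \<in> Bn n. sum_list \<mu> \<le> d}"
  have T: "finite T" "T \<subseteq> Bn n"
    using finite_subset[OF _ finite_partitions[of d], of T] unfolding T_def Bn_def by auto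
  obtain e where e: "\<And>t. t \<in> T \<Longrightarrow> (\<Sum>s\<in>T. e s * ?U s t) = f (part_monom t)"
    using unitriangular_surj[OF T(1), of ?U dominance_key "\<lambda>t. f (part_monom t)"]
      Ftil_part_diag tri[OF T(2)] T(2) by blast
  define c where "c la = (if la \<in> T then e la else 0)" for la
  have cT: "{la. c la \<noteq> 0} \<subseteq> T" unfolding c_def by auto
  have c: "(\<Sum>la\<in>T. c la * ?U la \<mu>) = f (part_monom \<mu>)" if \<mu>: "\<mu> \<in> Bn n" for \<mu>
  proof (cases "\<mu> \<in> T")
    case True
    then show ?thesis using e[of \<mu>] by (simp add: c_def)
  next
    case False
    then have gt: "sum_list \<mu> > d" using \<mu> unfolding T_def by simp
    then have "?U la \<mu> = 0" if "la \<in> T" for la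
      using Ftil_part_tri[of la \<mu>] that \<mu> unfolding T_def by force
    moreover have "f (part_monom \<mu>) = 0" using d[of "part_monom \<mu>"] mdeg_part_monom[of \<mu>] gt by force
    ultimately show ?thesis by simp
  qed
  show ?thesis
  proof (rule ex1I[of _ c])
    show "finite {la. c la \<noteq> 0} \<and> {la. c la \<noteq> 0} \<subseteq> Bn n \<and>
      (\<lambda>\<alpha>. f \<alpha> - (\<Sum>la\<in>{la. c la \<noteq> 0}. c la * Ftil_part n la \<alpha>)) \<in> In_ideal n"
      using In_ideal_diff_iff[OF f T(1) cT T(2)] finite_subset[OF cT T(1)] cT T(2) c by blast
  next
    fix c' assume sol: "finite {la. c' la \<noteq> 0} \<and> {la. c' la \<noteq> 0} \<subseteq> Bn n \<and>
      (\<lambda>\<alpha>. f \<alpha> - (\<Sum>la\<in>{la. c' la \<noteq> 0}. c' la * Ftil_part n la \<alpha>)) \<in> In_ideal n"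
    \<comment> \<open>A competing solution may involve partitions larger than d, so the comparison
      takes place on a set that contains both supports.\<close>
    define T' where "T' = T \<union> {la. c' la \<noteq> 0}"
    have T': "finite T'" "T' \<subseteq> Bn n" "{la. c la \<noteq> 0} \<subseteq> T'" "{la. c' la \<noteq> 0} \<subseteq> T'"
      using T sol cT unfolding T'_def by auto
    have c': "(\<Sum>la\<in>T'. c la * ?U la \<mu>) = f (part_monom \<mu>)" if "\<mu> \<in> Bn n" for \<mu>
    proof -
      have "(\<Sum>la\<in>T'. c la * ?U la \<mu>) = (\<Sum>la\<in>T. c la * ?U la \<mu>)"
        by (rule sum.mono_neutral_right) (use T' in \<open>auto simp: T'_def c_def\<close>)
      then show ?thesis using c[OF that] by simp
    qed
    have c'': "(\<Sum>la\<in>T'. c' la * ?U la \<mu>) = f (part_monom \<mu>)" if "\<mu> \<in> Bn n" for \<mu>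
      using In_ideal_diff_iff[OF f T'(1,4,2)] sol that by blast
    have "c' la - c la = 0" if "la \<in> T'" for la
    proof (rule unitriangular_inj[OF T'(1), of ?U dominance_key "\<lambda>la. c' la - c la"])
      show "(\<Sum>s\<in>T'. (c' s - c s) * ?U s t) = 0" if "t \<in> T'" for t
        using c'[of t] c''[of t] that T'(2) by (auto simp: left_diff_distrib sum_subtractf)
    qed (use that T'(2) Ftil_part_diag tri[OF T'(2)] in auto)
    then show "c' = c" using T' by (intro ext) (metis (mono_tags, lifting) eq_iff_diff_eq_0 mem_Collect_eq subsetD)
  qed
qed

end

theorem theorem3p5:
  fixes n :: nat
  assumes "n > 2"
  shows "(\<forall>la\<in>Bn n. Ftil_part n la \<in> Sym) \<and>
         (\<forall>f\<in>Sym. \<exists>!c :: nat list \<Rightarrow> int.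
             finite {la. c la \<noteq> 0} \<and> {la. c la \<noteq> 0} \<subseteq> Bn n \<and>
             (\<lambda>\<alpha>. f \<alpha> - (\<Sum>la\<in>{la. c la \<noteq> 0}. c la * Ftil_part n la \<alpha>)) \<in> In_ideal n)"
proof -
  interpret affine n by standard (rule assms)
  show ?thesis using Ftil_part_Sym Ftil_part_basis by blast
qed

end
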